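(* Let $(X,d_X)$ be a compact geodesic space and let $f: X \to \mathbb{R}$ be a $1$-Lipschitz function. Then the Reeb metric graph $(R_f,d_f)$ is a compact geodesic space with Lebesgue covering dimension at most one. Furthermore, if $b_1(X) < \infty$, then $R_f$ has a core $G$ such that $G$ is a finite metric graph and $b_1(G) \leq b_1(X)$.
   Context: Geodesic space: a metric space in which any two points are joined by a path whose length equals their distance. $b_1$ denotes the first Betti number, i.e. the dimension of first singular homology with real coefficients. Reeb metric graph: $R_f$ is the topological quotient of $X$ identifying points that lie in the same connected component of a fiber $f^{-1}(c)$, $c\in\mathbb{R}$; the class of $x$ is $[x]$, and $\bar f: R_f\to\mathbb{R}$, $\bar f([x])=f(x)$. The Reeb metric on $R_f$ is $d_f([x],[y]) := \inf_\beta \mathrm{length}_{\mathbb{R}}(\bar f\circ\beta)$, where $\beta$ ranges over all continuous paths in $R_f$ (quotient topology) from $[x]$ to $[y]$, and $\mathrm{length}_{\mathbb{R}}$ is the length (total variation) of a path in $\mathbb{R}$. Lebesgue covering dimension at most $n$: every open cover has an open refinement such that every point lies in at most $n+1$ members of the refinement. Quotient metric space: for a subspace $A$ of a metric space $(Z,d_Z)$, $Z/A$ is the quotient of $Z$ by the relation $x\sim y$ iff $x=y$ or $x,y\in A$, with metric $d_A([x],[y])=\inf\sum_{i=1}^n d_Z(p_i,q_i)$, the infimum taken over all $n$ and all $p_1,q_1,\dots,p_n,q_n\in Z$ with $p_1=x$, $q_n=y$, $q_i\sim p_{i+1}$ (points at distance $0$ identified). Metric tree: a geodesic space in which, up to reparametrization,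 there is a unique simple (injective) path between each pair of points. Core: a closed subspace $A$ of a compact metric space $Z$ is a core of $Z$ if $Z/A$ is a metric tree. A finite graph is a topological space admitting the structure of a finite CW-complex of dimension at most one (a single point is allowed). A finite metric graph is a geodesic space homeomorphic to a finite graph; $G$ carries the metric restricted from $(R_f,d_f)$. *)

theory Defs
  imports "HOL-Analysis.Analysis" "HOL-Analysis.Finite_Function_Topology"
    "HOL-Homology.Homology"
begin

section \<open>Length and geodesic spaces\<close>

definition path_length :: "('a \<Rightarrow> 'a \<Rightarrow> real) \<Rightarrow> (real \<Rightarrow> 'a) \<Rightarrow> ennreal" where
  "path_length d \<gamma> =
    (SUP (n, t) \<in> {(n::nat, t::nat \<Rightarrow> real). mono t \<and> range t \<subseteq> {0..1}}.
       \<Sum>i<n. ennreal (d (\<gamma> (t i)) (\<gamma> (t (Suc i)))))"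

definition geodesic_space :: "'a set \<Rightarrow> ('a \<Rightarrow> 'a \<Rightarrow> real) \<Rightarrow> bool" where
  "geodesic_space M d \<longleftrightarrow> Metric_space M d \<and>
    (\<forall>x\<in>M. \<forall>y\<in>M. \<exists>\<gamma>. pathin (Metric_space.mtopology M d) \<gamma> \<and> \<gamma> 0 = x \<and> \<gamma> 1 = y \<and>
       path_length d \<gamma> = ennreal (d x y))"

definition compact_metric_space :: "'a set \<Rightarrow> ('a \<Rightarrow> 'a \<Rightarrow> real) \<Rightarrow> bool" where
  "compact_metric_space M d \<longleftrightarrow>
    Metric_space M d \<and> compact_space (Metric_space.mtopology M d)"

section \<open>Reeb graph\<close>

definition quotient_topology :: "'a topology \<Rightarrow> ('a \<Rightarrow> 'b) \<Rightarrow> 'b topology" where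
  "quotient_topology X q =
    topology (\<lambda>U. U \<subseteq> q ` topspace X \<and> openin X {x \<in> topspace X. q x \<in> U})"

lemma openin_quotient_topology:
  "openin (quotient_topology X q) U \<longleftrightarrow>
    U \<subseteq> q ` topspace X \<and> openin X {x \<in> topspace X. q x \<in> U}"
proof -
  have "istopology (\<lambda>U. U \<subseteq> q ` topspace X \<and> openin X {x \<in> topspace X. q x \<in> U})"
    unfolding istopology_def
  proof (intro conjI allI impI)
    fix S T
    assume S: "S \<subseteq> q ` topspace X \<and> openin X {x \<in> topspace X. q x \<in> S}"
      and T: "T \<subseteq> q ` topspace X \<and> openin X {x \<in> topspace X. q x \<in> T}"
    show "S \<inter> T \<subseteq> q ` topspace X" using S by blast
    have "{x \<in> topspace X. q x \<in> S \<inter> T} =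
        {x \<in> topspace X. q x \<in> S} \<inter> {x \<in> topspace X. q x \<in> T}"
      by blast
    with S T show "openin X {x \<in> topspace X. q x \<in> S \<inter> T}" by auto
  next
    fix K
    assume K: "\<forall>S\<in>K. S \<subseteq> q ` topspace X \<and> openin X {x \<in> topspace X. q x \<in> S}"
    then show "\<Union>K \<subseteq> q ` topspace X" by blast
    have "{x \<in> topspace X. q x \<in> \<Union>K} = (\<Union>S\<in>K. {x \<in> topspace X. q x \<in> S})"
      by blast
    with K show "openin X {x \<in> topspace X. q x \<in> \<Union>K}" by auto
  qed
  then show ?thesis
    by (simp add: quotient_topology_def topology_inverse')
qed

lemma topspace_quotient_topology [simp]:
  "topspace (quotient_topology X q) = q ` topspace X"
proof
  show "topspace (quotient_topology X q) \<subseteq> q ` topspace X"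
    using openin_quotient_topology openin_topspace by metis
  have "{x \<in> topspace X. q x \<in> q ` topspace X} = topspace X" by blast
  then have "openin (quotient_topology X q) (q ` topspace X)"
    by (simp add: openin_quotient_topology)
  then show "q ` topspace X \<subseteq> topspace (quotient_topology X q)"
    by (rule openin_subset)
qed

lemma quotient_map_quotient_topology: "quotient_map X (quotient_topology X q) q"
  by (auto simp: quotient_map_def openin_quotient_topology)

definition reeb_class :: "'a set \<Rightarrow> ('a \<Rightarrow> 'a \<Rightarrow> real) \<Rightarrow> ('a \<Rightarrow> real) \<Rightarrow> 'a \<Rightarrow> 'a set" where
  "reeb_class M d f x =
    connected_component_of_set
      (subtopology (Metric_space.mtopology M d) {y \<in> M. f y = f x}) x"

definition reeb_space :: "'a set \<Rightarrow> ('a \<Rightarrow> 'a \<Rightarrow> real) \<Rightarrow> ('a \<Rightarrow> real) \<Rightarrow> 'a set set" where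
  "reeb_space M d f = reeb_class M d f ` M"

definition reeb_topology :: "'a set \<Rightarrow> ('a \<Rightarrow> 'a \<Rightarrow> real) \<Rightarrow> ('a \<Rightarrow> real) \<Rightarrow> 'a set topology" where
  "reeb_topology M d f = quotient_topology (Metric_space.mtopology M d) (reeb_class M d f)"

definition reeb_fun :: "('a \<Rightarrow> real) \<Rightarrow> 'a set \<Rightarrow> real" where
  "reeb_fun f C = f (SOME x. x \<in> C)"

text \<open>If no path of finite length joined two distinct points, this definition would give
  them distance \<open>0\<close>, so \<open>Metric_space\<close> for it entails that the infimum is finite.\<close>

definition reeb_dist ::
  "'a set \<Rightarrow> ('a \<Rightarrow> 'a \<Rightarrow> real) \<Rightarrow> ('a \<Rightarrow> real) \<Rightarrow> 'a set \<Rightarrow> 'a set \<Rightarrow> real" where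
  "reeb_dist M d f C D = enn2real
    (INF \<beta> \<in> {\<beta>. pathin (reeb_topology M d f) \<beta> \<and> \<beta> 0 = C \<and> \<beta> 1 = D}.
       path_length dist (reeb_fun f \<circ> \<beta>))"

section \<open>Covering dimension\<close>

definition covering_dim_le :: "'a topology \<Rightarrow> nat \<Rightarrow> bool" where
  "covering_dim_le X n \<longleftrightarrow>
    (\<forall>\<U>. (\<forall>U\<in>\<U>. openin X U) \<and> \<Union>\<U> = topspace X \<longrightarrow>
      (\<exists>\<V>. (\<forall>V\<in>\<V>. openin X V) \<and> \<Union>\<V> = topspace X \<and> (\<forall>V\<in>\<V>. \<exists>U\<in>\<U>. V \<subseteq> U) \<and>
        (\<forall>x\<in>topspace X. finite {V\<in>\<V>. x \<in> V} \<and> card {V\<in>\<V>. x \<in> V} \<le> n + 1)))"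

section \<open>Quotient metric spaces, metric trees and cores\<close>

definition identified :: "'a set \<Rightarrow> 'a \<Rightarrow> 'a \<Rightarrow> bool" where
  "identified A x y \<longleftrightarrow> x = y \<or> x \<in> A \<and> y \<in> A"

text \<open>\<open>Metric_space\<close> requires nonnegativity and symmetry also outside the carrier, hence the
  value \<open>0\<close> there.\<close>

definition glue_dist :: "'a set \<Rightarrow> ('a \<Rightarrow> 'a \<Rightarrow> real) \<Rightarrow> 'a set \<Rightarrow> 'a \<Rightarrow> 'a \<Rightarrow> real" where
  "glue_dist Z d A x y = (if x \<in> Z \<and> y \<in> Z then
     Inf {(\<Sum>i=1..n. d (p i) (q i)) | (n::nat) p q.
       1 \<le> n \<and> (\<forall>i\<in>{1..n}. p i \<in> Z \<and> q i \<in> Z) \<and> p 1 = x \<and> q n = y \<and>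
       (\<forall>i\<in>{1..<n}. identified A (q i) (p (Suc i)))} else 0)"

text \<open>\<open>glue_dist\<close> vanishes on identified points, so the classes of the zero-distance relation
  realise both the quotient by \<open>identified A\<close> and the identification of points at distance \<open>0\<close>.\<close>

definition glue_class :: "'a set \<Rightarrow> ('a \<Rightarrow> 'a \<Rightarrow> real) \<Rightarrow> 'a set \<Rightarrow> 'a \<Rightarrow> 'a set" where
  "glue_class Z d A x = {y \<in> Z. glue_dist Z d A x y = 0}"

definition glue_space :: "'a set \<Rightarrow> ('a \<Rightarrow> 'a \<Rightarrow> real) \<Rightarrow> 'a set \<Rightarrow> 'a set set" where
  "glue_space Z d A = glue_class Z d A ` Z"

definition glue_metric ::
  "'a set \<Rightarrow> ('a \<Rightarrow> 'a \<Rightarrow> real) \<Rightarrow> 'a set \<Rightarrow> 'a set \<Rightarrow> 'a set \<Rightarrow> real" where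
  "glue_metric Z d A C D = glue_dist Z d A (SOME x. x \<in> C) (SOME y. y \<in> D)"

definition simple_path_between :: "'a topology \<Rightarrow> 'a \<Rightarrow> 'a \<Rightarrow> (real \<Rightarrow> 'a) \<Rightarrow> bool" where
  "simple_path_between X x y \<gamma> \<longleftrightarrow> pathin X \<gamma> \<and> inj_on \<gamma> {0..1} \<and> \<gamma> 0 = x \<and> \<gamma> 1 = y"

text \<open>For \<open>x = y\<close> the only simple path is the one on a degenerate interval, which the
  parametrization by \<open>[0, 1]\<close> does not represent; hence the restriction to \<open>x \<noteq> y\<close>.\<close>

definition metric_tree :: "'a set \<Rightarrow> ('a \<Rightarrow> 'a \<Rightarrow> real) \<Rightarrow> bool" where
  "metric_tree M d \<longleftrightarrow> geodesic_space M d \<and>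
    (\<forall>x\<in>M. \<forall>y\<in>M. x \<noteq> y \<longrightarrow>
      (\<exists>\<gamma>. simple_path_between (Metric_space.mtopology M d) x y \<gamma>) \<and>
      (\<forall>\<gamma> \<delta>. simple_path_between (Metric_space.mtopology M d) x y \<gamma> \<and>
             simple_path_between (Metric_space.mtopology M d) x y \<delta> \<longrightarrow>
        (\<exists>\<phi> \<psi>. homeomorphism {0..1::real} {0..1::real} \<phi> \<psi> \<and> (\<forall>t\<in>{0..1}. \<delta> t = \<gamma> (\<phi> t)))))"

text \<open>Collapsing \<open>A\<close> to a point presupposes that \<open>A\<close> is nonempty; the empty set is admitted
  only as the core of the empty space.\<close>

definition is_core :: "'a set \<Rightarrow> ('a \<Rightarrow> 'a \<Rightarrow> real) \<Rightarrow> 'a set \<Rightarrow> bool" where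
  "is_core Z d A \<longleftrightarrow> compact_metric_space Z d \<and>
    closedin (Metric_space.mtopology Z d) A \<and> (A = {} \<longrightarrow> Z = {}) \<and>
    metric_tree (glue_space Z d A) (glue_metric Z d A)"

section \<open>Finite graphs\<close>

text \<open>A finite CW structure of dimension at most one: \<open>V\<close> is the set of 0-cells, \<open>\<Phi>\<close> the set of
  characteristic maps of the 1-cells. For finitely many cells in a Hausdorff space the weak
  topology condition is automatic. A space homeomorphic to one with such a structure
  carries such a structure itself.\<close>

definition finite_graph :: "'a topology \<Rightarrow> bool" where
  "finite_graph X \<longleftrightarrow> Hausdorff_space X \<and>
    (\<exists>V \<Phi>. finite V \<and> V \<subseteq> topspace X \<and> finite \<Phi> \<and>
      (\<forall>\<phi>\<in>\<Phi>. pathin X \<phi> \<and> \<phi> 0 \<in> V \<and> \<phi> 1 \<in> V \<and>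
         embedding_map (top_of_set {0<..<1::real}) X \<phi> \<and> \<phi> ` {0<..<1} \<inter> V = {}) \<and>
      (\<forall>\<phi>\<in>\<Phi>. \<forall>\<psi>\<in>\<Phi>. \<phi> \<noteq> \<psi> \<longrightarrow> \<phi> ` {0<..<1} \<inter> \<psi> ` {0<..<1} = {}) \<and>
      topspace X = V \<union> (\<Union>\<phi>\<in>\<Phi>. \<phi> ` {0<..<1}))"

definition finite_metric_graph :: "'a set \<Rightarrow> ('a \<Rightarrow> 'a \<Rightarrow> real) \<Rightarrow> bool" where
  "finite_metric_graph M d \<longleftrightarrow>
    geodesic_space M d \<and> finite_graph (Metric_space.mtopology M d)"

section \<open>Singular homology with real coefficients\<close>

type_synonym 'a real_chain = "((nat \<Rightarrow> real) \<Rightarrow> 'a) \<Rightarrow>\<^sub>0 real"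

definition real_chains :: "nat \<Rightarrow> 'a topology \<Rightarrow> 'a real_chain set" where
  "real_chains p X = {c. Poly_Mapping.keys c \<subseteq> singular_simplex_set p X}"

definition real_boundary :: "nat \<Rightarrow> 'a real_chain \<Rightarrow> 'a real_chain" where
  "real_boundary p c =
    (if p = 0 then 0 else
     \<Sum>\<sigma>\<in>Poly_Mapping.keys c. \<Sum>k\<le>p.
       Poly_Mapping.single (singular_face p k \<sigma>) ((-1) ^ k * Poly_Mapping.lookup c \<sigma>))"

definition real_cycles :: "nat \<Rightarrow> 'a topology \<Rightarrow> 'a real_chain set" where
  "real_cycles p X = {c \<in> real_chains p X. real_boundary p c = 0}"

definition real_boundaries :: "nat \<Rightarrow> 'a topology \<Rightarrow> 'a real_chain set" where
  "real_boundaries p X = real_boundary (Suc p) ` real_chains (Suc p) X"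

text \<open>\<open>S\<close> is a finite set of cycles representing a basis of the real vector space
  \<open>H\<^sub>p(X; \<real>) = Z\<^sub>p / B\<^sub>p\<close>.\<close>

definition real_homology_basis :: "nat \<Rightarrow> 'a topology \<Rightarrow> 'a real_chain set \<Rightarrow> bool" where
  "real_homology_basis p X S \<longleftrightarrow> finite S \<and> S \<subseteq> real_cycles p X \<and>
    (\<forall>z\<in>real_cycles p X. \<exists>a. z - (\<Sum>s\<in>S. a s *\<^sub>R s) \<in> real_boundaries p X) \<and>
    (\<forall>a. (\<Sum>s\<in>S. a s *\<^sub>R s) \<in> real_boundaries p X \<longrightarrow> (\<forall>s\<in>S. a s = 0))"

text \<open>All bases have the same cardinality; without a finite basis the infimum over the empty
  set is \<open>\<infinity>\<close>.\<close>

definition betti :: "nat \<Rightarrow> 'a topology \<Rightarrow> enat" where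
  "betti p X = (INF S \<in> {S. real_homology_basis p X S}. enat (card S))"

end

theory Submission
  imports Defs
begin

text \<open>
  The projection \<open>q\<close> of the space \<open>M\<close> onto its Reeb space \<open>R\<close> is monotone and closed, and this makes the
  induced function \<open>fb\<close> on \<open>R\<close> \<^emph>\<open>light\<close>: a connected set contained in one of its fibres has at most one
  point. Almost everything is extracted from lightness together with compactness.

  \<^bold>\<open>Metric.\<close> Two points of a fibre \<open>f = c\<close> in different components have disjoint open neighbourhoods
  that cover a whole slab \<open>\<bar>f - c\<bar> \<le> \<epsilon>\<close> (\<open>fibre_separation\<close>). A path between the two classes therefore
  has to leave the slab, which bounds the Reeb distance of distinct points from below
  (\<open>reeb_level_separation\<close>). So the Reeb distance is a metric, \<open>q\<close> is 1-Lipschitz for it, and since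
  a continuous surjection from a compact onto a Hausdorff space is a quotient map, metric and
  quotient topology agree (\<open>reeb_topology_eq\<close>). The distance being an infimum of lengths, there are
  approximate midpoints, hence by compactness midpoints, hence geodesics
  (\<open>isometric_path_if_midpoints\<close>).

  \<^bold>\<open>Dimension.\<close> Near each level, a compact space with a light function is a disjoint union of small open
  sets. Using these pieces over overlapping intervals of the line, at most two of which contain a
  given number, gives refinements of order two (\<open>covering_dim_le_1\<close>).

  \<^bold>\<open>Core.\<close> An arc complex of rank \<open>k\<close> is obtained from a point by attaching finitely many arcs,
  \<open>k\<close> of them with both ends on what is already there. It is a finite graph, and an induction over
  the attachments shows that its first Betti number is at most \<open>k\<close> (\<open>arc_complex_betti_le\<close>).

  Conversely, lightness yields many circle-valued maps: if \<open>f\<close> takes different values at the ends of an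
  arc, there is a map into the circle that winds along this arc by following a ramp of \<open>f\<close> across a
  level, and that is constantly \<open>1\<close> on a given closed set meeting the arc only at its ends
  (\<open>circle_map_winding_path\<close>). Circle-valued maps have winding numbers along 1-cycles, which vanish
  on boundaries. For an arc complex in \<open>R\<close> of rank \<open>k\<close>, the \<open>k\<close> arcs with both ends attached produce
  \<open>k\<close> such maps, which, composed with \<open>q\<close>, have linearly independent winding functionals on the
  cycles of \<open>M\<close>: a relation among them would give a potential on \<open>M\<close>, that potential is constant on
  the classes because these are connected, and so it descends to \<open>R\<close> (\<open>potential_descends\<close>), where
  only the trivial relation admits one (\<open>arc_complex_independent_windings\<close>).
  Therefore \<open>k\<close> is at most the first Betti number of \<open>M\<close> (\<open>arc_complex_le_betti\<close>).

  If that number is finite, an arc complex \<open>G\<close> of greatest rank exists, and it is the core. A geodesic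
  between two of its points stays inside it, since an excursion could be attached and would
  raise the rank; so \<open>G\<close> is itself geodesic. Every circle-valued map that is \<open>1\<close> on \<open>G\<close> lifts to
  a real function, because finitely many geodesics, each starting on the complex built so far, can
  be added to \<open>G\<close> by attaching only arcs with a free end (\<open>circle_map_lifts\<close>). If \<open>R/G\<close> had two
  simple paths with the same ends but different images, a circle-valued map would wind along a piece
  of one of them and be trivial on the rest and on \<open>G\<close>; its lift would take different values at the
  ends of the piece and equal ones by going around the other way, a contradiction
  (\<open>simple_path_image_subset\<close>).
\<close>

section \<open>Circle-valued maps that wind across a level\<close>

lemma level_gap:
  assumes "compact_space Y" "continuous_map Y euclideanreal f" "closedin Y K" "\<And>x. x \<in> K \<Longrightarrow> f x \<noteq> c"
  obtains \<delta> where "\<delta> > 0" "\<And>x. x \<in> K \<Longrightarrow> \<delta> \<le> \<bar>f x - c\<bar>"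
proof -
  have "compactin Y K" using assms closedin_compact_space by blast
  then have "compact (f ` K)" using assms(2) image_compactin by fastforce
  then have "open (- (f ` K))" using compact_imp_closed by blast
  moreover have "c \<in> - (f ` K)" using assms(4) by auto
  ultimately obtain e where e: "e > 0" "ball c e \<subseteq> - (f ` K)" by (meson openE)
  have "e \<le> \<bar>f x - c\<bar>" if "x \<in> K" for x
  proof -
    have "f x \<notin> ball c e" using e(2) that by blast
    then show ?thesis by (simp add: dist_real_def abs_minus_commute)
  qed
  then show ?thesis using that e(1) by blast
qed

text \<open>Inside the compact fibre over \<open>c\<close>, components and quasi-components coincide (the cut wire fence
  theorem), so the fibre splits into two closed pieces containing the traces of \<open>A\<close> and \<open>B\<close>.
  Normality thickens the pieces to disjoint open sets, and by compactness these still cover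
  and still capture \<open>A\<close> and \<open>B\<close> at all levels close to \<open>c\<close>. The bound \<open>\<eta>\<close> lets the slab be taken as
  thin as an application requires.\<close>

lemma fibre_separation:
  fixes f :: "'b \<Rightarrow> real"
  assumes Y: "compact_space Y" "Hausdorff_space Y" and f: "continuous_map Y euclideanreal f"
    and A: "closedin Y A" and B: "closedin Y B" and "\<eta> > 0"
    and dis: "\<And>C. connectedin Y C \<Longrightarrow> C \<subseteq> {x \<in> topspace Y. f x = c} \<Longrightarrow> disjnt C A \<or> disjnt C B"
  obtains \<epsilon> U V where "0 < \<epsilon>" "\<epsilon> \<le> \<eta>" "openin Y U" "openin Y V" "disjnt U V"
    "{x \<in> topspace Y. \<bar>f x - c\<bar> \<le> \<epsilon>} \<subseteq> U \<union> V"
    "\<And>x. x \<in> A \<Longrightarrow> \<bar>f x - c\<bar> \<le> \<epsilon> \<Longrightarrow> x \<in> U"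
    "\<And>x. x \<in> B \<Longrightarrow> \<bar>f x - c\<bar> \<le> \<epsilon> \<Longrightarrow> x \<in> V"
proof -
  define F where "F = {x \<in> topspace Y. f x = c}"
  have clF: "closedin Y F"
    using closedin_continuous_map_preimage[OF f, of "{c}"] by (simp add: F_def)
  have FY: "F \<subseteq> topspace Y" by (auto simp: F_def)
  have "separated_between (subtopology Y F) (A \<inter> F) (B \<inter> F)"
  proof (rule cut_wire_fence_theorem)
    show "compact_space (subtopology Y F)"
      using Y clF closedin_compact_space compact_space_subtopology by blast
    show "Hausdorff_space (subtopology Y F)" using Y Hausdorff_space_subtopology by blast
    show "closedin (subtopology Y F) (A \<inter> F)" "closedin (subtopology Y F) (B \<inter> F)"
      using A B closedin_subtopology by blast+
    show "disjnt C (A \<inter> F) \<or> disjnt C (B \<inter> F)" if "connectedin (subtopology Y F) C" for C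
      using dis[of C] that by (auto simp: connectedin_subtopology F_def disjnt_def)
  qed
  then obtain W where W: "closedin (subtopology Y F) W" "openin (subtopology Y F) W"
    "A \<inter> F \<subseteq> W" "B \<inter> F \<subseteq> topspace (subtopology Y F) - W"
    unfolding separated_between by blast
  have tF: "topspace (subtopology Y F) = F" using FY by auto
  have W1: "closedin Y W" using W(1) clF closedin_trans_full by blast
  have W2: "closedin Y (F - W)"
    using W(2) clF closedin_trans_full tF by (metis closedin_diff closedin_topspace)
  have "normal_space Y" using Y compact_Hausdorff_or_regular_imp_normal_space by blast
  then obtain U V where UV: "openin Y U" "openin Y V" "W \<subseteq> U" "F - W \<subseteq> V" "disjnt U V"
    unfolding normal_space_def using W1 W2 by (metis Diff_disjoint disjnt_def)
  define K where "K = (topspace Y - (U \<union> V)) \<union> (A - U) \<union> (B - V)"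
  have clK: "closedin Y K" unfolding K_def using UV A B
    by (intro closedin_Un closedin_diff openin_Un) auto
  have "f x \<noteq> c" if "x \<in> K" for x
  proof -
    have "x \<notin> F" using that W UV tF unfolding K_def by auto
    moreover have "x \<in> topspace Y" using that closedin_subset[OF clK] by blast
    ultimately show ?thesis by (auto simp: F_def)
  qed
  then obtain e where e: "e > 0" "\<And>x. x \<in> K \<Longrightarrow> e \<le> \<bar>f x - c\<bar>"
    using level_gap[OF Y(1) f clK] by metis
  define \<epsilon> where "\<epsilon> = min (e/2) \<eta>"
  have notK: "x \<notin> K" if "\<bar>f x - c\<bar> \<le> \<epsilon>" for x
  proof
    assume "x \<in> K"
    then show False using that e(1) e(2)[of x] by (auto simp: \<epsilon>_def)
  qed
  show ?thesis
  proof
    show "0 < \<epsilon>" "\<epsilon> \<le> \<eta>" using e(1) \<open>\<eta> > 0\<close> by (auto simp: \<epsilon>_def)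
    show "{x \<in> topspace Y. \<bar>f x - c\<bar> \<le> \<epsilon>} \<subseteq> U \<union> V" using notK by (auto simp: K_def)
    show "x \<in> U" if "x \<in> A" "\<bar>f x - c\<bar> \<le> \<epsilon>" for x using notK[OF that(2)] that by (auto simp: K_def)
    show "x \<in> V" if "x \<in> B" "\<bar>f x - c\<bar> \<le> \<epsilon>" for x using notK[OF that(2)] that by (auto simp: K_def)
  qed (use UV in auto)
qed

text \<open>A ramp whose image under the exponential goes once around the circle while \<open>s\<close> crosses the
  interval \<open>[c - \<epsilon>, c + \<epsilon>]\<close>, and rests at \<open>1\<close> outside.\<close>

definition level_ramp :: "real \<Rightarrow> real \<Rightarrow> real \<Rightarrow> real" where
  "level_ramp c \<epsilon> s = max 0 (min 1 ((s - c + \<epsilon>) / (2 * \<epsilon>)))"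

lemma level_ramp_low: "\<epsilon> > 0 \<Longrightarrow> s \<le> c - \<epsilon> \<Longrightarrow> level_ramp c \<epsilon> s = 0"
  by (auto simp: level_ramp_def max_def min_def divide_simps)

lemma level_ramp_high: "\<epsilon> > 0 \<Longrightarrow> c + \<epsilon> \<le> s \<Longrightarrow> level_ramp c \<epsilon> s = 1"
  by (auto simp: level_ramp_def max_def min_def divide_simps)

lemma cis_level_ramp_outside:
  assumes "\<epsilon> > 0" "\<epsilon> \<le> \<bar>s - c\<bar>" shows "cis (2 * pi * level_ramp c \<epsilon> s) = 1"
proof (cases "s \<le> c")
  case True
  then have "level_ramp c \<epsilon> s = 0" using assms by (intro level_ramp_low) auto
  then show ?thesis by simp
next
  case False
  then have "level_ramp c \<epsilon> s = 1" using assms by (intro level_ramp_high) auto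
  then show ?thesis by (simp add: complex_eq_iff)
qed

lemma continuous_on_level_ramp [continuous_intros]:
  "continuous_on S g \<Longrightarrow> continuous_on S (\<lambda>x. level_ramp c \<epsilon> (g x))"
  unfolding level_ramp_def divide_inverse by (intro continuous_intros)

definition circle_map :: "'b topology \<Rightarrow> ('b \<Rightarrow> complex) \<Rightarrow> bool" where
  "circle_map X u \<longleftrightarrow> continuous_map X euclidean u \<and> (\<forall>x\<in>topspace X. norm (u x) = 1)"

text \<open>The map follows the ramp on the part of the slab near \<open>A\<close> and is \<open>1\<close> everywhere else. This is
  continuous: in the interior of the slab the two parts are separated by disjoint open sets,
  and at its two ends the ramp has the value \<open>1\<close> on the circle.\<close>

lemma circle_map_across_fibre:
  fixes f :: "'b \<Rightarrow> real"
  assumes Y: "compact_space Y" "Hausdorff_space Y" and f: "continuous_map Y euclideanreal f"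
    and A: "closedin Y A" and B: "closedin Y B" and "\<eta> > 0"
    and disAB: "\<And>x. x \<in> A \<Longrightarrow> x \<in> B \<Longrightarrow> f x \<noteq> c"
    and td: "\<And>C. connectedin Y C \<Longrightarrow> C \<subseteq> {x \<in> topspace Y. f x = c} \<Longrightarrow> \<exists>a. C \<subseteq> {a}"
  obtains u \<epsilon> where "0 < \<epsilon>" "\<epsilon> \<le> \<eta>" "circle_map Y u" "\<And>x. x \<in> B \<Longrightarrow> u x = 1"
    "\<And>x. x \<in> A \<Longrightarrow> u x = cis (2 * pi * level_ramp c \<epsilon> (f x))"
proof -
  have dis: "disjnt C A \<or> disjnt C B"
    if "connectedin Y C" "C \<subseteq> {x \<in> topspace Y. f x = c}" for C
    using td[OF that] that(2) disAB by (auto simp: disjnt_def)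
  obtain \<epsilon> U V where sep: "0 < \<epsilon>" "\<epsilon> \<le> \<eta>" "openin Y U" "openin Y V" "disjnt U V"
    "{x \<in> topspace Y. \<bar>f x - c\<bar> \<le> \<epsilon>} \<subseteq> U \<union> V"
    "\<And>x. x \<in> A \<Longrightarrow> \<bar>f x - c\<bar> \<le> \<epsilon> \<Longrightarrow> x \<in> U"
    "\<And>x. x \<in> B \<Longrightarrow> \<bar>f x - c\<bar> \<le> \<epsilon> \<Longrightarrow> x \<in> V"
    by (rule fibre_separation[OF Y f A B \<open>\<eta> > 0\<close>, of c]) (erule (1) dis, blast)
  define P where "P x \<longleftrightarrow> \<bar>f x - c\<bar> \<le> \<epsilon> \<and> x \<notin> V" for x
  define g where "g x = cis (2 * pi * level_ramp c \<epsilon> (f x))" for x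
  define u where "u x = (if P x then g x else 1)" for x
  have absf: "continuous_map Y euclideanreal (\<lambda>x. \<bar>f x - c\<bar>)"
    using f by (intro continuous_intros) auto
  have clN: "closedin Y {x \<in> topspace Y. \<bar>f x - c\<bar> \<le> \<epsilon>}"
    using closedin_continuous_map_preimage[OF absf, of "{..\<epsilon>}"] by simp
  have clM: "closedin Y {x \<in> topspace Y. \<epsilon> \<le> \<bar>f x - c\<bar>}"
    using closedin_continuous_map_preimage[OF absf, of "{\<epsilon>..}"] by simp
  have cl1: "closedin Y {x \<in> topspace Y. P x}"
  proof -
    have "{x \<in> topspace Y. P x} = {x \<in> topspace Y. \<bar>f x - c\<bar> \<le> \<epsilon>} - V" by (auto simp: P_def)
    then show ?thesis using closedin_diff[OF clN sep(4)] by simp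
  qed
  define Q where "Q = {x \<in> topspace Y. \<epsilon> \<le> \<bar>f x - c\<bar>} \<union> ({x \<in> topspace Y. \<bar>f x - c\<bar> \<le> \<epsilon>} - U)"
  have cl2: "closedin Y Q" unfolding Q_def using clN clM sep by (intro closedin_Un closedin_diff) auto
  have "{x \<in> topspace Y. \<not> P x} \<subseteq> Q"
    using sep(5) by (auto simp: P_def Q_def disjnt_def)
  then have cl3: "Y closure_of {x \<in> topspace Y. \<not> P x} \<subseteq> Q" by (simp add: cl2 closure_of_minimal)
  have contg: "continuous_map Y euclidean g"
  proof -
    have "continuous_map euclideanreal euclidean (\<lambda>s. cis (2 * pi * level_ramp c \<epsilon> s))"
      by (simp, intro continuous_intros)
    from continuous_map_compose[OF f this] show ?thesis by (simp add: g_def[abs_def] o_def)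
  qed
  have compl: "topspace Y - {x \<in> topspace Y. P x} = {x \<in> topspace Y. \<not> P x}" by auto
  \<comment> \<open>a frontier point lies in both closed sets; since \<open>U\<close> and \<open>V\<close> cover the slab, this can only happen on its rim\<close>
  have fr: "g x = 1" if "x \<in> Y frontier_of {x \<in> topspace Y. P x}" for x
  proof -
    have "x \<in> Y closure_of {x \<in> topspace Y. P x}" "x \<in> Y closure_of {x \<in> topspace Y. \<not> P x}"
      using that by (auto simp: frontier_of_closures compl)
    then have "P x" "x \<in> Q" "x \<in> topspace Y"
      using cl1 cl3 closure_of_closedin[OF cl1] by auto
    then have "\<epsilon> \<le> \<bar>f x - c\<bar>" using sep(6) by (auto simp: P_def Q_def)
    then show ?thesis unfolding g_def using cis_level_ramp_outside sep(1) by blast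
  qed
  have contu: "continuous_map Y euclidean u"
    unfolding u_def
  proof (rule continuous_map_cases_alt)
    show "continuous_map (subtopology Y (Y closure_of {x \<in> topspace Y. P x})) euclidean g"
      using contg continuous_map_from_subtopology by blast
  qed (use fr in auto)
  show ?thesis
  proof
    show "circle_map Y u" using contu by (auto simp: circle_map_def u_def g_def)
    show "u x = 1" if "x \<in> B" for x using sep(8)[OF that] by (auto simp: u_def P_def)
    show "u x = cis (2 * pi * level_ramp c \<epsilon> (f x))" if "x \<in> A" for x
    proof (cases "\<bar>f x - c\<bar> \<le> \<epsilon>")
      case True
      then have "P x" using sep(5) sep(7)[OF that] by (auto simp: P_def disjnt_def)
      then show ?thesis by (simp add: u_def g_def)
    next
      case False
      then show ?thesis using cis_level_ramp_outside sep(1) by (simp add: u_def P_def)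
    qed
  qed (use sep in auto)
qed

lemma circle_lift_convex:
  fixes S :: "'b::real_normed_vector set" and p :: "'b \<Rightarrow> complex"
  assumes "convex S" "continuous_on S p" "\<And>x. x \<in> S \<Longrightarrow> norm (p x) = 1"
  obtains h where "continuous_on S h" "\<And>x. x \<in> S \<Longrightarrow> p x = cis (h x)"
proof -
  have "p x \<noteq> 0" if "x \<in> S" for x using assms(3)[OF that] by auto
  then obtain g where g: "continuous_on S g" "\<And>x. x \<in> S \<Longrightarrow> p x = exp (g x)"
    using continuous_logarithm_on_contractible[OF assms(2) convex_imp_contractible[OF assms(1)]] by metis
  show ?thesis
  proof
    show "continuous_on S (\<lambda>x. Im (g x))" using g by (intro continuous_intros)
    fix x assume x: "x \<in> S"
    then have "exp (Re (g x)) = 1" using assms(3) g(2) by (metis norm_exp_eq_Re)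
    then show "p x = cis (Im (g x))" using g(2)[OF x] by (simp add: exp_eq_polar)
  qed
qed

text \<open>Two lifts differ by a continuous function with values in the discrete set of multiples of \<open>2 * pi\<close>.\<close>

lemma circle_lift_unique:
  fixes S :: "'b::topological_space set"
  assumes "connected S" "continuous_on S h" "continuous_on S k" "\<And>x. x \<in> S \<Longrightarrow> cis (h x) = cis (k x)"
    and "x \<in> S" "y \<in> S"
  shows "h x - h y = k x - k y"
proof -
  have ex: "\<exists>n::int. h z - k z = 2 * pi * n" if z: "z \<in> S" for z
  proof -
    have "sin (h z) = sin (k z) \<and> cos (h z) = cos (k z)" using assms(4)[OF z] by (simp add: complex_eq_iff)
    then obtain n :: int where "h z = k z + 2 * pi * n" using sin_cos_eq_iff by blast
    then show ?thesis by (intro exI[of _ n]) simp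
  qed
  have "(\<lambda>z. h z - k z) constant_on S"
  proof (rule continuous_discrete_range_constant[OF assms(1)])
    show "continuous_on S (\<lambda>z. h z - k z)" using assms by (intro continuous_intros)
    fix z assume z: "z \<in> S"
    have "2 * pi \<le> norm ((h y - k y) - (h z - k z))" if y: "y \<in> S" "h y - k y \<noteq> h z - k z" for y
    proof -
      obtain n m :: int where nm: "h y - k y = 2 * pi * n" "h z - k z = 2 * pi * m" using ex y z by meson
      then have "n \<noteq> m" using y by auto
      then have "1 \<le> \<bar>real_of_int (n - m)\<bar>" by linarith
      then have "2 * pi * 1 \<le> 2 * pi * \<bar>real_of_int (n - m)\<bar>" by (intro mult_left_mono) auto
      also have "\<dots> = \<bar>2 * pi * real_of_int (n - m)\<bar>" by (simp add: abs_mult)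
      also have "\<dots> = norm ((h y - k y) - (h z - k z))" using nm by (simp add: algebra_simps)
      finally show ?thesis by simp
    qed
    then show "\<exists>e>0. \<forall>y. y \<in> S \<and> h y - k y \<noteq> h z - k z \<longrightarrow> e \<le> norm (h y - k y - (h z - k z))"
      by (intro exI[of _ "2 * pi"]) auto
  qed
  then obtain c where "\<forall>z\<in>S. h z - k z = c" unfolding constant_on_def by blast
  then have "h x - k x = h y - k y" using assms(5,6) by simp
  then show ?thesis by simp
qed

text \<open>The total change of a continuous angle along the path; by uniqueness of lifts the choice of the
  lift is irrelevant.\<close>

definition angle_incr :: "(real \<Rightarrow> complex) \<Rightarrow> real" where
  "angle_incr p = (SOME r. \<exists>h. continuous_on {0..1} h \<and> (\<forall>t\<in>{0..1}. p t = cis (h t)) \<and> r = h 1 - h 0)"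

lemma angle_incr_eq:
  assumes "continuous_on {0..1} h" "\<And>t. t \<in> {0..1} \<Longrightarrow> p t = cis (h t)"
  shows "angle_incr p = h 1 - h 0"
  unfolding angle_incr_def
proof (rule some_equality)
  show "\<exists>k. continuous_on {0..1} k \<and> (\<forall>t\<in>{0..1}. p t = cis (k t)) \<and> h 1 - h 0 = k 1 - k 0"
    using assms by blast
  fix r assume "\<exists>k. continuous_on {0..1} k \<and> (\<forall>t\<in>{0..1}. p t = cis (k t)) \<and> r = k 1 - k 0"
  then obtain k where k: "continuous_on {0..1} k" "\<And>t. t\<in>{0..1} \<Longrightarrow> p t = cis (k t)" "r = k 1 - k 0" by blast
  have eq: "cis (k t) = cis (h t)" if "t \<in> {0..1}" for t using k(2)[OF that] assms(2)[OF that] by simp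
  have "k 1 - k 0 = h 1 - h 0"
    by (rule circle_lift_unique[OF connected_Icc k(1) assms(1)]) (auto intro: eq)
  then show "r = h 1 - h 0" using k by simp
qed

lemma circle_map_path_lift:
  assumes "circle_map X u" "pathin X g"
  obtains h where "continuous_on {0..1} h" "\<And>t. t \<in> {0..1} \<Longrightarrow> u (g t) = cis (h t)"
    "angle_incr (u \<circ> g) = h 1 - h 0"
proof -
  have "continuous_map (top_of_set {0..1}) euclidean (u \<circ> g)"
    using assms unfolding circle_map_def pathin_def by (meson continuous_map_compose)
  then have c: "continuous_on {0..1} (u \<circ> g)" by simp
  have "norm ((u \<circ> g) t) = 1" if "t \<in> {0..1}" for t
    using assms path_image_subset_topspace[OF assms(2)] that by (auto simp: circle_map_def)
  from circle_lift_convex[OF _ c this]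
  obtain h where h: "continuous_on {0..1} h" "\<And>t. t \<in> {0..1} \<Longrightarrow> (u \<circ> g) t = cis (h t)" by auto
  show ?thesis using that[of h] h angle_incr_eq[OF h(1), of "u \<circ> g"] by auto
qed

section \<open>Real singular chains in degree one\<close>

definition lin_ext :: "('k \<Rightarrow> 'v::real_vector) \<Rightarrow> ('k \<Rightarrow>\<^sub>0 real) \<Rightarrow> 'v" where
  "lin_ext D c = (\<Sum>k\<in>Poly_Mapping.keys c. Poly_Mapping.lookup c k *\<^sub>R D k)"

lemma lookup_scaleR_poly [simp]: "Poly_Mapping.lookup (r *\<^sub>R c) k = r *\<^sub>R Poly_Mapping.lookup c k"
proof -
  have "finite {i. r *\<^sub>R Poly_Mapping.lookup c i \<noteq> 0}"
    by (rule finite_subset[OF _ finite_keys[of c]]) (auto simp: in_keys_iff)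
  then show ?thesis by (simp add: scaleR_poly_mapping_def)
qed

lemma lin_ext_superset:
  assumes "finite K" "Poly_Mapping.keys c \<subseteq> K"
  shows "lin_ext D c = (\<Sum>k\<in>K. Poly_Mapping.lookup c k *\<^sub>R D k)"
  unfolding lin_ext_def by (rule sum.mono_neutral_left) (use assms in \<open>auto simp: in_keys_iff\<close>)

lemma linear_lin_ext: "linear (lin_ext D)"
proof (rule linearI)
  fix b c :: "'a \<Rightarrow>\<^sub>0 real" and r :: real
  let ?K = "Poly_Mapping.keys b \<union> Poly_Mapping.keys c"
  have "Poly_Mapping.keys (b + c) \<subseteq> ?K" by (rule keys_add)
  then show "lin_ext D (b + c) = lin_ext D b + lin_ext D c"
    by (simp add: lin_ext_superset[of ?K] lookup_add scaleR_add_left sum.distrib)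
  have "Poly_Mapping.keys (r *\<^sub>R b) \<subseteq> Poly_Mapping.keys b" by (auto simp: in_keys_iff)
  then show "lin_ext D (r *\<^sub>R b) = r *\<^sub>R lin_ext D b"
    by (simp add: lin_ext_superset[of "Poly_Mapping.keys b"] scaleR_right.sum)
qed

lemma lin_ext_single [simp]: "lin_ext D (Poly_Mapping.single k r) = r *\<^sub>R D k"
  by (simp add: lin_ext_def)

text \<open>Reduces statements about linear maps on chains to single simplices.\<close>

lemma chain_sum_singles:
  "c = (\<Sum>k\<in>Poly_Mapping.keys c. Poly_Mapping.lookup c k *\<^sub>R Poly_Mapping.single k (1::real))"
proof (rule poly_mapping_eqI)
  fix k
  have "Poly_Mapping.lookup c k =
      (\<Sum>j\<in>Poly_Mapping.keys c. Poly_Mapping.lookup c j * (1 when j = k))"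
    by (simp add: in_keys_iff when_def if_distrib sum.delta cong: if_cong)
  then show "Poly_Mapping.lookup c k = Poly_Mapping.lookup
      (\<Sum>k\<in>Poly_Mapping.keys c. Poly_Mapping.lookup c k *\<^sub>R Poly_Mapping.single k (1::real)) k"
    by (simp add: lookup_sum lookup_single)
qed

lemma real_boundary_lin_ext:
  "p \<noteq> 0 \<Longrightarrow> real_boundary p =
    lin_ext (\<lambda>\<sigma>. \<Sum>k\<le>p. (-1) ^ k *\<^sub>R Poly_Mapping.single (singular_face p k \<sigma>) 1)"
proof (rule ext)
  fix c :: "'a real_chain" assume "p \<noteq> 0"
  have s: "Poly_Mapping.single x (r * s) = s *\<^sub>R r *\<^sub>R Poly_Mapping.single x (1::real)" for x :: "(nat \<Rightarrow> real) \<Rightarrow> 'a" and r s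
    by (rule poly_mapping_eqI) (simp add: lookup_single when_def)
  show "real_boundary p c = lin_ext (\<lambda>\<sigma>. \<Sum>k\<le>p. (-1) ^ k *\<^sub>R Poly_Mapping.single (singular_face p k \<sigma>) 1) c"
    using \<open>p \<noteq> 0\<close> by (simp add: real_boundary_def lin_ext_def s scaleR_right.sum)
qed

lemma linear_real_boundary: "linear (real_boundary p)"
proof (cases "p = 0")
  case True
  then show ?thesis by (simp add: real_boundary_def[abs_def] linear_iff)
next
  case False
  then show ?thesis by (simp only: real_boundary_lin_ext linear_lin_ext not_False_eq_True)
qed

lemma subspace_real_chains: "subspace (real_chains p X)"
proof -
  have "Poly_Mapping.keys (r *\<^sub>R c) \<subseteq> Poly_Mapping.keys c" for r and c :: "'a real_chain"
    by (auto simp: in_keys_iff)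
  moreover have "Poly_Mapping.keys (b + c) \<subseteq> Poly_Mapping.keys b \<union> Poly_Mapping.keys c" for b c :: "'a real_chain"
    by (rule keys_add)
  ultimately show ?thesis
    unfolding subspace_def real_chains_def by simp (meson Un_least order_trans)
qed

lemma subspace_real_boundaries: "subspace (real_boundaries p X)"
  unfolding real_boundaries_def by (intro linear_subspace_image linear_real_boundary subspace_real_chains)

lemma real_chains_mono: "\<Gamma> \<subseteq> \<Delta> \<Longrightarrow> real_chains p (subtopology X \<Gamma>) \<subseteq> real_chains p (subtopology X \<Delta>)"
  unfolding real_chains_def using singular_simplex_mono by fastforce

lemma real_cycles_mono: "\<Gamma> \<subseteq> \<Delta> \<Longrightarrow> real_cycles p (subtopology X \<Gamma>) \<subseteq> real_cycles p (subtopology X \<Delta>)"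
  unfolding real_cycles_def using real_chains_mono by blast

lemma real_boundaries_mono:
  "\<Gamma> \<subseteq> \<Delta> \<Longrightarrow> real_boundaries p (subtopology X \<Gamma>) \<subseteq> real_boundaries p (subtopology X \<Delta>)"
  unfolding real_boundaries_def using real_chains_mono by blast

text \<open>The vertices of the standard 1-simplex are the unit vectors, and its coordinate with index \<open>1\<close>
  serves as time.\<close>

definition path_simplex :: "(real \<Rightarrow> 'b) \<Rightarrow> (nat \<Rightarrow> real) \<Rightarrow> 'b" where
  "path_simplex g = restrict (\<lambda>x. g (x 1)) (standard_simplex 1)"

definition path_chain :: "(real \<Rightarrow> 'b) \<Rightarrow> 'b real_chain" where
  "path_chain g = Poly_Mapping.single (path_simplex g) 1"

definition point_chain :: "'b \<Rightarrow> 'b real_chain" where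
  "point_chain x = Poly_Mapping.single (restrict (\<lambda>_. x) (standard_simplex 0)) 1"

definition edge_point :: "real \<Rightarrow> nat \<Rightarrow> real" where
  "edge_point t = (\<lambda>i. if i = 0 then 1 - t else if i = 1 then t else 0)"

lemma standard_simplex_1: "standard_simplex (Suc 0) = edge_point ` {0..1}"
proof -
  have "x \<in> edge_point ` {0..1}" if x: "x \<in> standard_simplex (Suc 0)" for x
  proof
    show "x = edge_point (x 1)"
    proof
      fix i
      have "x 0 + x 1 = 1" "\<And>i. 1 < i \<Longrightarrow> x i = 0" using x by (auto simp: standard_simplex_def)
      then show "x i = edge_point (x 1) i" unfolding edge_point_def by (cases "i = 0"; cases "i = 1") auto
    qed
    show "x 1 \<in> {0..1}" using x by (auto simp: standard_simplex_def)
  qed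
  then show ?thesis by (auto simp: standard_simplex_def edge_point_def)
qed

lemma edge_point_in: "t \<in> {0..1} \<Longrightarrow> edge_point t \<in> standard_simplex (Suc 0)"
  by (simp add: standard_simplex_1)

lemma edge_point_1 [simp]: "edge_point t (Suc 0) = t"
  by (simp add: edge_point_def)

lemma path_simplex_edge_point [simp]: "t \<in> {0..1} \<Longrightarrow> path_simplex g (edge_point t) = g t"
  by (simp add: path_simplex_def edge_point_in)

lemma path_simplex_cong: "(\<And>t. t \<in> {0..1} \<Longrightarrow> g t = h t) \<Longrightarrow> path_simplex g = path_simplex h"
  by (auto simp: path_simplex_def standard_simplex_1 fun_eq_iff)

lemma path_chain_cong: "(\<And>t. t \<in> {0..1} \<Longrightarrow> g t = h t) \<Longrightarrow> path_chain g = path_chain h"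
  using path_simplex_cong by (metis path_chain_def)

lemma continuous_on_coordinate [continuous_intros]:
  "continuous_on S (\<lambda>x::nat \<Rightarrow> real. x i)"
  by (rule continuous_on_subset[OF continuous_on_product_coordinates subset_UNIV])

lemma continuous_on_edge_point: "continuous_on S edge_point"
proof (rule continuous_on_coordinatewise_then_product)
  fix i show "continuous_on S (\<lambda>t. edge_point t i)"
    unfolding edge_point_def by (cases "i = 0"; cases "i = 1") (auto intro!: continuous_intros)
qed

lemma singular_simplex_path_simplex:
  assumes "pathin X g" shows "singular_simplex 1 X (path_simplex g)"
proof -
  have "continuous_map (top_of_set (standard_simplex 1)) (top_of_set {0..1}) (\<lambda>x::nat \<Rightarrow> real. x 1)"
    by (auto intro!: continuous_intros simp: standard_simplex_def)
  then have "continuous_map (top_of_set (standard_simplex 1)) X (g \<circ> (\<lambda>x. x 1))"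
    using assms unfolding pathin_def by (rule continuous_map_compose)
  then have "continuous_map (top_of_set (standard_simplex 1)) X (path_simplex g)"
    by (rule continuous_map_eq) (simp add: path_simplex_def)
  then show ?thesis by (simp add: singular_simplex_def euclidean_product_topology path_simplex_def)
qed

lemma path_chain_in_chains: "pathin X g \<Longrightarrow> path_chain g \<in> real_chains 1 X"
  using singular_simplex_path_simplex[of X g] by (simp add: real_chains_def path_chain_def)

lemma singular_1_simplex_is_path:
  assumes "singular_simplex 1 X \<sigma>"
  shows "pathin X (\<sigma> \<circ> edge_point)" "\<sigma> = path_simplex (\<sigma> \<circ> edge_point)"
proof -
  have s: "continuous_map (top_of_set (standard_simplex 1)) X \<sigma>" "\<sigma> \<in> extensional (standard_simplex 1)"
    using assms by (auto simp: singular_simplex_def euclidean_product_topology)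
  have "continuous_map (top_of_set {0..1}) (top_of_set (standard_simplex 1)) edge_point"
    using edge_point_in by (auto simp: continuous_on_edge_point)
  then show "pathin X (\<sigma> \<circ> edge_point)" unfolding pathin_def using s(1) by (rule continuous_map_compose)
  show "\<sigma> = path_simplex (\<sigma> \<circ> edge_point)"
  proof
    fix x show "\<sigma> x = path_simplex (\<sigma> \<circ> edge_point) x"
    proof (cases "x \<in> standard_simplex 1")
      case True
      then obtain t where "t \<in> {0..1}" "x = edge_point t" by (auto simp: standard_simplex_1)
      then show ?thesis by simp
    next
      case False
      then show ?thesis using s(2) by (simp add: path_simplex_def extensional_def)
    qed
  qed
qed

lemma simplical_face_edges:
  "simplical_face 0 (\<lambda>j. if j = 0 then 1 else 0) = edge_point 1"
  "simplical_face 1 (\<lambda>j. if j = 0 then 1 else 0) = edge_point 0"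
  by (auto simp: simplical_face_def edge_point_def fun_eq_iff)

lemma real_boundary_path_chain:
  "real_boundary 1 (path_chain g) = point_chain (g 1) - point_chain (g 0)"
proof -
  have "singular_face 1 0 (path_simplex g) = restrict (\<lambda>_. g 1) (standard_simplex 0)"
    "singular_face 1 1 (path_simplex g) = restrict (\<lambda>_. g 0) (standard_simplex 0)"
    using simplical_face_edges path_simplex_edge_point[of 1 g] path_simplex_edge_point[of 0 g]
    by (auto simp: singular_face_def standard_simplex_0 restrict_def)
  then show ?thesis
    by (simp add: real_boundary_lin_ext path_chain_def point_chain_def)
qed

definition seg :: "'e::real_vector \<Rightarrow> 'e \<Rightarrow> real \<Rightarrow> 'e" where
  "seg a b t = (1 - t) *\<^sub>R a + t *\<^sub>R b"

lemma seg_ends [simp]: "seg a b 0 = a" "seg a b 1 = b"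
  by (auto simp: seg_def)

lemma seg_in_convex: "convex S \<Longrightarrow> a \<in> S \<Longrightarrow> b \<in> S \<Longrightarrow> t \<in> {0..1} \<Longrightarrow> seg a b t \<in> S"
  unfolding seg_def convex_alt by auto

lemma continuous_on_seg [continuous_intros]: "continuous_on T (seg a (b::'e::real_normed_vector))"
  unfolding seg_def by (intro continuous_intros)

lemma pathin_seg:
  fixes a b :: "'e::real_normed_vector"
  assumes "continuous_map (top_of_set S) X H" "convex S" "a \<in> S" "b \<in> S"
  shows "pathin X (H \<circ> seg a b)"
  unfolding pathin_def
  by (rule continuous_map_compose[OF _ assms(1)])
    (use seg_in_convex[OF assms(2-4)] in \<open>auto intro!: continuous_intros\<close>)

text \<open>The three sides bound the affine singular triangle spanned by the three points in the
  convex domain. Concatenation, inverses, constant paths and homotopies are all instances.\<close>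

lemma triangle_boundary:
  fixes a b c :: "'e::real_normed_vector"
  assumes H: "continuous_map (top_of_set S) X H" and S: "convex S" "a \<in> S" "b \<in> S" "c \<in> S"
  shows "path_chain (H \<circ> seg a b) + path_chain (H \<circ> seg b c) - path_chain (H \<circ> seg a c) \<in> real_boundaries 1 X"
proof -
  define A where "A x = x 0 *\<^sub>R a + x 1 *\<^sub>R b + x 2 *\<^sub>R c" for x :: "nat \<Rightarrow> real"
  define \<tau> where "\<tau> = restrict (H \<circ> A) (standard_simplex 2)"
  have A_in: "A x \<in> S" if "x \<in> standard_simplex 2" for x
  proof -
    have "0 \<le> x 0" "0 \<le> x 1" "0 \<le> x 2" "x 0 + x 1 + x 2 = 1"
      using that by (auto simp: standard_simplex_def numeral_2_eq_2)
    then have "A x \<in> convex hull {a, b, c}" unfolding A_def convex_hull_3 by blast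
    moreover have "convex hull {a, b, c} \<subseteq> S" using S by (intro hull_minimal) auto
    ultimately show ?thesis by blast
  qed
  have "continuous_on (standard_simplex 2) A" unfolding A_def by (intro continuous_intros)
  then have "continuous_map (top_of_set (standard_simplex 2)) (top_of_set S) A"
    using A_in by auto
  then have "continuous_map (top_of_set (standard_simplex 2)) X (H \<circ> A)"
    using H by (rule continuous_map_compose)
  then have "continuous_map (top_of_set (standard_simplex 2)) X \<tau>"
    by (rule continuous_map_eq) (simp add: \<tau>_def)
  then have "singular_simplex 2 X \<tau>" by (simp add: singular_simplex_def euclidean_product_topology \<tau>_def)
  then have chain: "Poly_Mapping.single \<tau> 1 \<in> real_chains 2 X" by (simp add: real_chains_def)
  have face: "singular_face 2 k \<tau> = path_simplex (H \<circ> g)"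
    if "k \<le> 2" "\<And>t. A (simplical_face k (edge_point t)) = g t" for k g
  proof
    fix x show "singular_face 2 k \<tau> x = path_simplex (H \<circ> g) x"
    proof (cases "x \<in> standard_simplex 1")
      case True
      then obtain t where t: "t \<in> {0..1}" "x = edge_point t" by (auto simp: standard_simplex_1)
      have "simplical_face k x \<in> standard_simplex 2"
        using simplical_face_in_standard_simplex[of 2 k x] True that(1) by simp
      then show ?thesis using True t that(2) by (simp add: singular_face_def \<tau>_def)
    qed (simp add: singular_face_def path_simplex_def)
  qed
  have f0: "singular_face 2 0 \<tau> = path_simplex (H \<circ> seg b c)"
    by (rule face) (auto simp: A_def simplical_face_def edge_point_def seg_def)
  have f1: "singular_face 2 1 \<tau> = path_simplex (H \<circ> seg a c)"
    by (rule face) (auto simp: A_def simplical_face_def edge_point_def seg_def)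
  have f2: "singular_face 2 2 \<tau> = path_simplex (H \<circ> seg a b)"
    by (rule face) (auto simp: A_def simplical_face_def edge_point_def seg_def)
  have "real_boundary 2 (Poly_Mapping.single \<tau> 1) =
      path_chain (H \<circ> seg a b) + path_chain (H \<circ> seg b c) - path_chain (H \<circ> seg a c)"
    using f0 f1 f2 by (simp add: real_boundary_lin_ext path_chain_def numeral_2_eq_2)
  then show ?thesis unfolding real_boundaries_def using chain by (metis Suc_1 image_eqI)
qed

lemma constant_path_boundary:
  assumes "x \<in> topspace X" shows "path_chain (\<lambda>_. x) \<in> real_boundaries 1 X"
proof -
  have "continuous_map (top_of_set (UNIV :: real set)) X (\<lambda>_. x)" using assms by simp
  from triangle_boundary[OF this, of 0 0 0] show ?thesis by (simp add: o_def)
qed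

lemma path_split_boundary:
  assumes "pathin X g" "a \<in> {0..1}" "b \<in> {0..1}" "c \<in> {0..1}"
  shows "path_chain (g \<circ> seg a b) + path_chain (g \<circ> seg b c) - path_chain (g \<circ> seg a c) \<in> real_boundaries 1 X"
  using triangle_boundary[of "{0..1::real}" X g a b c] assms by (simp add: pathin_def)

text \<open>Cut the square along its diagonal; the two triangles share the diagonal, which cancels.\<close>

lemma square_boundary:
  fixes H :: "real \<times> real \<Rightarrow> 'b"
  assumes H: "continuous_map (top_of_set ({0..1} \<times> {0..1})) X H"
  shows "path_chain (\<lambda>t. H (0, t)) + path_chain (\<lambda>s. H (s, 1))
    - path_chain (\<lambda>s. H (s, 0)) - path_chain (\<lambda>t. H (1, t)) \<in> real_boundaries 1 X"
proof -
  let ?S = "{0..1::real} \<times> {0..1::real}"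
  have S: "convex ?S" by (intro convex_Times) auto
  have t1: "path_chain (H \<circ> seg (0,0) (0,1)) + path_chain (H \<circ> seg (0,1) (1,1)) - path_chain (H \<circ> seg (0,0) (1,1)) \<in> real_boundaries 1 X"
    by (rule triangle_boundary[OF H S]) auto
  have t2: "path_chain (H \<circ> seg (0,0) (1,0)) + path_chain (H \<circ> seg (1,0) (1,1)) - path_chain (H \<circ> seg (0,0) (1,1)) \<in> real_boundaries 1 X"
    by (rule triangle_boundary[OF H S]) auto
  show ?thesis
    using subspace_diff[OF subspace_real_boundaries t1 t2]
    by (simp add: seg_def o_def algebra_simps)
qed

text \<open>A spanning set of least cardinality is linearly independent modulo boundaries.\<close>

lemma homology_basis_from_spanning:
  assumes "finite S" "S \<subseteq> real_cycles p X" "real_cycles p X \<subseteq> span (S \<union> real_boundaries p X)"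
  shows "betti p X \<le> enat (card S)"
proof -
  let ?B = "real_boundaries p X"
  define P where "P T \<longleftrightarrow> finite T \<and> T \<subseteq> real_cycles p X \<and> real_cycles p X \<subseteq> span (T \<union> ?B)" for T
  have "P S" using assms by (simp add: P_def)
  then obtain T where T: "P T" "card T \<le> card S" "\<And>T'. P T' \<Longrightarrow> card T \<le> card T'"
    using arg_min_natI[of P S card] arg_min_nat_le[of P _ card] by (metis (no_types))
  have fin: "finite T" using T(1) by (simp add: P_def)
  have spB: "span ?B = ?B" by (simp only: span_eq_iff subspace_real_boundaries)
  have "real_homology_basis p X T"
    unfolding real_homology_basis_def
  proof (intro conjI ballI allI impI)
    show "finite T" "T \<subseteq> real_cycles p X" using T(1) by (auto simp: P_def)
  next
    fix z assume "z \<in> real_cycles p X"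
    then have "z \<in> span (T \<union> ?B)" using T(1) by (auto simp: P_def)
    then obtain x y where xy: "z = x + y" "x \<in> span T" "y \<in> ?B" by (auto simp: span_Un spB)
    then obtain a where "x = (\<Sum>s\<in>T. a s *\<^sub>R s)" using span_finite[OF fin] by auto
    then show "\<exists>a. z - (\<Sum>s\<in>T. a s *\<^sub>R s) \<in> ?B" using xy by (intro exI[of _ a]) simp
  next
    fix a t assume a: "(\<Sum>s\<in>T. a s *\<^sub>R s) \<in> ?B" and t: "t \<in> T"
    show "a t = 0"
    proof (rule ccontr)
      assume nz: "a t \<noteq> 0"
      let ?W = "span ((T - {t}) \<union> ?B)"
      have "(\<Sum>s\<in>T. a s *\<^sub>R s) = a t *\<^sub>R t + (\<Sum>s\<in>T-{t}. a s *\<^sub>R s)" using fin t by (rule sum.remove)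
      then have "a t *\<^sub>R t = (\<Sum>s\<in>T. a s *\<^sub>R s) - (\<Sum>s\<in>T-{t}. a s *\<^sub>R s)" by simp
      moreover have "(\<Sum>s\<in>T. a s *\<^sub>R s) \<in> ?W" using a by (simp add: span_base)
      moreover have "(\<Sum>s\<in>T-{t}. a s *\<^sub>R s) \<in> ?W" by (intro span_sum span_scale span_base) auto
      ultimately have "a t *\<^sub>R t \<in> ?W" by (simp add: span_diff)
      then have "t \<in> ?W" using nz by (metis span_scale scaleR_scaleR scaleR_one left_inverse)
      moreover have "(T - {t}) \<union> ?B \<subseteq> ?W" by (rule span_superset)
      ultimately have "T \<union> ?B \<subseteq> ?W" by blast
      then have "span (T \<union> ?B) \<subseteq> ?W" by (simp add: span_minimal)
      then have "P (T - {t})" using T(1) by (auto simp: P_def)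
      then have "card T \<le> card (T - {t})" by (rule T(3))
      then show False using fin t by (metis card_Diff1_less not_less)
    qed
  qed
  then have "betti p X \<le> enat (card T)" unfolding betti_def by (intro INF_lower) simp
  then show ?thesis using T(2) by (meson enat_ord_simps(1) order_trans)
qed

text \<open>A way to bound the first Betti number from above without computing any homology: \<open>p x\<close> is a
  chain leading from a base point to \<open>x\<close>, and closing up an arbitrary path \<open>g\<close> by these chains gives
  a cycle that lies, modulo boundaries, in the span of \<open>S\<close>. Unlike a statement about all cycles, this
  condition can be checked on short pieces of a path.\<close>

definition path_spanning :: "'b topology \<Rightarrow> ('b \<Rightarrow> 'b real_chain) \<Rightarrow> 'b real_chain set \<Rightarrow> bool" where
  "path_spanning X p S \<longleftrightarrow> finite S \<and> S \<subseteq> real_cycles 1 X \<and>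
    (\<exists>x0. \<forall>x\<in>topspace X. p x \<in> real_chains 1 X \<and> real_boundary 1 (p x) = point_chain x - point_chain x0) \<and>
    (\<forall>g. pathin X g \<longrightarrow> path_chain g + p (g 0) - p (g 1) \<in> span (S \<union> real_boundaries 1 X))"

text \<open>Every cycle is a combination of paths. Replacing each path by its closed-up version adds the image
  of the boundary of the cycle under the linear extension of \<open>p\<close>, which is zero.\<close>

lemma path_spanning_imp_betti_le:
  assumes "path_spanning X p S" shows "betti 1 X \<le> enat (card S)"
proof (rule homology_basis_from_spanning)
  show "finite S" "S \<subseteq> real_cycles 1 X" using assms by (auto simp: path_spanning_def)
  let ?W = "span (S \<union> real_boundaries 1 X)"
  show "real_cycles 1 X \<subseteq> ?W"
  proof
    fix z assume z: "z \<in> real_cycles 1 X"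
    define P where "P = lin_ext (\<lambda>\<tau>::(nat \<Rightarrow> real) \<Rightarrow> 'a. p (\<tau> (\<lambda>j. if j = 0 then 1 else 0)))"
    have P: "linear P" unfolding P_def by (rule linear_lin_ext)
    have P_pt: "P (point_chain x) = p x" for x
      by (simp add: P_def point_chain_def standard_simplex_0)
    let ?c = "\<lambda>\<sigma>. Poly_Mapping.lookup z \<sigma>"
    let ?g = "\<lambda>\<sigma>::(nat \<Rightarrow> real) \<Rightarrow> 'a. \<sigma> \<circ> edge_point"
    have key: "pathin X (?g \<sigma>)" "Poly_Mapping.single \<sigma> 1 = path_chain (?g \<sigma>)"
      if "\<sigma> \<in> Poly_Mapping.keys z" for \<sigma>
    proof -
      have s: "singular_simplex 1 X \<sigma>" using z that by (auto simp: real_cycles_def real_chains_def)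
      show "pathin X (?g \<sigma>)" by (rule singular_1_simplex_is_path(1)[OF s])
      show "Poly_Mapping.single \<sigma> 1 = path_chain (?g \<sigma>)"
        unfolding path_chain_def using singular_1_simplex_is_path(2)[OF s] by metis
    qed
    have zs: "z = (\<Sum>\<sigma>\<in>Poly_Mapping.keys z. ?c \<sigma> *\<^sub>R path_chain (?g \<sigma>))"
      by (subst chain_sum_singles) (simp add: key(2))
    have "0 = P (real_boundary 1 z)" using z P by (simp add: real_cycles_def linear_0)
    also have "\<dots> = P (real_boundary 1 (\<Sum>\<sigma>\<in>Poly_Mapping.keys z. ?c \<sigma> *\<^sub>R path_chain (?g \<sigma>)))"
      using zs by simp
    also have "\<dots> = (\<Sum>\<sigma>\<in>Poly_Mapping.keys z. ?c \<sigma> *\<^sub>R (p (?g \<sigma> 1) - p (?g \<sigma> 0)))"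
      using P by (simp add: linear_sum[OF linear_real_boundary] linear_scale[OF linear_real_boundary]
          linear_sum[OF P] linear_scale[OF P] real_boundary_path_chain linear_diff P_pt del: One_nat_def)
    finally have "(\<Sum>\<sigma>\<in>Poly_Mapping.keys z. ?c \<sigma> *\<^sub>R (p (?g \<sigma> 1) - p (?g \<sigma> 0))) = 0" by simp
    then have "z = (\<Sum>\<sigma>\<in>Poly_Mapping.keys z. ?c \<sigma> *\<^sub>R path_chain (?g \<sigma>))
        - (\<Sum>\<sigma>\<in>Poly_Mapping.keys z. ?c \<sigma> *\<^sub>R (p (?g \<sigma> 1) - p (?g \<sigma> 0)))" using zs by simp
    also have "\<dots> = (\<Sum>\<sigma>\<in>Poly_Mapping.keys z. ?c \<sigma> *\<^sub>R (path_chain (?g \<sigma>) + p (?g \<sigma> 0) - p (?g \<sigma> 1)))"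
      by (simp add: algebra_simps sum_subtractf sum.distrib)
    also have "\<dots> \<in> ?W"
      using assms key(1) unfolding path_spanning_def by (intro span_sum span_scale) blast
    finally show "z \<in> ?W" .
  qed
qed

section \<open>Complexes built by attaching arcs\<close>

lemma arc_inverse:
  fixes \<alpha> :: "real \<Rightarrow> 'b"
  assumes "Hausdorff_space X" "pathin X \<alpha>" "inj_on \<alpha> {0..1}"
  obtains \<beta> where "continuous_map (subtopology X (\<alpha> ` {0..1})) (top_of_set {0..1}) \<beta>"
    "\<And>t. t \<in> {0..1} \<Longrightarrow> \<beta> (\<alpha> t) = t"
proof -
  have "embedding_map (top_of_set {0..1}) X \<alpha>"
    using assms by (intro continuous_imp_embedding_map) (auto simp: pathin_def compact_space_subtopology)
  then have "homeomorphic_map (top_of_set {0..1}) (subtopology X (\<alpha> ` {0..1})) \<alpha>"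
    by (simp add: embedding_map_def)
  then obtain g where "homeomorphic_maps (top_of_set {0..1}) (subtopology X (\<alpha> ` {0..1})) \<alpha> g"
    by (auto simp: homeomorphic_map_maps)
  then show ?thesis using that[of g] by (auto simp: homeomorphic_maps_def)
qed

lemma pathin_in_topspace: "pathin X g \<Longrightarrow> t \<in> {0..1} \<Longrightarrow> g t \<in> topspace X"
  using path_image_subset_topspace by blast

text \<open>The starting point of the arc lies on \<open>\<Gamma>\<close>, the end point may or may not.\<close>

definition attaching_arc :: "'b topology \<Rightarrow> 'b set \<Rightarrow> (real \<Rightarrow> 'b) \<Rightarrow> bool" where
  "attaching_arc X \<Gamma> \<alpha> \<longleftrightarrow> pathin X \<alpha> \<and> inj_on \<alpha> {0..1} \<and> \<alpha> 0 \<in> \<Gamma> \<and> \<alpha> ` {0<..<1} \<inter> \<Gamma> = {}"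

text \<open>The index is the rank. Attaching an arc with a free end is a homotopy equivalence, whereas an arc
  with both ends on the complex creates one new independent cycle.\<close>

inductive arc_complex :: "'b topology \<Rightarrow> nat \<Rightarrow> 'b set \<Rightarrow> bool" for X where
  point: "x \<in> topspace X \<Longrightarrow> arc_complex X 0 {x}"
| attach: "arc_complex X k \<Gamma> \<Longrightarrow> attaching_arc X \<Gamma> \<alpha> \<Longrightarrow>
    arc_complex X (if \<alpha> 1 \<in> \<Gamma> then Suc k else k) (\<Gamma> \<union> \<alpha> ` {0..1})"

lemma arc_complex_topology:
  assumes "arc_complex X k \<Gamma>"
  shows "\<Gamma> \<subseteq> topspace X" "\<Gamma> \<noteq> {}" "compactin X \<Gamma>" "path_connectedin X \<Gamma>"
proof -
  have "\<Gamma> \<subseteq> topspace X \<and> \<Gamma> \<noteq> {} \<and> compactin X \<Gamma> \<and> path_connectedin X \<Gamma>"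
    using assms
  proof induction
    case (point x)
    then show ?case by (simp add: path_connectedin_singleton)
  next
    case (attach k \<Gamma> \<alpha>)
    then have a: "pathin X \<alpha>" "\<alpha> 0 \<in> \<Gamma>" by (auto simp: attaching_arc_def)
    have "\<alpha> 0 \<in> \<Gamma> \<inter> \<alpha> ` {0..1}" using a by auto
    then have "path_connectedin X (\<Gamma> \<union> \<alpha> ` {0..1})"
      using attach path_connectedin_path_image[OF a(1)] by (intro path_connectedin_Un) auto
    moreover have "\<alpha> ` {0..1} \<subseteq> topspace X" using path_image_subset_topspace[OF a(1)] by blast
    ultimately show ?case
      using attach compactin_path_image[OF a(1)] compactin_Un by blast
  qed
  then show "\<Gamma> \<subseteq> topspace X" "\<Gamma> \<noteq> {}" "compactin X \<Gamma>" "path_connectedin X \<Gamma>" by auto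
qed

text \<open>The cells of \<open>finite_graph\<close>, made explicit so that the cell structure can be refined.\<close>

definition graph_cells :: "'b topology \<Rightarrow> 'b set \<Rightarrow> (real \<Rightarrow> 'b) set \<Rightarrow> bool" where
  "graph_cells X V \<Phi> \<longleftrightarrow> finite V \<and> V \<subseteq> topspace X \<and> finite \<Phi> \<and>
      (\<forall>\<phi>\<in>\<Phi>. pathin X \<phi> \<and> \<phi> 0 \<in> V \<and> \<phi> 1 \<in> V \<and>
         embedding_map (top_of_set {0<..<1::real}) X \<phi> \<and> \<phi> ` {0<..<1} \<inter> V = {}) \<and>
      (\<forall>\<phi>\<in>\<Phi>. \<forall>\<psi>\<in>\<Phi>. \<phi> \<noteq> \<psi> \<longrightarrow> \<phi> ` {0<..<1} \<inter> \<psi> ` {0<..<1} = {}) \<and>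
      topspace X = V \<union> (\<Union>\<phi>\<in>\<Phi>. \<phi> ` {0<..<1})"

lemma finite_graph_iff_cells: "finite_graph X \<longleftrightarrow> Hausdorff_space X \<and> (\<exists>V \<Phi>. graph_cells X V \<Phi>)"
  unfolding finite_graph_def graph_cells_def ..

lemma seg_open_image:
  fixes a b :: real
  assumes "0 \<le> a" "a < b" "b \<le> 1"
  shows "seg a b ` {0<..<1} = {a<..<b}"
proof -
  have "x \<in> seg a b ` {0<..<1}" if "x \<in> {a<..<b}" for x
  proof
    have "seg a b s = a + s * (b - a)" for s by (simp add: seg_def algebra_simps)
    from this[of "(x - a) / (b - a)"] have "seg a b ((x - a) / (b - a)) = a + (x - a) / (b - a) * (b - a)" .
    then show "x = seg a b ((x - a) / (b - a))" using assms by simp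
    show "(x - a) / (b - a) \<in> {0<..<1}" using that assms by (simp add: field_simps)
  qed
  moreover have "seg a b t \<in> {a<..<b}" if "t \<in> {0<..<1}" for t
  proof -
    have "seg a b t = a + t * (b - a)" "seg a b t = b - (1 - t) * (b - a)"
      by (simp_all add: seg_def algebra_simps)
    moreover have "0 < t * (b - a)" "0 < (1 - t) * (b - a)" using that assms by auto
    ultimately have "a < seg a b t" "seg a b t < b" by linarith+
    then show ?thesis by simp
  qed
  ultimately show ?thesis by blast
qed

lemma inj_seg: "a \<noteq> (b::real) \<Longrightarrow> inj (seg a b)"
proof (rule injI)
  fix x y assume "a \<noteq> b" "seg a b x = seg a b y"
  then have "(x - y) * (b - a) = 0" by (simp add: seg_def algebra_simps)
  then show "x = y" using \<open>a \<noteq> b\<close> by simp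
qed

lemma embedding_map_seg:
  fixes a b :: real
  assumes "0 \<le> a" "a < b" "b \<le> 1" "embedding_map (top_of_set {0<..<1}) X \<phi>"
  shows "embedding_map (top_of_set {0<..<1}) X (\<phi> \<circ> seg a b)"
proof (rule embedding_map_compose[OF _ assms(4)])
  have "embedding_map (top_of_set {0<..<1}) euclideanreal (seg a b)"
    using assms inj_on_subset[OF inj_seg subset_UNIV]
    by (subst embedding_map_into_euclideanreal)
      (auto intro!: continuous_intros convex_imp_path_connected simp flip: path_connectedin_def)
  then show "embedding_map (top_of_set {0<..<1}) (top_of_set {0<..<1}) (seg a b)"
    using seg_open_image[OF assms(1-3)] assms by (auto simp: embedding_map_in_subtopology)
qed

text \<open>An arc may be attached at an interior point of an edge. Such an edge is subdivided first.\<close>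

lemma graph_cells_insert_vertex:
  assumes "graph_cells X V \<Phi>" "x \<in> topspace X"
  obtains \<Psi> where "graph_cells X (insert x V) \<Psi>"
proof (cases "x \<in> V")
  case True
  then show ?thesis using assms that[of \<Phi>] by (simp add: insert_absorb)
next
  case False
  note C = assms(1)[unfolded graph_cells_def]
  have "\<forall>\<phi>\<in>\<Phi>. \<forall>\<psi>\<in>\<Phi>. \<phi> \<noteq> \<psi> \<longrightarrow> \<phi> ` {0<..<1} \<inter> \<psi> ` {0<..<1} = {}" using C by (elim conjE)
  then have C5: "\<phi> ` {0<..<1} \<inter> \<psi> ` {0<..<1} = {}" if "\<phi> \<in> \<Phi>" "\<psi> \<in> \<Phi>" "\<phi> \<noteq> \<psi>" for \<phi> \<psi> using that by blast
  obtain \<phi> t where \<phi>: "\<phi> \<in> \<Phi>" "t \<in> {0<..<1}" "x = \<phi> t" using C assms(2) False by auto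
  have p: "pathin X \<phi>" "\<phi> 0 \<in> V" "\<phi> 1 \<in> V" "embedding_map (top_of_set {0<..<1::real}) X \<phi>"
    "\<phi> ` {0<..<1} \<inter> V = {}"
    using C \<phi>(1) by auto
  have inj: "inj_on \<phi> {0<..<1}"
    using p(4) by (auto simp: embedding_map_def dest!: homeomorphic_imp_injective_map)
  define \<phi>1 where "\<phi>1 = \<phi> \<circ> seg 0 t"
  define \<phi>2 where "\<phi>2 = \<phi> \<circ> seg t 1"
  have im: "\<phi>1 ` {0<..<1} = \<phi> ` {0<..<t}" "\<phi>2 ` {0<..<1} = \<phi> ` {t<..<1}"
    using seg_open_image[of 0 t] seg_open_image[of t 1] \<phi>(2) unfolding \<phi>1_def \<phi>2_def image_comp[symmetric] by auto
  have sub: "{0<..<t} \<subseteq> {0<..<1}" "{t<..<1} \<subseteq> {0<..<1}" using \<phi>(2) by auto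
  have split: "\<phi> ` {0<..<1} = insert x (\<phi> ` {0<..<t} \<union> \<phi> ` {t<..<1})"
  proof -
    have "{0<..<1} = insert t ({0<..<t} \<union> {t<..<1})" using \<phi>(2) by auto
    then show ?thesis using \<phi>(3) by auto
  qed
  have xn: "x \<notin> \<phi> ` {0<..<t}" "x \<notin> \<phi> ` {t<..<1}"
    using inj \<phi>(2,3) by (auto simp: inj_on_def) (metis greaterThanLessThan_iff less_irrefl less_trans)+
  have dis12: "\<phi> ` {0<..<t} \<inter> \<phi> ` {t<..<1} = {}"
    using inj_on_image_Int[OF inj sub] by auto
  have path12: "pathin X \<phi>1" "pathin X \<phi>2"
    unfolding \<phi>1_def \<phi>2_def using p(1) \<phi>(2) by (auto simp: pathin_def intro!: pathin_seg[unfolded pathin_def])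
  have emb12: "embedding_map (top_of_set {0<..<1::real}) X \<phi>1" "embedding_map (top_of_set {0<..<1::real}) X \<phi>2"
    unfolding \<phi>1_def \<phi>2_def using embedding_map_seg[OF _ _ _ p(4)] \<phi>(2) by auto
  have ends: "\<phi>1 0 = \<phi> 0" "\<phi>1 1 = x" "\<phi>2 0 = x" "\<phi>2 1 = \<phi> 1" by (auto simp: \<phi>1_def \<phi>2_def \<phi>)
  define \<Psi> where "\<Psi> = insert \<phi>1 (insert \<phi>2 (\<Phi> - {\<phi>}))"
  have other: "\<psi> ` {0<..<1} \<inter> \<phi> ` {0<..<1} = {}" if "\<psi> \<in> \<Phi> - {\<phi>}" for \<psi> using C \<phi>(1) that by auto
  have xo: "x \<notin> \<psi> ` {0<..<1}" if "\<psi> \<in> \<Phi> - {\<phi>}" for \<psi> using other[OF that] split by auto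
  have "graph_cells X (insert x V) \<Psi>"
    unfolding graph_cells_def
  proof (intro conjI)
    show "finite (insert x V)" "insert x V \<subseteq> topspace X" "finite \<Psi>" using C assms(2) by (auto simp: \<Psi>_def)
    show "\<forall>\<psi>\<in>\<Psi>. pathin X \<psi> \<and> \<psi> 0 \<in> insert x V \<and> \<psi> 1 \<in> insert x V \<and>
         embedding_map (top_of_set {0<..<1::real}) X \<psi> \<and> \<psi> ` {0<..<1} \<inter> insert x V = {}"
    proof
      fix \<psi> assume "\<psi> \<in> \<Psi>"
      then consider "\<psi> = \<phi>1" | "\<psi> = \<phi>2" | "\<psi> \<in> \<Phi> - {\<phi>}" by (auto simp: \<Psi>_def)
      then show "pathin X \<psi> \<and> \<psi> 0 \<in> insert x V \<and> \<psi> 1 \<in> insert x V \<and>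
         embedding_map (top_of_set {0<..<1::real}) X \<psi> \<and> \<psi> ` {0<..<1} \<inter> insert x V = {}"
      proof cases
        case 1
        then show ?thesis using path12 emb12 ends p(2) im xn p(5) split by auto
      next
        case 2
        then show ?thesis using path12 emb12 ends p(3) im xn p(5) split by auto
      next
        case 3
        then show ?thesis using C xo[OF 3] by auto
      qed
    qed
    show "\<forall>\<psi>\<in>\<Psi>. \<forall>\<psi>'\<in>\<Psi>. \<psi> \<noteq> \<psi>' \<longrightarrow> \<psi> ` {0<..<1} \<inter> \<psi>' ` {0<..<1} = {}"
    proof (intro ballI impI)
      have o1: "\<psi> ` {0<..<1} \<inter> \<phi>1 ` {0<..<1} = {}" "\<psi> ` {0<..<1} \<inter> \<phi>2 ` {0<..<1} = {}"
        if "\<psi> \<in> \<Phi> - {\<phi>}" for \<psi> using other[OF that] split im by auto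
      have o2: "\<phi>1 ` {0<..<1} \<inter> \<phi>2 ` {0<..<1} = {}" using im dis12 by simp
      fix \<psi> \<psi>' assume "\<psi> \<in> \<Psi>" "\<psi>' \<in> \<Psi>" "\<psi> \<noteq> \<psi>'"
      then show "\<psi> ` {0<..<1} \<inter> \<psi>' ` {0<..<1} = {}"
        unfolding \<Psi>_def using o1[of \<psi>] o1[of \<psi>'] o2 C5[of \<psi> \<psi>'] by (elim insertE) (simp_all add: Int_commute)
    qed
    have un: "(\<Union>\<psi>\<in>\<Phi>. \<psi> ` {0<..<1}) = \<phi> ` {0<..<1} \<union> (\<Union>\<psi>\<in>\<Phi>-{\<phi>}. \<psi> ` {0<..<1})" using \<phi>(1) by auto
    have "topspace X = V \<union> (\<Union>\<psi>\<in>\<Phi>. \<psi> ` {0<..<1})" using C by (elim conjE)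
    then show "topspace X = insert x V \<union> (\<Union>\<psi>\<in>\<Psi>. \<psi> ` {0<..<1})"
      unfolding un split \<Psi>_def by (simp add: im) blast
  qed
  then show ?thesis by (rule that)
qed

lemma pathin_subtopology_mono:
  "pathin (subtopology X \<Gamma>) g \<Longrightarrow> \<Gamma> \<subseteq> \<Delta> \<Longrightarrow> pathin (subtopology X \<Delta>) g"
  by (auto simp: pathin_subtopology)

lemma graph_cells_attach_arc:
  assumes "Hausdorff_space X" "\<Gamma> \<subseteq> topspace X" "graph_cells (subtopology X \<Gamma>) V \<Phi>" "attaching_arc X \<Gamma> \<alpha>"
    and "\<alpha> 0 \<in> V" "\<alpha> 1 \<in> \<Gamma> \<Longrightarrow> \<alpha> 1 \<in> V"
  shows "graph_cells (subtopology X (\<Gamma> \<union> \<alpha> ` {0..1})) (insert (\<alpha> 1) V) (insert \<alpha> \<Phi>)"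
proof -
  note C = assms(3)[unfolded graph_cells_def]
  have C1: "\<phi> ` {0<..<1} \<inter> \<psi> ` {0<..<1} = {}" if "\<phi> \<in> \<Phi>" "\<psi> \<in> \<Phi>" "\<phi> \<noteq> \<psi>" for \<phi> \<psi>
  proof -
    have "\<forall>\<phi>\<in>\<Phi>. \<forall>\<psi>\<in>\<Phi>. \<phi> \<noteq> \<psi> \<longrightarrow> \<phi> ` {0<..<1} \<inter> \<psi> ` {0<..<1} = {}" using C by (elim conjE)
    then show ?thesis using that by blast
  qed
  have C2: "topspace (subtopology X \<Gamma>) = V \<union> (\<Union>\<phi>\<in>\<Phi>. \<phi> ` {0<..<1})" using C by (elim conjE)
  have C3: "pathin (subtopology X \<Gamma>) \<phi>" "\<phi> 0 \<in> V" "\<phi> 1 \<in> V"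
    "embedding_map (top_of_set {0<..<1::real}) (subtopology X \<Gamma>) \<phi>" "\<phi> ` {0<..<1} \<inter> V = {}" if "\<phi> \<in> \<Phi>" for \<phi>
    using C that by auto
  have a: "pathin X \<alpha>" "inj_on \<alpha> {0..1}" "\<alpha> 0 \<in> \<Gamma>" "\<alpha> ` {0<..<1} \<inter> \<Gamma> = {}"
    using assms(4) by (auto simp: attaching_arc_def)
  have aim: "\<alpha> ` {0..1} \<subseteq> topspace X" using a(1) path_image_subset_topspace by blast
  have top: "topspace (subtopology X (\<Gamma> \<union> \<alpha> ` {0..1})) = \<Gamma> \<union> \<alpha> ` {0..1}" "topspace (subtopology X \<Gamma>) = \<Gamma>"
    using assms(2) aim by auto
  have emb: "embedding_map (top_of_set {0<..<1::real}) X \<alpha>"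
  proof -
    have "embedding_map (top_of_set {0..1}) X \<alpha>"
      using assms a by (intro continuous_imp_embedding_map) (auto simp: pathin_def compact_space_subtopology)
    moreover have "embedding_map (top_of_set {0<..<1::real}) (top_of_set {0..1}) id"
      by (auto simp: embedding_map_in_subtopology embedding_map_def homeomorphic_map_id subtopology_subtopology
          intro!: arg_cong[where f = "subtopology euclidean"])
    ultimately show ?thesis using embedding_map_compose by fastforce
  qed
  have \<phi>\<Gamma>: "\<phi> ` {0<..<1} \<subseteq> \<Gamma>" if "\<phi> \<in> \<Phi>" for \<phi> using C top that by auto
  have V\<Gamma>: "V \<subseteq> \<Gamma>" using C top by auto
  have split: "\<alpha> ` {0..1} = {\<alpha> 0, \<alpha> 1} \<union> \<alpha> ` {0<..<1}"
  proof -
    have "{0..1} = {0, 1::real} \<union> {0<..<1}" by auto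
    then show ?thesis by auto
  qed
  have a1: "\<alpha> 1 \<notin> \<alpha> ` {0<..<1}" using a(2) by (auto simp: inj_on_def) force
  show ?thesis
    unfolding graph_cells_def
  proof (intro conjI)
    show "finite (insert (\<alpha> 1) V)" "finite (insert \<alpha> \<Phi>)" using C by auto
    show "insert (\<alpha> 1) V \<subseteq> topspace (subtopology X (\<Gamma> \<union> \<alpha> ` {0..1}))" using V\<Gamma> top by auto
    show "\<forall>\<phi>\<in>insert \<alpha> \<Phi>. pathin (subtopology X (\<Gamma> \<union> \<alpha> ` {0..1})) \<phi> \<and> \<phi> 0 \<in> insert (\<alpha> 1) V \<and> \<phi> 1 \<in> insert (\<alpha> 1) V \<and>
         embedding_map (top_of_set {0<..<1::real}) (subtopology X (\<Gamma> \<union> \<alpha> ` {0..1})) \<phi> \<and> \<phi> ` {0<..<1} \<inter> insert (\<alpha> 1) V = {}"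
    proof
      fix \<phi> assume "\<phi> \<in> insert \<alpha> \<Phi>"
      then consider "\<phi> = \<alpha>" | "\<phi> \<in> \<Phi>" by auto
      then show "pathin (subtopology X (\<Gamma> \<union> \<alpha> ` {0..1})) \<phi> \<and> \<phi> 0 \<in> insert (\<alpha> 1) V \<and> \<phi> 1 \<in> insert (\<alpha> 1) V \<and>
         embedding_map (top_of_set {0<..<1::real}) (subtopology X (\<Gamma> \<union> \<alpha> ` {0..1})) \<phi> \<and> \<phi> ` {0<..<1} \<inter> insert (\<alpha> 1) V = {}"
      proof cases
        case 1
        have "\<alpha> ` {0<..<1} \<subseteq> \<alpha> ` {0..1}" by auto
        then show ?thesis using 1 a emb assms(5) V\<Gamma> a1
          by (auto simp: pathin_subtopology embedding_map_in_subtopology)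
      next
        case 2
        have "\<alpha> 1 \<notin> \<phi> ` {0<..<1}" using assms(6) C3(5)[OF 2] \<phi>\<Gamma>[OF 2] by blast
        moreover have "embedding_map (top_of_set {0<..<1::real}) (subtopology X (\<Gamma> \<union> \<alpha> ` {0..1})) \<phi>"
          using C3(4)[OF 2] \<phi>\<Gamma>[OF 2] by (simp add: embedding_map_in_subtopology le_supI1)
        moreover have "pathin (subtopology X (\<Gamma> \<union> \<alpha> ` {0..1})) \<phi>"
          using C3(1)[OF 2] by (rule pathin_subtopology_mono) simp
        ultimately show ?thesis using C3[OF 2] by simp
      qed
    qed
    show "\<forall>\<phi>\<in>insert \<alpha> \<Phi>. \<forall>\<psi>\<in>insert \<alpha> \<Phi>. \<phi> \<noteq> \<psi> \<longrightarrow> \<phi> ` {0<..<1} \<inter> \<psi> ` {0<..<1} = {}"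
    proof (intro ballI impI)
      have o: "\<phi> ` {0<..<1} \<inter> \<alpha> ` {0<..<1} = {}" if "\<phi> \<in> \<Phi>" for \<phi> using a(4) \<phi>\<Gamma>[OF that] by blast
      fix \<phi> \<psi> assume "\<phi> \<in> insert \<alpha> \<Phi>" "\<psi> \<in> insert \<alpha> \<Phi>" "\<phi> \<noteq> \<psi>"
      then show "\<phi> ` {0<..<1} \<inter> \<psi> ` {0<..<1} = {}"
        using o[of \<phi>] o[of \<psi>] C1[of \<phi> \<psi>] by (elim insertE) (simp_all add: Int_commute)
    qed
    have "\<Gamma> = V \<union> (\<Union>\<phi>\<in>\<Phi>. \<phi> ` {0<..<1})" using C2 top by simp
    then have "\<Gamma> \<union> ({\<alpha> 0, \<alpha> 1} \<union> \<alpha> ` {0<..<1}) = insert (\<alpha> 1) V \<union> (\<Union>\<phi>\<in>insert \<alpha> \<Phi>. \<phi> ` {0<..<1})"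
      using assms(5) by auto
    then show "topspace (subtopology X (\<Gamma> \<union> \<alpha> ` {0..1})) = insert (\<alpha> 1) V \<union> (\<Union>\<phi>\<in>insert \<alpha> \<Phi>. \<phi> ` {0<..<1})"
      unfolding top(1) unfolding split .
  qed
qed

lemma arc_complex_finite_graph:
  assumes "Hausdorff_space X" "arc_complex X k \<Gamma>"
  shows "finite_graph (subtopology X \<Gamma>)"
proof -
  have "\<exists>V \<Phi>. graph_cells (subtopology X \<Gamma>) V \<Phi>" using assms(2)
  proof induction
    case (point x)
    then have "graph_cells (subtopology X {x}) {x} {}" by (auto simp: graph_cells_def)
    then show ?case by blast
  next
    case (attach k \<Gamma> \<alpha>)
    have sub: "\<Gamma> \<subseteq> topspace X" using attach arc_complex_topology by blast
    then have top: "topspace (subtopology X \<Gamma>) = \<Gamma>" by auto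
    obtain V \<Phi> where "graph_cells (subtopology X \<Gamma>) V \<Phi>" using attach by blast
    moreover have a0: "\<alpha> 0 \<in> \<Gamma>" using attach by (auto simp: attaching_arc_def)
    ultimately obtain \<Phi>' where 1: "graph_cells (subtopology X \<Gamma>) (insert (\<alpha> 0) V) \<Phi>'"
      using graph_cells_insert_vertex top by metis
    obtain V' \<Phi>'' where "graph_cells (subtopology X \<Gamma>) V' \<Phi>''" "\<alpha> 0 \<in> V'" "\<alpha> 1 \<in> \<Gamma> \<Longrightarrow> \<alpha> 1 \<in> V'"
    proof (cases "\<alpha> 1 \<in> \<Gamma>")
      case True
      then obtain \<Psi> where "graph_cells (subtopology X \<Gamma>) (insert (\<alpha> 1) (insert (\<alpha> 0) V)) \<Psi>"
        using 1 graph_cells_insert_vertex top by metis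
      then show ?thesis using that by blast
    next
      case False
      then show ?thesis using 1 that by blast
    qed
    then show ?case using graph_cells_attach_arc[OF assms(1) sub] attach by blast
  qed
  then show ?thesis using assms(1) Hausdorff_space_subtopology finite_graph_iff_cells by blast
qed

section \<open>The first Betti number of an arc complex\<close>

lemma attaching_arc_meets_only_at_ends:
  assumes "attaching_arc X \<Gamma> \<alpha>" "v \<in> {0..1}" "\<alpha> v \<in> \<Gamma>"
  shows "v = 0 \<or> v = 1"
proof (rule ccontr)
  assume "\<not> (v = 0 \<or> v = 1)"
  then have "v \<in> {0<..<1}" using assms(2) by auto
  then show False using assms(1,3) unfolding attaching_arc_def by blast
qed

text \<open>The part of the path \<open>g\<close> that runs on the arc is pushed into \<open>\<Gamma>\<close> by a retraction of the arc: \<open>m\<close>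
  is a deformation of the parameter interval (or of the part \<open>J\<close> of it that \<open>g\<close> visits) which fixes the
  parameters of points in \<open>\<Gamma>\<close>. The homotopy is a singular square whose sides are \<open>g\<close>, a path in \<open>\<Gamma>\<close>
  and two paths that stay at a point of \<open>\<Gamma>\<close> or move along the arc; for the last three the claim is known.\<close>

lemma path_homotopy_across_arc:
  fixes X :: "'b topology" and m :: "real \<Rightarrow> real \<Rightarrow> real"
  assumes X: "Hausdorff_space X" and \<Gamma>: "closedin X \<Gamma>" and arc: "attaching_arc X \<Gamma> \<alpha>"
    and W: "subspace W" "real_boundaries 1 (subtopology X (\<Gamma> \<union> \<alpha> ` {0..1})) \<subseteq> W"
    and J: "J \<subseteq> {0..1}" "0 \<in> J" "1 \<in> J" and m: "continuous_on ({0..1} \<times> J) (\<lambda>z. m (fst z) (snd z))"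
    and m01: "\<And>s v. s \<in> {0..1} \<Longrightarrow> v \<in> J \<Longrightarrow> m s v \<in> {0..1}"
    and m1: "\<And>v. v \<in> J \<Longrightarrow> m 1 v = v"
    and m0: "\<And>v. v \<in> J \<Longrightarrow> \<alpha> (m 0 v) \<in> \<Gamma>"
    and m\<Gamma>: "\<And>s v. s \<in> {0..1} \<Longrightarrow> v \<in> J \<Longrightarrow> \<alpha> v \<in> \<Gamma> \<Longrightarrow> m s v = v"
    and in\<Gamma>: "\<And>g. pathin (subtopology X \<Gamma>) g \<Longrightarrow> path_chain g + p (g 0) - p (g 1) \<in> W"
    and in\<alpha>: "\<And>\<tau>. continuous_on {0..1} \<tau> \<Longrightarrow> \<tau> ` {0..1} \<subseteq> {0..1} \<Longrightarrow>
        path_chain (\<alpha> \<circ> \<tau>) + p (\<alpha> (\<tau> 0)) - p (\<alpha> (\<tau> 1)) \<in> W"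
    and g: "pathin X g" "g ` {0..1} \<subseteq> \<Gamma> \<union> \<alpha> ` J"
  shows "path_chain g + p (g 0) - p (g 1) \<in> W"
proof -
  have a: "pathin X \<alpha>" "inj_on \<alpha> {0..1}" "\<alpha> 0 \<in> \<Gamma>" "\<alpha> ` {0<..<1} \<inter> \<Gamma> = {}"
    using arc by (auto simp: attaching_arc_def)
  let ?I = "{0..1::real}" let ?X' = "subtopology X (\<Gamma> \<union> \<alpha> ` {0..1})"
  obtain \<beta> where \<beta>: "continuous_map (subtopology X (\<alpha> ` ?I)) (top_of_set ?I) \<beta>"
    "\<And>t. t \<in> ?I \<Longrightarrow> \<beta> (\<alpha> t) = t" using arc_inverse[OF X a(1,2)] by metis
  have \<alpha>cont: "continuous_map (top_of_set ?I) X \<alpha>" using a(1) by (simp add: pathin_def)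
  have gcont: "continuous_map (top_of_set ?I) X g" using g(1) by (simp add: pathin_def)
  have g2: "g t \<in> \<Gamma> \<union> \<alpha> ` J" if "t \<in> ?I" for t using g(2) that by blast
  have g3: "g t \<in> \<alpha> ` ?I" if "t \<in> ?I" "g t \<notin> \<Gamma>" for t using g2[OF that(1)] that(2) J(1) by blast
  have \<beta>J: "\<beta> (g t) \<in> J" "\<alpha> (\<beta> (g t)) = g t" if t: "t \<in> ?I" "g t \<in> \<alpha> ` ?I" for t
  proof -
    obtain v where v: "v \<in> ?I" "g t = \<alpha> v" using t by auto
    have "v \<in> J"
    proof (cases "v = 0 \<or> v = 1")
      case True
      then show ?thesis using J by auto
    next
      case False
      then have "g t \<notin> \<Gamma>" using v attaching_arc_meets_only_at_ends[OF arc v(1)] by auto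
      then obtain w where w: "w \<in> J" "g t = \<alpha> w" using g2[OF t(1)] by auto
      then have "w = v" using \<beta>(2)[of w] \<beta>(2)[of v] v J by auto
      then show ?thesis using w by simp
    qed
    then show "\<beta> (g t) \<in> J" "\<alpha> (\<beta> (g t)) = g t" using v \<beta>(2)[of v] by auto
  qed
  define K where "K z = \<alpha> (m (fst z) (\<beta> (g (snd z))))" for z :: "real \<times> real"
  define H where "H z = (if g (snd z) \<in> \<Gamma> then g (snd z) else K z)" for z :: "real \<times> real"
  let ?Q = "top_of_set (?I \<times> ?I)"
  let ?A = "{z \<in> topspace ?Q. (g \<circ> snd) z \<in> \<Gamma>}" let ?B = "{z \<in> topspace ?Q. (g \<circ> snd) z \<in> \<alpha> ` ?I}"
  have gs: "continuous_map ?Q X (g \<circ> snd)"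
    by (rule continuous_map_compose[OF _ gcont]) (auto intro!: continuous_intros)
  have cl\<alpha>: "closedin X (\<alpha> ` ?I)" using compactin_imp_closedin[OF X compactin_path_image[OF a(1)]] .
  have clA: "closedin ?Q ?A" using closedin_continuous_map_preimage[OF gs \<Gamma>] .
  have clB: "closedin ?Q ?B" using closedin_continuous_map_preimage[OF gs cl\<alpha>] .
  have zB: "fst z \<in> ?I" "snd z \<in> ?I" "\<beta> (g (snd z)) \<in> J" "\<alpha> (\<beta> (g (snd z))) = g (snd z)" if "z \<in> ?B" for z
  proof -
    show z: "fst z \<in> ?I" "snd z \<in> ?I" using that by auto
    have "g (snd z) \<in> \<alpha> ` ?I" using that by simp
    then show "\<beta> (g (snd z)) \<in> J" "\<alpha> (\<beta> (g (snd z))) = g (snd z)" using \<beta>J[OF z(2)] by auto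
  qed
  have contK: "continuous_map (subtopology ?Q ?B) X K"
  proof -
    have "continuous_map (subtopology ?Q ?B) (subtopology X (\<alpha> ` ?I)) (g \<circ> snd)"
      using gs by (auto simp: continuous_map_in_subtopology continuous_map_from_subtopology)
    then have "continuous_map (subtopology ?Q ?B) (top_of_set ?I) (\<beta> \<circ> (g \<circ> snd))"
      using \<beta>(1) by (rule continuous_map_compose)
    then have "continuous_map (subtopology ?Q ?B) euclideanreal (\<beta> \<circ> (g \<circ> snd))"
      using continuous_map_into_fulltopology by blast
    moreover have sB: "subtopology ?Q ?B = top_of_set ?B"
      by (auto simp: subtopology_subtopology intro!: arg_cong[where f = "subtopology euclidean"])
    ultimately have cB: "continuous_on ?B (\<lambda>z. \<beta> (g (snd z)))" by (simp add: o_def)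
    have "continuous_on ?B (\<lambda>z. m (fst (fst z, \<beta> (g (snd z)))) (snd (fst z, \<beta> (g (snd z)))))"
    proof (rule continuous_on_compose2[OF m])
      show "continuous_on ?B (\<lambda>z. (fst z, \<beta> (g (snd z))))" by (intro continuous_intros cB)
      show "(\<lambda>z. (fst z, \<beta> (g (snd z)))) ` ?B \<subseteq> ?I \<times> J"
        by (rule image_subsetI) (simp only: mem_Times_iff fst_conv snd_conv zB simp_thms)
    qed
    moreover have "m (fst z) (\<beta> (g (snd z))) \<in> ?I" if "z \<in> ?B" for z by (rule m01[OF zB(1,3)[OF that]])
    ultimately have "continuous_map (top_of_set ?B) (top_of_set ?I) (\<lambda>z. m (fst z) (\<beta> (g (snd z))))" by auto
    then have "continuous_map (top_of_set ?B) X (\<alpha> \<circ> (\<lambda>z. m (fst z) (\<beta> (g (snd z)))))"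
      using \<alpha>cont by (rule continuous_map_compose)
    then show ?thesis by (simp only: sB) (simp add: K_def[abs_def] o_def)
  qed
  have agree: "K z = g (snd z)" if "z \<in> ?A" "z \<in> ?B" for z
  proof -
    have "g (snd z) \<in> \<Gamma>" using that(1) by simp
    then have "m (fst z) (\<beta> (g (snd z))) = \<beta> (g (snd z))" using m\<Gamma>[OF zB(1,3)[OF that(2)]] zB(4)[OF that(2)] by simp
    then show ?thesis using zB(4)[OF that(2)] by (simp add: K_def)
  qed
  have "continuous_map ?Q X H"
  proof (rule pasting_lemma_closed[of "UNIV :: bool set" ?Q "\<lambda>b. if b then ?A else ?B" X "\<lambda>b. if b then g \<circ> snd else K"])
    fix x assume x: "x \<in> topspace ?Q"
    show "\<exists>j. j \<in> UNIV \<and> x \<in> (if j then ?A else ?B) \<and> H x = (if j then g \<circ> snd else K) x"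
    proof (cases "g (snd x) \<in> \<Gamma>")
      case True
      then show ?thesis using x by (intro exI[of _ True]) (simp add: H_def)
    next
      case False
      moreover have "snd x \<in> ?I" using x by auto
      ultimately have "g (snd x) \<in> \<alpha> ` ?I" using g3 by blast
      then show ?thesis using x False by (intro exI[of _ False]) (simp add: H_def)
    qed
  next
    fix i j x assume "x \<in> topspace ?Q \<inter> (if i then ?A else ?B) \<inter> (if j then ?A else ?B)"
    then show "(if i then g \<circ> snd else K) x = (if j then g \<circ> snd else K) x"
      using agree by (cases i; cases j) auto
  next
    fix i show "continuous_map (subtopology ?Q (if i then ?A else ?B)) X (if i then g \<circ> snd else K)"
      using continuous_map_from_subtopology[OF gs] contK by (cases i) auto
  qed (use clA clB in auto)
  moreover have "H z \<in> \<Gamma> \<union> \<alpha> ` ?I" if "z \<in> ?I \<times> ?I" for z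
  proof (cases "g (snd z) \<in> \<Gamma>")
    case False
    then have "g (snd z) \<in> \<alpha> ` ?I" using g3[of "snd z"] that by auto
    then show ?thesis using False m01[of "fst z"] \<beta>J[of "snd z"] that by (auto simp: H_def K_def)
  qed (simp add: H_def)
  ultimately have H: "continuous_map ?Q ?X' H" by (auto simp: continuous_map_in_subtopology)
  have sq: "path_chain (\<lambda>t. H (0, t)) + path_chain (\<lambda>s. H (s, 1))
      - path_chain (\<lambda>s. H (s, 0)) - path_chain (\<lambda>t. H (1, t)) \<in> W"
    using square_boundary[OF H] W(2) by blast
  have H1: "H (1, t) = g t" if "t \<in> ?I" for t
  proof (cases "g t \<in> \<Gamma>")
    case False
    then have "g t \<in> \<alpha> ` ?I" using g3 that by auto
    then show ?thesis using m1 \<beta>J[OF that] by (simp add: H_def K_def)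
  qed (simp add: H_def)
  have H0: "path_chain (\<lambda>t. H (0, t)) + p (H (0, 0)) - p (H (0, 1)) \<in> W"
  proof (rule in\<Gamma>)
    have "continuous_map (top_of_set ?I) ?Q (\<lambda>t. (0, t))" by (auto intro!: continuous_intros)
    from continuous_map_compose[OF this H] have "continuous_map (top_of_set ?I) X (\<lambda>t. H (0, t))"
      by (simp add: o_def continuous_map_in_subtopology)
    moreover have "H (0, t) \<in> \<Gamma>" if "t \<in> ?I" for t
    proof (cases "g t \<in> \<Gamma>")
      case False
      then have "g t \<in> \<alpha> ` ?I" using g3 that by auto
      then show ?thesis using m0 \<beta>J[OF that] by (simp add: H_def K_def)
    qed (simp add: H_def)
    ultimately show "pathin (subtopology X \<Gamma>) (\<lambda>t. H (0, t))" by (auto simp: pathin_def continuous_map_in_subtopology)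
  qed
  have side: "path_chain (\<lambda>s. H (s, t)) + p (H (0, t)) - p (H (1, t)) \<in> W" if t: "t \<in> ?I" for t
  proof (cases "g t \<in> \<Gamma>")
    case True
    then have "g t \<in> topspace (subtopology X \<Gamma>)" using path_image_subset_topspace[OF g(1)] t by auto
    then have "pathin (subtopology X \<Gamma>) (\<lambda>s. g t)" by (simp add: pathin_def)
    from in\<Gamma>[OF this] show ?thesis using True by (simp add: H_def)
  next
    case False
    then have ga: "g t \<in> \<alpha> ` ?I" using g3 t by auto
    have "continuous_on ?I (\<lambda>s. m (fst (s, \<beta> (g t))) (snd (s, \<beta> (g t))))"
      by (rule continuous_on_compose2[OF m]) (use \<beta>J[OF t ga] in \<open>auto intro!: continuous_intros\<close>)
    then have "continuous_on ?I (\<lambda>s. m s (\<beta> (g t)))" by simp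
    from in\<alpha>[OF this] have "path_chain (\<alpha> \<circ> (\<lambda>s. m s (\<beta> (g t)))) + p (\<alpha> (m 0 (\<beta> (g t)))) - p (\<alpha> (m 1 (\<beta> (g t)))) \<in> W"
      using m01[OF _ \<beta>J(1)[OF t ga]] by (simp only: image_subset_iff) blast
    then show ?thesis using False by (simp add: H_def K_def o_def)
  qed
  have "(path_chain (\<lambda>t. H (0, t)) + p (H (0, 0)) - p (H (0, 1)))
      + (path_chain (\<lambda>s. H (s, 1)) + p (H (0, 1)) - p (H (1, 1)))
      - (path_chain (\<lambda>s. H (s, 0)) + p (H (0, 0)) - p (H (1, 0)))
      - (path_chain (\<lambda>t. H (0, t)) + path_chain (\<lambda>s. H (s, 1))
      - path_chain (\<lambda>s. H (s, 0)) - path_chain (\<lambda>t. H (1, t))) \<in> W"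
    by (intro subspace_diff subspace_add W(1) H0 side sq) auto
  then have "path_chain (\<lambda>t. H (1, t)) + p (H (1, 0)) - p (H (1, 1)) \<in> W" by (simp add: algebra_simps)
  moreover have "path_chain (\<lambda>t. H (1, t)) = path_chain g" by (rule path_chain_cong) (rule H1)
  ultimately show ?thesis using H1[of 0] H1[of 1] by simp
qed

text \<open>Extend \<open>p\<close> over the arc by adding the initial piece of the arc to \<open>p (\<alpha> 0)\<close>. If the end of the
  arc is free, the arc retracts onto its starting point and nothing new appears. If not, the only
  conflict is at \<open>\<alpha> 1\<close>, where \<open>p\<close> and its extension differ by the cycle that runs once through the
  arc; this cycle is added to the spanning set.\<close>

lemma path_spanning_attach:
  fixes X :: "'b topology"
  assumes X: "Hausdorff_space X" and \<Gamma>: "closedin X \<Gamma>" and arc: "attaching_arc X \<Gamma> \<alpha>"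
    and sp: "path_spanning (subtopology X \<Gamma>) p S"
  shows "\<exists>p' S'. path_spanning (subtopology X (\<Gamma> \<union> \<alpha> ` {0..1})) p' S' \<and>
     card S' \<le> (if \<alpha> 1 \<in> \<Gamma> then Suc (card S) else card S)"
proof -
  let ?I = "{0..1::real}" let ?X' = "subtopology X (\<Gamma> \<union> \<alpha> ` {0..1})"
  have a: "pathin X \<alpha>" "inj_on \<alpha> ?I" "\<alpha> 0 \<in> \<Gamma>" "\<alpha> ` {0<..<1} \<inter> \<Gamma> = {}"
    using arc by (auto simp: attaching_arc_def)
  have sub: "\<Gamma> \<subseteq> topspace X" using \<Gamma> closedin_subset by blast
  have top: "topspace ?X' = \<Gamma> \<union> \<alpha> ` ?I" "topspace (subtopology X \<Gamma>) = \<Gamma>"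
    using sub path_image_subset_topspace[OF a(1)] by auto
  obtain \<beta> where \<beta>: "continuous_map (subtopology X (\<alpha> ` ?I)) (top_of_set ?I) \<beta>"
    "\<And>t. t \<in> ?I \<Longrightarrow> \<beta> (\<alpha> t) = t" using arc_inverse[OF X a(1,2)] by metis
  obtain x0 where x0: "\<And>x. x \<in> \<Gamma> \<Longrightarrow> p x \<in> real_chains 1 (subtopology X \<Gamma>)"
    "\<And>x. x \<in> \<Gamma> \<Longrightarrow> real_boundary 1 (p x) = point_chain x - point_chain x0"
    using sp top by (auto simp: path_spanning_def)
  have pathg: "path_chain g + p (g 0) - p (g 1) \<in> span (S \<union> real_boundaries 1 (subtopology X \<Gamma>))"
    if "pathin (subtopology X \<Gamma>) g" for g using sp that by (auto simp: path_spanning_def)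
  define e where "e t = p (\<alpha> 0) + path_chain (\<alpha> \<circ> seg 0 t)" for t
  define p' where "p' x = (if x \<in> \<Gamma> then p x else e (\<beta> x))" for x
  define S' where "S' = (if \<alpha> 1 \<in> \<Gamma> then insert (e 1 - p (\<alpha> 1)) S else S)"
  let ?W = "span (S' \<union> real_boundaries 1 ?X')"
  have a': "pathin ?X' \<alpha>" using a(1) by (auto simp: pathin_subtopology)
  have mono: "real_chains 1 (subtopology X \<Gamma>) \<subseteq> real_chains 1 ?X'"
    "real_cycles 1 (subtopology X \<Gamma>) \<subseteq> real_cycles 1 ?X'"
    "real_boundaries 1 (subtopology X \<Gamma>) \<subseteq> real_boundaries 1 ?X'"
    by (rule real_chains_mono real_cycles_mono real_boundaries_mono; simp)+
  have e_chain: "e t \<in> real_chains 1 ?X'" if "t \<in> ?I" for t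
  proof -
    have "pathin ?X' (\<alpha> \<circ> seg 0 t)" using a' that by (intro pathin_seg[of ?I]) (auto simp: pathin_def)
    then show ?thesis unfolding e_def using x0(1)[OF a(3)] mono(1)
      by (intro subspace_add subspace_real_chains path_chain_in_chains) auto
  qed
  have e_boundary: "real_boundary 1 (e t) = point_chain (\<alpha> t) - point_chain x0" for t
    unfolding e_def using x0(2)[OF a(3)]
    by (simp add: linear_add[OF linear_real_boundary] real_boundary_path_chain del: One_nat_def)
  have e1: "e 1 - p (\<alpha> 1) \<in> real_cycles 1 ?X'" if "\<alpha> 1 \<in> \<Gamma>"
    unfolding real_cycles_def using e_chain[of 1] e_boundary[of 1] x0[OF that] mono(1)
    by (auto simp: linear_diff[OF linear_real_boundary] subspace_diff[OF subspace_real_chains] simp del: One_nat_def)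
  have BW: "real_boundaries 1 ?X' \<subseteq> ?W" by (rule order_trans[OF Un_upper2 span_superset])
  have e_p': "e t - p' (\<alpha> t) \<in> ?W" if t: "t \<in> ?I" for t
  proof -
    consider "t = 0" | "t = 1" "\<alpha> 1 \<in> \<Gamma>" | "\<alpha> t \<notin> \<Gamma>"
      using attaching_arc_meets_only_at_ends[OF arc t] by blast
    then show ?thesis
    proof cases
      case 1
      have "\<alpha> 0 \<in> topspace ?X'" using a(3) top by simp
      from constant_path_boundary[OF this] have "path_chain (\<alpha> \<circ> seg 0 0) \<in> real_boundaries 1 ?X'"
        by (simp add: seg_def o_def)
      then show ?thesis using BW 1 a(3) by (auto simp: e_def p'_def)
    next
      case 2
      then show ?thesis by (auto simp: p'_def S'_def intro: span_base)
    next
      case 3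
      then show ?thesis using \<beta>(2)[OF t] by (simp add: p'_def span_zero)
    qed
  qed
  have in\<alpha>: "path_chain (\<alpha> \<circ> \<tau>) + p' (\<alpha> (\<tau> 0)) - p' (\<alpha> (\<tau> 1)) \<in> ?W"
    if \<tau>: "continuous_on ?I \<tau>" "\<tau> ` ?I \<subseteq> ?I" for \<tau>
  proof -
    define H where "H = \<alpha> \<circ> (\<lambda>z. fst z * \<tau> (snd z))"
    have "continuous_on (?I \<times> ?I) (\<lambda>z. fst z * \<tau> (snd z))"
      by (intro continuous_intros continuous_on_compose2[OF \<tau>(1)]) auto
    moreover have "fst z * \<tau> (snd z) \<in> ?I" if "z \<in> ?I \<times> ?I" for z
      using \<tau>(2) that by (auto intro!: mult_nonneg_nonneg mult_le_one simp: image_subset_iff)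
    ultimately have "continuous_map (top_of_set (?I \<times> ?I)) (top_of_set ?I) (\<lambda>z. fst z * \<tau> (snd z))" by auto
    then have "continuous_map (top_of_set (?I \<times> ?I)) ?X' H"
      unfolding H_def by (rule continuous_map_compose) (use a' in \<open>simp add: pathin_def\<close>)
    from square_boundary[OF this]
    have sq: "path_chain (\<lambda>t. \<alpha> 0) + path_chain (\<alpha> \<circ> seg 0 (\<tau> 1)) - path_chain (\<alpha> \<circ> seg 0 (\<tau> 0)) - path_chain (\<alpha> \<circ> \<tau>) \<in> ?W"
      using BW by (auto simp: H_def o_def seg_def)
    have "\<alpha> 0 \<in> topspace ?X'" using a(3) top by simp
    from constant_path_boundary[OF this] have c: "path_chain (\<lambda>t. \<alpha> 0) \<in> ?W" using BW by blast
    have \<tau>01: "\<tau> 0 \<in> ?I" "\<tau> 1 \<in> ?I" using \<tau>(2) by (auto simp: image_subset_iff)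
    have "path_chain (\<lambda>t. \<alpha> 0) - (path_chain (\<lambda>t. \<alpha> 0) + path_chain (\<alpha> \<circ> seg 0 (\<tau> 1)) - path_chain (\<alpha> \<circ> seg 0 (\<tau> 0)) - path_chain (\<alpha> \<circ> \<tau>))
        + (e (\<tau> 1) - p' (\<alpha> (\<tau> 1))) - (e (\<tau> 0) - p' (\<alpha> (\<tau> 0))) \<in> ?W"
      by (intro span_diff span_add c sq e_p' \<tau>01)
    then show ?thesis by (simp add: e_def algebra_simps)
  qed
  have in\<Gamma>: "path_chain g + p' (g 0) - p' (g 1) \<in> ?W" if g: "pathin (subtopology X \<Gamma>) g" for g
  proof -
    have "g ` ?I \<subseteq> \<Gamma>" using g by (simp add: pathin_subtopology image_subset_iff)
    then have "g 0 \<in> \<Gamma>" "g 1 \<in> \<Gamma>" by auto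
    moreover have "span (S \<union> real_boundaries 1 (subtopology X \<Gamma>)) \<subseteq> ?W"
      using mono(3) by (intro span_mono) (auto simp: S'_def)
    ultimately show ?thesis using pathg[OF g] by (auto simp: p'_def)
  qed
  have all: "path_chain g + p' (g 0) - p' (g 1) \<in> ?W" if g': "pathin ?X' g" for g
  proof -
    have g: "pathin X g" "g ` ?I \<subseteq> \<Gamma> \<union> \<alpha> ` ?I" using g' by (auto simp: pathin_subtopology)
    show ?thesis
    proof (cases "\<alpha> 1 \<in> \<Gamma>")
      case False
      show ?thesis
      proof (rule path_homotopy_across_arc[OF X \<Gamma> arc subspace_span BW, where J = ?I and m = "\<lambda>s v. s * v"])
        show "\<alpha> v \<in> \<Gamma> \<Longrightarrow> s * v = v" if "v \<in> ?I" for s v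
        proof -
          assume "\<alpha> v \<in> \<Gamma>"
          then have "v = 0" using attaching_arc_meets_only_at_ends[OF arc that] False by auto
          then show ?thesis by simp
        qed
      qed (use in\<Gamma> in\<alpha> g a(3) in \<open>auto intro!: continuous_intros mult_le_one\<close>)
    next
      case True
      \<comment> \<open>the condition is additive under concatenation, so it suffices to check it locally: a short piece of the path either stays on the open arc or avoids the midpoint of the arc\<close>
      define P where "P s t \<longleftrightarrow> (0 \<le> s \<longrightarrow> s \<le> t \<longrightarrow> t \<le> 1 \<longrightarrow>
        path_chain (g \<circ> seg s t) + p' (g s) - p' (g t) \<in> ?W)" for s t :: real
      have gcont: "continuous_map (top_of_set ?I) X g" using g(1) by (simp add: pathin_def)
      have subg: "pathin X (g \<circ> seg s t)" "(g \<circ> seg s t) ` ?I \<subseteq> g ` {s..t}" if "0 \<le> s" "s \<le> t" "t \<le> 1" for s t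
      proof -
        show "pathin X (g \<circ> seg s t)" using that by (intro pathin_seg[OF gcont]) auto
        have "seg s t v \<in> {s..t}" if "v \<in> ?I" for v
          using seg_in_convex[of "{s..t}" s t v] that \<open>s \<le> t\<close> by simp
        then show "(g \<circ> seg s t) ` ?I \<subseteq> g ` {s..t}" by auto
      qed
      have nbhd: "\<exists>d>0. \<forall>t\<in>?I. \<bar>t - x\<bar> < d \<longrightarrow> g t \<in> U" if U: "openin X U" "x \<in> ?I" "g x \<in> U" for U x
      proof -
        have "openin (top_of_set ?I) {t \<in> ?I. g t \<in> U}"
          using openin_continuous_map_preimage[OF gcont U(1)] by simp
        then obtain d where "d > 0" "\<And>t. t \<in> ?I \<Longrightarrow> dist t x < d \<Longrightarrow> g t \<in> U"
          using U(2,3) unfolding openin_euclidean_subtopology_iff by blast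
        then show ?thesis by (auto simp: dist_real_def)
      qed
      have "P 0 1"
      proof (rule Bolzano)
        fix r s t :: real assume rst: "P r s" "P s t" "r \<le> s" "s \<le> t"
        show "P r t"
          unfolding P_def
        proof (intro impI)
          assume b: "0 \<le> r" "r \<le> t" "t \<le> 1"
          have sp: "path_chain (g \<circ> seg r s) + path_chain (g \<circ> seg s t) - path_chain (g \<circ> seg r t) \<in> ?W"
            using path_split_boundary[OF g', of r s t] b rst BW by auto
          have "path_chain (g \<circ> seg r s) + p' (g r) - p' (g s) \<in> ?W" "path_chain (g \<circ> seg s t) + p' (g s) - p' (g t) \<in> ?W"
            using rst b unfolding P_def by auto
          from span_diff[OF span_add[OF this] sp]
          have "(path_chain (g \<circ> seg r s) + p' (g r) - p' (g s)) + (path_chain (g \<circ> seg s t) + p' (g s) - p' (g t))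
            - (path_chain (g \<circ> seg r s) + path_chain (g \<circ> seg s t) - path_chain (g \<circ> seg r t)) \<in> ?W" .
          then show "path_chain (g \<circ> seg r t) + p' (g r) - p' (g t) \<in> ?W" by (simp add: algebra_simps)
        qed
      next
        fix x :: real assume x: "0 \<le> x" "x \<le> 1"
        show "\<exists>d>0. \<forall>s t. s \<le> x \<and> x \<le> t \<and> t - s < d \<longrightarrow> P s t"
        proof (cases "g x = \<alpha> (1/2)")
          case mid: True
          have "\<alpha> (1/2) \<notin> \<Gamma>" using attaching_arc_meets_only_at_ends[OF arc, of "1/2"] by auto
          then have "g x \<in> topspace X - \<Gamma>" using mid pathin_in_topspace[OF g(1), of x] x by auto
          moreover have "openin X (topspace X - \<Gamma>)" using \<Gamma> by blast
          ultimately obtain d where d: "d > 0" "\<And>t. t \<in> ?I \<Longrightarrow> \<bar>t - x\<bar> < d \<Longrightarrow> g t \<in> topspace X - \<Gamma>"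
            using nbhd[of "topspace X - \<Gamma>" x] x by auto
          have "P s t" if st: "s \<le> x" "x \<le> t" "t - s < d" for s t
            unfolding P_def
          proof (intro impI)
            assume b: "0 \<le> s" "s \<le> t" "t \<le> 1"
            have "g ` {s..t} \<subseteq> \<alpha> ` ?I"
            proof
              fix y assume "y \<in> g ` {s..t}"
              then obtain v where v: "v \<in> {s..t}" "y = g v" by auto
              moreover have "v \<in> ?I" "\<bar>v - x\<bar> < d" using v(1) b st by auto
              ultimately show "y \<in> \<alpha> ` ?I" using d(2)[of v] g(2) by blast
            qed
            then have im: "(g \<circ> seg s t) ` ?I \<subseteq> \<alpha> ` ?I" using subg(2)[OF b] by blast
            define \<tau> where "\<tau> = \<beta> \<circ> (g \<circ> seg s t)"
            have "continuous_map (top_of_set ?I) (subtopology X (\<alpha> ` ?I)) (g \<circ> seg s t)"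
              using subg(1)[OF b] im by (auto simp: pathin_def continuous_map_in_subtopology)
            then have "continuous_map (top_of_set ?I) (top_of_set ?I) \<tau>"
              unfolding \<tau>_def using \<beta>(1) by (rule continuous_map_compose)
            then have \<tau>: "continuous_on ?I \<tau>" "\<tau> ` ?I \<subseteq> ?I" by (auto simp: continuous_map_in_subtopology)
            have \<alpha>\<tau>: "\<alpha> (\<tau> v) = (g \<circ> seg s t) v" if "v \<in> ?I" for v
            proof -
              have "(g \<circ> seg s t) v \<in> \<alpha> ` ?I" using im imageI[OF \<open>v \<in> ?I\<close>, of "g \<circ> seg s t"] by (rule subsetD)
              then obtain w where "w \<in> ?I" "(g \<circ> seg s t) v = \<alpha> w" unfolding image_iff by blast
              then show ?thesis using \<beta>(2) by (simp add: \<tau>_def)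
            qed
            have "path_chain (\<alpha> \<circ> \<tau>) = path_chain (g \<circ> seg s t)"
              by (rule path_chain_cong) (use \<alpha>\<tau> in auto)
            then show "path_chain (g \<circ> seg s t) + p' (g s) - p' (g t) \<in> ?W"
              using in\<alpha>[OF \<tau>] \<alpha>\<tau>[of 0] \<alpha>\<tau>[of 1] by simp
          qed
          then show ?thesis using d(1) by blast
        next
          case off: False
          have "closedin X {\<alpha> (1/2)}"
            using X path_image_subset_topspace[OF a(1)] by (intro closedin_Hausdorff_singleton) auto
          then have "openin X (topspace X - {\<alpha> (1/2)})" by blast
          moreover have "g x \<in> topspace X - {\<alpha> (1/2)}" using off path_image_subset_topspace[OF g(1)] x by auto
          ultimately obtain d where d: "d > 0" "\<And>t. t \<in> ?I \<Longrightarrow> \<bar>t - x\<bar> < d \<Longrightarrow> g t \<in> topspace X - {\<alpha> (1/2)}"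
            using nbhd[of "topspace X - {\<alpha> (1/2)}" x] x by auto
          have "P s t" if st: "s \<le> x" "x \<le> t" "t - s < d" for s t
            unfolding P_def
          proof (intro impI)
            assume b: "0 \<le> s" "s \<le> t" "t \<le> 1"
            let ?J = "?I - {1/2}"
            \<comment> \<open>without its midpoint, the arc retracts onto its two ends\<close>
            define m where "m r v = (if v \<le> 1/2 then r * v else 1 - r * (1 - v))" for r v :: real
            have contm: "continuous_on (?I \<times> ?J) (\<lambda>z. m (fst z) (snd z))"
            proof -
              have "continuous_map (top_of_set (?I \<times> ?J)) euclideanreal
                  (\<lambda>z. if snd z \<le> 1/2 then fst z * snd z else 1 - fst z * (1 - snd z))"
                by (rule continuous_map_cases_le)
                  (auto intro!: continuous_intros continuous_map_from_subtopology)
              then show ?thesis by (simp add: m_def)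
            qed
            have m01: "m r v \<in> ?I" if "r \<in> ?I" "v \<in> ?J" for r v
            proof -
              have "0 \<le> r * v" "r * v \<le> 1" "0 \<le> r * (1 - v)" "r * (1 - v) \<le> 1"
                using that by (auto intro!: mult_le_one)
              then show ?thesis by (auto simp: m_def)
            qed
            have gJ: "(g \<circ> seg s t) ` ?I \<subseteq> \<Gamma> \<union> \<alpha> ` ?J"
            proof
              fix y assume "y \<in> (g \<circ> seg s t) ` ?I"
              then obtain v where v: "v \<in> {s..t}" "y = g v" using subg(2)[OF b] by auto
              moreover have "v \<in> ?I" "\<bar>v - x\<bar> < d" using v b st by auto
              ultimately have "y \<in> \<Gamma> \<union> \<alpha> ` ?I" using g(2) imageI[of v ?I g] by (metis subsetD)
              moreover have "y \<noteq> \<alpha> (1/2)" using d(2)[OF \<open>v \<in> ?I\<close> \<open>\<bar>v - x\<bar> < d\<close>] v by simp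
              ultimately have "y \<in> \<Gamma> \<union> \<alpha> ` ?I" "y \<noteq> \<alpha> (1/2)" .
              then show "y \<in> \<Gamma> \<union> \<alpha> ` ?J" by auto
            qed
            have ends: "v = 0 \<or> v = 1" if "v \<in> ?I" "\<alpha> v \<in> \<Gamma>" for v
              using attaching_arc_meets_only_at_ends[OF arc that] .
            have "path_chain (g \<circ> seg s t) + p' ((g \<circ> seg s t) 0) - p' ((g \<circ> seg s t) 1) \<in> ?W"
            proof (rule path_homotopy_across_arc[OF X \<Gamma> arc subspace_span BW, where J = ?J and m = m])
              show "m 1 v = v" "\<alpha> (m 0 v) \<in> \<Gamma>" for v using a(3) True by (auto simp: m_def)
              show "m r v = v" if "v \<in> ?J" "\<alpha> v \<in> \<Gamma>" for r v using ends[of v] that by (auto simp: m_def)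
              show "continuous_on (?I \<times> ?J) (\<lambda>z. m (fst z) (snd z))" by (rule contm)
              show "m r v \<in> ?I" if "r \<in> ?I" "v \<in> ?J" for r v by (rule m01[OF that])
              show "path_chain g + p' (g 0) - p' (g 1) \<in> ?W" if "pathin (subtopology X \<Gamma>) g" for g by (rule in\<Gamma>[OF that])
              show "path_chain (\<alpha> \<circ> \<tau>) + p' (\<alpha> (\<tau> 0)) - p' (\<alpha> (\<tau> 1)) \<in> ?W"
                if "continuous_on ?I \<tau>" "\<tau> ` ?I \<subseteq> ?I" for \<tau> by (rule in\<alpha>[OF that])
              show "pathin X (g \<circ> seg s t)" by (rule subg(1)[OF b])
              show "(g \<circ> seg s t) ` ?I \<subseteq> \<Gamma> \<union> \<alpha> ` ?J" by (rule gJ)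
            qed auto
            then show "path_chain (g \<circ> seg s t) + p' (g s) - p' (g t) \<in> ?W" by simp
          qed
          then show ?thesis using d(1) by blast
        qed
      qed simp
      then show ?thesis by (simp add: P_def seg_def[abs_def] o_def)
    qed
  qed
  have "path_spanning ?X' p' S'"
    unfolding path_spanning_def
  proof (intro conjI allI impI)
    show "finite S'" using sp by (auto simp: S'_def path_spanning_def)
    show "S' \<subseteq> real_cycles 1 ?X'" using sp mono(2) e1 by (auto simp: S'_def path_spanning_def simp del: One_nat_def)
    show "\<exists>x0. \<forall>x\<in>topspace ?X'. p' x \<in> real_chains 1 ?X' \<and> real_boundary 1 (p' x) = point_chain x - point_chain x0"
    proof (intro exI ballI)
      fix x assume "x \<in> topspace ?X'"
      then have "x \<in> \<Gamma> \<or> x \<in> \<alpha> ` ?I" using top(1) by (simp only: Un_iff)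
      then consider "x \<in> \<Gamma>" | t where "x \<notin> \<Gamma>" "t \<in> ?I" "x = \<alpha> t" by (metis imageE)
      then show "p' x \<in> real_chains 1 ?X' \<and> real_boundary 1 (p' x) = point_chain x - point_chain x0"
      proof cases
        case 1
        then show ?thesis using x0[OF 1] mono(1) by (auto simp: p'_def simp del: One_nat_def)
      next
        case 2
        then show ?thesis using \<beta>(2) e_chain e_boundary by (simp add: p'_def del: One_nat_def)
      qed
    qed
  qed (use all in auto)
  moreover have "card S' \<le> (if \<alpha> 1 \<in> \<Gamma> then Suc (card S) else card S)"
    by (auto simp: S'_def card_insert_le_m1 intro: card_insert_le_m1 order_trans[OF card_insert_le])
  ultimately show ?thesis by blast
qed

lemma arc_complex_betti_le:
  assumes "Hausdorff_space X" "arc_complex X k \<Gamma>"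
  shows "betti 1 (subtopology X \<Gamma>) \<le> enat k"
proof -
  have "\<exists>p S. path_spanning (subtopology X \<Gamma>) p S \<and> card S \<le> k" using assms(2)
  proof induction
    case (point x)
    let ?p = "\<lambda>_::'a. 0 :: 'a real_chain"
    have "path_chain g \<in> real_boundaries 1 (subtopology X {x})" if "pathin (subtopology X {x}) g" for g
    proof -
      have "g t = x" if "t \<in> {0..1}" for t using \<open>pathin (subtopology X {x}) g\<close> that by (auto simp: pathin_subtopology)
      then have "path_chain g = path_chain (\<lambda>_. x)" by (intro path_chain_cong) auto
      then show ?thesis using constant_path_boundary[of x "subtopology X {x}"] point by simp
    qed
    then have "path_spanning (subtopology X {x}) ?p {}"
      unfolding path_spanning_def using subspace_0[OF subspace_real_chains]
      by (auto simp: linear_0[OF linear_real_boundary] intro!: exI[of _ x] span_base)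
    then show ?case by (metis card.empty le_refl)
  next
    case (attach k \<Gamma> \<alpha>)
    then obtain p S where pS: "path_spanning (subtopology X \<Gamma>) p S" "card S \<le> k" by blast
    have "closedin X \<Gamma>" using arc_complex_topology(3)[OF attach(1)] assms(1) compactin_imp_closedin by blast
    from path_spanning_attach[OF assms(1) this attach(2) pS(1)] pS(2)
    show ?case by (cases "\<alpha> 1 \<in> \<Gamma>") (fastforce dest: order_trans)+
  qed
  then show ?thesis using path_spanning_imp_betti_le by (meson enat_ord_simps(1) order_trans)
qed

section \<open>Winding numbers and arcs\<close>

lemma angle_incr_subpath:
  assumes u: "circle_map X u" and g: "pathin X g"
  obtains h where "\<And>a b. a \<in> {0..1} \<Longrightarrow> b \<in> {0..1} \<Longrightarrow> angle_incr (u \<circ> (g \<circ> seg a b)) = h b - h a"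
    "angle_incr (u \<circ> g) = h 1 - h 0" "continuous_on {0..1} h" "\<And>t. t \<in> {0..1} \<Longrightarrow> u (g t) = cis (h t)"
proof -
  obtain h where h: "continuous_on {0..1} h" "\<And>t. t \<in> {0..1} \<Longrightarrow> u (g t) = cis (h t)"
    "angle_incr (u \<circ> g) = h 1 - h 0" using circle_map_path_lift[OF u g] by metis
  have "angle_incr (u \<circ> (g \<circ> seg a b)) = h b - h a" if ab: "a \<in> {0..1}" "b \<in> {0..1}" for a b
  proof -
    have s: "seg a b t \<in> {0..1}" if "t \<in> {0..1}" for t using seg_in_convex[OF _ ab that] by simp
    have "continuous_on {0..1} (\<lambda>t. h (seg a b t))"
      by (rule continuous_on_compose2[OF h(1) continuous_on_seg]) (use s in blast)
    then have "angle_incr (u \<circ> (g \<circ> seg a b)) = h (seg a b 1) - h (seg a b 0)"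
      by (rule angle_incr_eq) (use s h(2) in auto)
    then show ?thesis by simp
  qed
  then show ?thesis using that[of h] h by blast
qed

lemma angle_incr_split:
  assumes u: "circle_map X u" and g: "pathin X g" and ab: "a \<in> {0..1}" "b \<in> {0..1}"
  shows "angle_incr (u \<circ> g) = angle_incr (u \<circ> (g \<circ> seg 0 a)) + angle_incr (u \<circ> (g \<circ> seg a b)) + angle_incr (u \<circ> (g \<circ> seg b 1))"
  by (rule angle_incr_subpath[OF u g]) (use ab in simp)

lemma angle_incr_trivial: "(\<And>t. t \<in> {0..1} \<Longrightarrow> p t = 1) \<Longrightarrow> angle_incr p = 0"
  using angle_incr_eq[of "\<lambda>_. 0" p] by auto

lemma angle_incr_cong:
  assumes "\<And>t. t \<in> {0..1} \<Longrightarrow> p t = q t" shows "angle_incr p = angle_incr q"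
proof -
  have "(\<forall>t\<in>{0..1}. p t = cis (h t)) \<longleftrightarrow> (\<forall>t\<in>{0..1}. q t = cis (h t))" for h using assms by auto
  then show ?thesis by (simp add: angle_incr_def)
qed

locale light_map =
  fixes Y :: "'b topology" and f :: "'b \<Rightarrow> real"
  assumes compact: "compact_space Y" and Hausdorff: "Hausdorff_space Y"
    and cont: "continuous_map Y euclideanreal f"
    and light: "\<And>C c. connectedin Y C \<Longrightarrow> C \<subseteq> {x \<in> topspace Y. f x = c} \<Longrightarrow> \<exists>a. C \<subseteq> {a}"
begin

text \<open>Ramp across the level halfway between the values of \<open>f\<close> at the ends of the path. At this level,
  the path does not meet \<open>Q\<close>, since the ends have other values.\<close>

lemma circle_map_winding_path:
  assumes g: "pathin Y g" and Q: "closedin Y Q" "g ` {0..1} \<inter> Q \<subseteq> {g 0, g 1}" and ne: "f (g 0) \<noteq> f (g 1)"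
  obtains u where "circle_map Y u" "\<And>x. x \<in> Q \<Longrightarrow> u x = 1" "angle_incr (u \<circ> g) \<noteq> 0"
proof -
  define c where "c = (f (g 0) + f (g 1)) / 2"
  \<comment> \<open>with a slab at most this thin, both ends of the path lie outside, on different sides\<close>
  define \<eta> where "\<eta> = \<bar>f (g 0) - f (g 1)\<bar> / 2"
  have \<eta>: "\<eta> > 0" using ne by (simp add: \<eta>_def)
  have clA: "closedin Y (g ` {0..1})" using compactin_imp_closedin[OF Hausdorff compactin_path_image[OF g]] .
  have c0: "f (g 0) \<noteq> c" "f (g 1) \<noteq> c" using ne by (auto simp: c_def)
  obtain u \<epsilon> where u: "0 < \<epsilon>" "\<epsilon> \<le> \<eta>" "circle_map Y u" "\<And>x. x \<in> Q \<Longrightarrow> u x = 1"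
    "\<And>x. x \<in> g ` {0..1} \<Longrightarrow> u x = cis (2 * pi * level_ramp c \<epsilon> (f x))"
  proof (rule circle_map_across_fibre[OF compact Hausdorff cont clA Q(1) \<eta>, of c])
    show "f x \<noteq> c" if "x \<in> g ` {0..1}" "x \<in> Q" for x
    proof -
      have "x \<in> {g 0, g 1}" using that Q(2) by blast
      then show ?thesis using c0 by auto
    qed
    show "\<exists>a. C \<subseteq> {a}" if "connectedin Y C" "C \<subseteq> {x \<in> topspace Y. f x = c}" for C using light[OF that] .
  qed blast
  have "continuous_map (top_of_set {0..1}) euclideanreal (f \<circ> g)"
    using g cont unfolding pathin_def by (rule continuous_map_compose)
  then have "continuous_on {0..1} (\<lambda>t. 2 * pi * level_ramp c \<epsilon> (f (g t)))"
    by (auto intro!: continuous_intros simp: o_def)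
  from angle_incr_eq[OF this, of "u \<circ> g"]
  have inc: "angle_incr (u \<circ> g) = 2 * pi * level_ramp c \<epsilon> (f (g 1)) - 2 * pi * level_ramp c \<epsilon> (f (g 0))"
    using u(5) by simp
  have "level_ramp c \<epsilon> (f (g 1)) \<noteq> level_ramp c \<epsilon> (f (g 0))"
  proof (cases "f (g 0) < f (g 1)")
    case True
    then have "f (g 0) \<le> c - \<epsilon>" "c + \<epsilon> \<le> f (g 1)" using u(2) by (auto simp: c_def \<eta>_def field_simps)
    then show ?thesis using level_ramp_low level_ramp_high u(1) by fastforce
  next
    case False
    then have "f (g 1) \<le> c - \<epsilon>" "c + \<epsilon> \<le> f (g 0)" using u(2) by (auto simp: c_def \<eta>_def field_simps)
    then show ?thesis using level_ramp_low level_ramp_high u(1) by fastforce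
  qed
  then have "angle_incr (u \<circ> g) \<noteq> 0" using inc by simp
  then show ?thesis using that u by blast
qed

text \<open>Otherwise the image of a nondegenerate interval would be a connected subset of a fibre with more
  than one point.\<close>

lemma nonconstant_on_arc:
  assumes g: "pathin Y g" "inj_on g {0..1}" and st: "0 \<le> s" "s < t" "t \<le> 1"
  shows "\<exists>v. s < v \<and> v \<le> t \<and> f (g v) \<noteq> f (g s)"
proof (rule ccontr)
  assume n: "\<not> (\<exists>v. s < v \<and> v \<le> t \<and> f (g v) \<noteq> f (g s))"
  have eq: "f (g v) = f (g s)" if v: "v \<in> {s..t}" for v
  proof (rule ccontr)
    assume ne: "f (g v) \<noteq> f (g s)"
    then have "v \<noteq> s" by auto
    then have "s < v" "v \<le> t" using v by auto
    then show False using n ne by blast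
  qed
  have sub: "{s..t} \<subseteq> {0..1}" using st by auto
  have "connectedin Y (g ` {s..t})"
  proof (rule connectedin_continuous_map_image)
    show "continuous_map (top_of_set {0..1}) Y g" using g by (simp add: pathin_def)
    show "connectedin (top_of_set {0..1}) {s..t}" using sub by (simp add: connectedin_subtopology)
  qed
  moreover have "g ` {s..t} \<subseteq> {x \<in> topspace Y. f x = f (g s)}"
  proof
    fix x assume "x \<in> g ` {s..t}"
    then obtain v where "v \<in> {s..t}" "x = g v" unfolding image_iff by blast
    then show "x \<in> {x \<in> topspace Y. f x = f (g s)}"
      using eq[of v] pathin_in_topspace[OF g(1), of v] st by auto
  qed
  ultimately obtain a where "g ` {s..t} \<subseteq> {a}" using light by meson
  moreover have "s \<in> {s..t}" "t \<in> {s..t}" using st by auto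
  ultimately have "g s = g t" by blast
  then show False using inj_onD[OF g(2), of s t] st by auto
qed

text \<open>The function \<open>f\<close> may take equal values at the ends of the arc, so the map is made to wind
  along an interior piece on which the values at the ends differ, and to be trivial on the rest of
  the arc as well as on \<open>\<Gamma>\<close>.\<close>

lemma attaching_arc_winding:
  assumes \<Gamma>: "closedin Y \<Gamma>" and arc: "attaching_arc Y \<Gamma> \<alpha>"
  obtains u where "circle_map Y u" "\<And>x. x \<in> \<Gamma> \<Longrightarrow> u x = 1" "angle_incr (u \<circ> \<alpha>) \<noteq> 0"
proof -
  have a: "pathin Y \<alpha>" "inj_on \<alpha> {0..1}" "\<alpha> ` {0<..<1} \<inter> \<Gamma> = {}" using arc by (auto simp: attaching_arc_def)
  obtain v where v: "1/3 < v" "v \<le> 2/3" "f (\<alpha> v) \<noteq> f (\<alpha> (1/3))" using nonconstant_on_arc[OF a(1,2), of "1/3" "2/3"] by auto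
  define s :: real where "s = 1/3"
  have s: "0 < s" "s < v" "v < 1" using v by (auto simp: s_def)
  have cont\<alpha>: "continuous_map (top_of_set {0..1}) Y \<alpha>" using a(1) by (simp add: pathin_def)
  have cl: "closedin Y (\<alpha> ` {x..y})" if "0 \<le> x" "y \<le> 1" for x y
  proof (rule compactin_imp_closedin[OF Hausdorff], rule image_compactin[OF _ cont\<alpha>])
    show "compactin (top_of_set {0..1}) {x..y}" using that by (simp add: compactin_subtopology)
  qed
  define Q where "Q = \<Gamma> \<union> \<alpha> ` {0..s} \<union> \<alpha> ` {v..1}"
  have Q: "closedin Y Q" unfolding Q_def using \<Gamma> cl s by (intro closedin_Un) auto
  let ?g = "\<alpha> \<circ> seg s v"
  have g: "pathin Y ?g" using s by (intro pathin_seg[OF cont\<alpha>]) auto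
  have sg: "seg s v t \<in> {s..v}" if "t \<in> {0..1}" for t using seg_in_convex[of "{s..v}" s v t] s that by auto
  have "?g ` {0..1} \<inter> Q \<subseteq> {?g 0, ?g 1}"
  proof
    fix y assume y: "y \<in> ?g ` {0..1} \<inter> Q"
    then obtain r where r: "r \<in> {0..1}" "y = \<alpha> (seg s v r)" by auto
    define t where "t = seg s v r"
    have t: "t \<in> {s..v}" "y = \<alpha> t" using sg[OF r(1)] r(2) by (auto simp: t_def)
    have "t \<in> {0<..<1}" using t s by auto
    then have "y \<notin> \<Gamma>" using a(3) t by blast
    then have "y \<in> \<alpha> ` ({0..s} \<union> {v..1})" using y unfolding Q_def image_Un by blast
    then obtain w where w: "w \<in> {0..s} \<union> {v..1}" "y = \<alpha> w" unfolding image_iff by blast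
    then have "w = t" using inj_onD[OF a(2), of w t] t s by auto
    then show "y \<in> {?g 0, ?g 1}" using w t by auto
  qed
  moreover have "f (?g 0) \<noteq> f (?g 1)" using v by (simp add: s_def)
  ultimately obtain u where u: "circle_map Y u" "\<And>x. x \<in> Q \<Longrightarrow> u x = 1" "angle_incr (u \<circ> ?g) \<noteq> 0"
    using circle_map_winding_path[OF g Q] by metis
  have "angle_incr (u \<circ> (\<alpha> \<circ> seg 0 s)) = 0"
  proof (rule angle_incr_trivial)
    fix t :: real assume "t \<in> {0..1}"
    then have "seg 0 s t \<in> {0..s}" using seg_in_convex[of "{0..s}" 0 s t] s by auto
    then show "(u \<circ> (\<alpha> \<circ> seg 0 s)) t = 1" using u(2) by (auto simp: Q_def)
  qed
  moreover have "angle_incr (u \<circ> (\<alpha> \<circ> seg v 1)) = 0"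
  proof (rule angle_incr_trivial)
    fix t :: real assume "t \<in> {0..1}"
    then have "seg v 1 t \<in> {v..1}" using seg_in_convex[of "{v..1}" v 1 t] s by auto
    then show "(u \<circ> (\<alpha> \<circ> seg v 1)) t = 1" using u(2) by (auto simp: Q_def)
  qed
  ultimately have "angle_incr (u \<circ> \<alpha>) \<noteq> 0" using angle_incr_split[OF u(1) a(1), of s v] u(3) s by simp
  then show ?thesis using that u by (auto simp: Q_def)
qed

text \<open>Independence is expressed through potentials: no nontrivial combination of the winding
  increments is the increment of a function. When an arc with both ends on \<open>\<Gamma>\<close> is attached, the new
  map winds along it but is trivial on \<open>\<Gamma>\<close>. So a relation restricts to one among the old maps
  on \<open>\<Gamma>\<close> and is trivial there; the potential is then constant on \<open>\<Gamma>\<close>, and comparing the ends of the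
  arc shows that the new coefficient vanishes too.\<close>

lemma arc_complex_independent_windings:
  assumes "arc_complex Y k \<Gamma>"
  shows "\<exists>u. (\<forall>i<k. circle_map Y (u i)) \<and>
    (\<forall>a h. (\<forall>g. pathin (subtopology Y \<Gamma>) g \<longrightarrow> h (g 1) - h (g 0) = (\<Sum>i<k. a i * angle_incr (u i \<circ> g)))
       \<longrightarrow> (\<forall>i<k. a i = (0::real)))"
  using assms
proof induction
  case (point x)
  then show ?case by auto
next
  case (attach k \<Gamma> \<alpha>)
  let ?\<Gamma>' = "\<Gamma> \<union> \<alpha> ` {0..1}"
  obtain u where u: "\<And>i. i < k \<Longrightarrow> circle_map Y (u i)"
    "\<And>a h. (\<And>g. pathin (subtopology Y \<Gamma>) g \<Longrightarrow> h (g 1) - h (g 0) = (\<Sum>i<k. a i * angle_incr (u i \<circ> g)))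
       \<Longrightarrow> (\<forall>i<k. a i = (0::real))" using attach.IH by blast
  note T = arc_complex_topology[OF attach(1)]
  have a: "pathin Y \<alpha>" "\<alpha> 0 \<in> \<Gamma>" using attach(2) by (auto simp: attaching_arc_def)
  have top: "topspace (subtopology Y \<Gamma>) = \<Gamma>" using T(1) by auto
  have up: "pathin (subtopology Y ?\<Gamma>') g" if "pathin (subtopology Y \<Gamma>) g" for g
    using that by (rule pathin_subtopology_mono) simp
  show ?case
  proof (cases "\<alpha> 1 \<in> \<Gamma>")
    case False
    have "\<forall>i<k. a i = 0"
      if "\<forall>g. pathin (subtopology Y ?\<Gamma>') g \<longrightarrow> h (g 1) - h (g 0) = (\<Sum>i<k. a i * angle_incr (u i \<circ> g))" for a h
      by (rule u(2)[of h]) (use that up in blast)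
    then have "(\<forall>i<k. circle_map Y (u i)) \<and> (\<forall>a h. (\<forall>g. pathin (subtopology Y ?\<Gamma>') g \<longrightarrow>
      h (g 1) - h (g 0) = (\<Sum>i<k. a i * angle_incr (u i \<circ> g))) \<longrightarrow> (\<forall>i<k. a i = 0))" using u(1) by blast
    then show ?thesis using False by (simp only: if_False) blast
  next
    case True
    have "closedin Y \<Gamma>" using T(3) Hausdorff compactin_imp_closedin by blast
    then obtain w where w: "circle_map Y w" "\<And>x. x \<in> \<Gamma> \<Longrightarrow> w x = 1" "angle_incr (w \<circ> \<alpha>) \<noteq> 0"
      using attaching_arc_winding attach(2) by metis
    let ?u = "u(k := w)"
    have "\<forall>i<Suc k. a i = 0"
      if ex: "\<And>g. pathin (subtopology Y ?\<Gamma>') g \<Longrightarrow> h (g 1) - h (g 0) = (\<Sum>i<Suc k. a i * angle_incr (?u i \<circ> g))"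
      for a h
    proof -
      have ex\<Gamma>: "h (g 1) - h (g 0) = (\<Sum>i<k. a i * angle_incr (u i \<circ> g))" if g: "pathin (subtopology Y \<Gamma>) g" for g
      proof -
        have "angle_incr (w \<circ> g) = 0"
          by (rule angle_incr_trivial) (use g w(2) in \<open>auto simp: pathin_subtopology\<close>)
        then show ?thesis using ex[OF up[OF g]] by simp
      qed
      then have z: "\<forall>i<k. a i = 0" by (rule u(2))
      have "h (\<alpha> 1) = h (\<alpha> 0)"
      proof -
        obtain g where g: "pathin (subtopology Y \<Gamma>) g" "g 0 = \<alpha> 0" "g 1 = \<alpha> 1"
          using T(4) top True a(2) unfolding path_connectedin_def path_connected_space_def by blast
        show ?thesis using ex\<Gamma>[OF g(1)] z g by simp
      qed
      moreover have "pathin (subtopology Y ?\<Gamma>') \<alpha>" using a(1) by (auto simp: pathin_subtopology)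
      ultimately have "a k * angle_incr (w \<circ> \<alpha>) = 0" using ex[of \<alpha>] z by simp
      then show ?thesis using z w(3) by (auto simp: less_Suc_eq)
    qed
    then have "(\<forall>i<Suc k. circle_map Y (?u i)) \<and>
      (\<forall>a h. (\<forall>g. pathin (subtopology Y ?\<Gamma>') g \<longrightarrow> h (g 1) - h (g 0) = (\<Sum>i<Suc k. a i * angle_incr (?u i \<circ> g)))
       \<longrightarrow> (\<forall>i<Suc k. a i = 0))" using u(1) w(1) by (auto simp: less_Suc_eq)
    then show ?thesis using True by (simp only: if_True) blast
  qed
qed

end

definition winding_functional :: "('b \<Rightarrow> complex) \<Rightarrow> 'b real_chain \<Rightarrow> real" where
  "winding_functional u = lin_ext (\<lambda>\<sigma>. angle_incr (u \<circ> \<sigma> \<circ> edge_point))"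

lemma linear_winding_functional: "linear (winding_functional u)"
  by (simp add: winding_functional_def linear_lin_ext)

lemma winding_functional_path_chain: "winding_functional u (path_chain g) = angle_incr (u \<circ> g)"
  unfolding winding_functional_def path_chain_def by (auto intro: angle_incr_cong)

text \<open>On a singular triangle the map has a global angle function, as the triangle is convex; the increments
  along the three sides cancel.\<close>

lemma winding_functional_boundary:
  assumes u: "circle_map X u" and c: "c \<in> real_boundaries 1 X"
  shows "winding_functional u c = 0"
proof -
  have simplex: "winding_functional u (real_boundary 2 (Poly_Mapping.single \<tau> 1)) = 0" if \<tau>: "singular_simplex 2 X \<tau>" for \<tau>
  proof -
    define T where "T = {z :: real \<times> real. 0 \<le> fst z \<and> 0 \<le> snd z \<and> fst z + snd z \<le> 1}"
    define E where "E z = (\<lambda>i::nat. if i = 0 then 1 - fst z - snd z else if i = 1 then fst z else if i = 2 then snd z else 0)"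
      for z :: "real \<times> real"
    have convT: "convex T"
    proof -
      have "T = {z. (1,0) \<bullet> z \<ge> 0} \<inter> {z. (0,1) \<bullet> z \<ge> 0} \<inter> {z. (1,1) \<bullet> z \<le> 1}"
        by (auto simp: T_def inner_prod_def)
      then show ?thesis by (simp add: convex_Int convex_halfspace_ge convex_halfspace_le)
    qed
    have E_in: "E z \<in> standard_simplex 2" if "z \<in> T" for z
      using that by (auto simp: T_def E_def standard_simplex_def numeral_2_eq_2)
    have "continuous_on T E"
    proof (rule continuous_on_coordinatewise_then_product)
      fix i show "continuous_on T (\<lambda>z. E z i)"
        unfolding E_def by (cases "i = 0"; cases "i = 1"; cases "i = 2") (auto intro!: continuous_intros)
    qed
    then have "continuous_map (top_of_set T) (top_of_set (standard_simplex 2)) E" using E_in by auto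
    moreover have "continuous_map (top_of_set (standard_simplex 2)) X \<tau>"
      using \<tau> by (simp add: singular_simplex_def euclidean_product_topology)
    ultimately have "continuous_map (top_of_set T) X (\<tau> \<circ> E)" by (rule continuous_map_compose)
    then have im: "continuous_map (top_of_set T) euclidean (u \<circ> (\<tau> \<circ> E))" "(\<tau> \<circ> E) ` T \<subseteq> topspace X"
      using u unfolding circle_map_def by (meson continuous_map_compose, auto simp: continuous_map_def)
    then have "continuous_on T (u \<circ> (\<tau> \<circ> E))" by simp
    moreover have "norm ((u \<circ> (\<tau> \<circ> E)) z) = 1" if "z \<in> T" for z
      using u im(2) that unfolding circle_map_def by auto
    ultimately obtain h where h: "continuous_on T h" "\<And>z. z \<in> T \<Longrightarrow> (u \<circ> (\<tau> \<circ> E)) z = cis (h z)"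
      using circle_lift_convex[OF convT] by metis
    have face: "angle_incr (u \<circ> singular_face 2 k \<tau> \<circ> edge_point) = h (e 1) - h (e 0)"
      if "k \<le> 2" "continuous_on {0..1} e" "\<And>t. t \<in> {0..1} \<Longrightarrow> e t \<in> T"
        "\<And>t. t \<in> {0..1} \<Longrightarrow> simplical_face k (edge_point t) = E (e t)" for k and e :: "real \<Rightarrow> real \<times> real"
    proof (rule angle_incr_eq)
      show "continuous_on {0..1} (\<lambda>t. h (e t))"
        by (rule continuous_on_compose2[OF h(1) that(2)]) (use that(3) in auto)
      fix t :: real assume t: "t \<in> {0..1}"
      then show "(u \<circ> singular_face 2 k \<tau> \<circ> edge_point) t = cis (h (e t))"
        using h(2)[OF that(3)[OF t]] that(4)[OF t] edge_point_in[OF t] by (simp add: singular_face_def)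
    qed
    have f0: "angle_incr (u \<circ> singular_face 2 0 \<tau> \<circ> edge_point) = h (0,1) - h (1,0)"
      by (subst face[of 0 "\<lambda>t. (1 - t, t)"])
        (auto intro!: continuous_intros simp: T_def E_def simplical_face_def edge_point_def fun_eq_iff)
    have f1: "angle_incr (u \<circ> singular_face 2 1 \<tau> \<circ> edge_point) = h (0,1) - h (0,0)"
      by (subst face[of 1 "\<lambda>t. (0, t)"])
        (auto intro!: continuous_intros simp: T_def E_def simplical_face_def edge_point_def fun_eq_iff)
    have f2: "angle_incr (u \<circ> singular_face 2 2 \<tau> \<circ> edge_point) = h (1,0) - h (0,0)"
      by (subst face[of 2 "\<lambda>t. (t, 0)"])
        (auto intro!: continuous_intros simp: T_def E_def simplical_face_def edge_point_def fun_eq_iff)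
    have "winding_functional u (real_boundary 2 (Poly_Mapping.single \<tau> 1)) =
      angle_incr (u \<circ> singular_face 2 0 \<tau> \<circ> edge_point) - angle_incr (u \<circ> singular_face 2 1 \<tau> \<circ> edge_point)
      + angle_incr (u \<circ> singular_face 2 2 \<tau> \<circ> edge_point)"
      using linear_winding_functional[of u]
      by (simp add: real_boundary_lin_ext numeral_2_eq_2 linear_add linear_diff linear_neg)
        (simp add: winding_functional_def)
    then show ?thesis using f0 f1 f2 by simp
  qed
  obtain b where b: "b \<in> real_chains 2 X" "c = real_boundary 2 b" using c by (auto simp: real_boundaries_def numeral_2_eq_2)
  have "c = (\<Sum>\<tau>\<in>Poly_Mapping.keys b. Poly_Mapping.lookup b \<tau> *\<^sub>R real_boundary 2 (Poly_Mapping.single \<tau> 1))"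
    unfolding b(2) by (subst chain_sum_singles)
      (simp add: linear_sum[OF linear_real_boundary] linear_scale[OF linear_real_boundary])
  then have "winding_functional u c = (\<Sum>\<tau>\<in>Poly_Mapping.keys b. Poly_Mapping.lookup b \<tau> *\<^sub>R winding_functional u (real_boundary 2 (Poly_Mapping.single \<tau> 1)))"
    by (simp add: linear_sum[OF linear_winding_functional] linear_scale[OF linear_winding_functional])
  also have "\<dots> = 0" using b(1) simplex by (intro sum.neutral) (auto simp: real_chains_def)
  finally show ?thesis .
qed

text \<open>Integrate along a chosen path from a base point. Two choices differ by a cycle.\<close>

lemma winding_potential:
  fixes a :: "nat \<Rightarrow> real"
  assumes X: "path_connected_space X"
    and zero: "\<And>z. z \<in> real_cycles 1 X \<Longrightarrow> (\<Sum>i<k. a i * winding_functional (u i) z) = 0"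
  obtains h where "\<And>g. pathin X g \<Longrightarrow> h (g 1) - h (g 0) = (\<Sum>i<k. a i * angle_incr (u i \<circ> g))"
proof (cases "topspace X = {}")
  case True
  have "\<not> pathin X g" for g using pathin_in_topspace[of X g 0] True by auto
  then show ?thesis using that by blast
next
  case False
  then obtain x0 where x0: "x0 \<in> topspace X" by blast
  have "\<exists>P. \<forall>x\<in>topspace X. pathin X (P x) \<and> P x 0 = x0 \<and> P x 1 = x"
    using X x0 unfolding path_connected_space_def by (intro bchoice) auto
  then obtain P where P: "\<And>x. x \<in> topspace X \<Longrightarrow> pathin X (P x) \<and> P x 0 = x0 \<and> P x 1 = x" by blast
  define h where "h x = (\<Sum>i<k. a i * angle_incr (u i \<circ> P x))" for x
  have "h (g 1) - h (g 0) = (\<Sum>i<k. a i * angle_incr (u i \<circ> g))" if g: "pathin X g" for g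
  proof -
    have e: "g 0 \<in> topspace X" "g 1 \<in> topspace X" using path_image_subset_topspace[OF g] by auto
    define z where "z = path_chain (P (g 0)) + path_chain g - path_chain (P (g 1))"
    have "z \<in> real_chains 1 X" unfolding z_def using P e g
      by (intro subspace_add subspace_diff subspace_real_chains path_chain_in_chains) auto
    moreover have "real_boundary 1 z = 0" unfolding z_def using P e
      by (simp add: linear_add[OF linear_real_boundary] linear_diff[OF linear_real_boundary] real_boundary_path_chain del: One_nat_def)
    ultimately have "z \<in> real_cycles 1 X" by (simp add: real_cycles_def)
    from zero[OF this] have "(\<Sum>i<k. a i * (angle_incr (u i \<circ> P (g 0)) + angle_incr (u i \<circ> g) - angle_incr (u i \<circ> P (g 1)))) = 0"
      by (simp add: z_def linear_add[OF linear_winding_functional] linear_diff[OF linear_winding_functional] winding_functional_path_chain)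
    then show ?thesis by (simp add: h_def algebra_simps sum.distrib sum_subtractf)
  qed
  then show ?thesis by (rule that)
qed

lemma linear_dependence_family:
  fixes v :: "nat \<Rightarrow> 'v::real_vector"
  assumes "finite S" "card S < k" "\<And>i. i < k \<Longrightarrow> v i \<in> span S"
  obtains a where "(\<Sum>i<k. a i *\<^sub>R v i) = 0" "\<exists>i<k. a i \<noteq> 0"
proof (cases "inj_on v {..<k}")
  case False
  then obtain i j where ij: "i < k" "j < k" "i \<noteq> j" "v i = v j" by (auto simp: inj_on_def)
  define a where "a l = (if l = i then 1 else if l = j then -1 else (0::real))" for l
  have "(\<Sum>l<k. a l *\<^sub>R v l) = (\<Sum>l\<in>{i,j}. a l *\<^sub>R v l)"
    by (rule sum.mono_neutral_right) (use ij in \<open>auto simp: a_def\<close>)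
  then have "(\<Sum>l<k. a l *\<^sub>R v l) = 0" using ij by (simp add: a_def)
  moreover have "a i \<noteq> 0" by (simp add: a_def)
  ultimately show ?thesis using that ij(1) by blast
next
  case True
  have "dependent (v ` {..<k})"
  proof (rule ccontr)
    assume "independent (v ` {..<k})"
    then have "card (v ` {..<k}) \<le> card S" using independent_span_bound[OF assms(1)] assms(3) by auto
    then show False using card_image[OF True] assms(2) by simp
  qed
  then obtain b where b: "\<exists>x\<in>v ` {..<k}. b x \<noteq> 0" "(\<Sum>x\<in>v ` {..<k}. b x *\<^sub>R x) = 0"
    using dependent_finite[of "v ` {..<k}"] by auto
  then show ?thesis using that[of "b \<circ> v"] by (auto simp: sum.reindex[OF True])
qed

text \<open>The functionals descend to homology. If there were more of them than elements in a basis, a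
  nontrivial combination would vanish on the basis and hence on all cycles. The case of an infinite
  Betti number needs no argument, there being no finite basis at all.\<close>

lemma betti_ge_independent_windings:
  assumes u: "\<And>i. i < k \<Longrightarrow> circle_map X (u i)"
    and indep: "\<And>a. (\<And>z. z \<in> real_cycles 1 X \<Longrightarrow> (\<Sum>i<k. a i * winding_functional (u i) z) = 0) \<Longrightarrow> \<forall>i<k. a i = (0::real)"
  shows "enat k \<le> betti 1 X"
  unfolding betti_def
proof (rule INF_greatest)
  fix S assume "S \<in> {S. real_homology_basis 1 X S}"
  then have S: "finite S" "\<And>z. z \<in> real_cycles 1 X \<Longrightarrow> \<exists>a. z - (\<Sum>s\<in>S. a s *\<^sub>R s) \<in> real_boundaries 1 X"
    "\<And>a. (\<Sum>s\<in>S. a s *\<^sub>R s) \<in> real_boundaries 1 X \<Longrightarrow> \<forall>s\<in>S. a s = 0" by (auto simp: real_homology_basis_def)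
  show "enat k \<le> enat (card S)"
  proof (rule ccontr)
    assume "\<not> enat k \<le> enat (card S)"
    then have k: "card S < k" by simp
    let ?\<Phi> = "\<lambda>i. winding_functional (u i)"
    obtain a where a: "(\<Sum>i<k. a i *\<^sub>R (\<Sum>s\<in>S. ?\<Phi> i s *\<^sub>R s)) = 0" "\<exists>i<k. a i \<noteq> 0"
    proof (rule linear_dependence_family[OF S(1) k, of "\<lambda>i. \<Sum>s\<in>S. ?\<Phi> i s *\<^sub>R s"])
      show "(\<Sum>s\<in>S. ?\<Phi> i s *\<^sub>R s) \<in> span S" for i by (intro span_sum span_scale span_base)
    qed
    have "(\<Sum>s\<in>S. (\<Sum>i<k. a i * ?\<Phi> i s) *\<^sub>R s) = (\<Sum>i<k. a i *\<^sub>R (\<Sum>s\<in>S. ?\<Phi> i s *\<^sub>R s))"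
      by (simp add: scaleR_sum_left scaleR_sum_right sum.swap[of _ S])
    then have "(\<Sum>s\<in>S. (\<Sum>i<k. a i * ?\<Phi> i s) *\<^sub>R s) \<in> real_boundaries 1 X"
      using a(1) subspace_0[OF subspace_real_boundaries[of 1 X]] by (simp del: One_nat_def)
    from S(3)[OF this] have s0: "(\<Sum>i<k. a i * ?\<Phi> i s) = 0" if "s \<in> S" for s using that by blast
    have "(\<Sum>i<k. a i * ?\<Phi> i z) = 0" if z: "z \<in> real_cycles 1 X" for z
    proof -
      obtain b where b: "z - (\<Sum>s\<in>S. b s *\<^sub>R s) \<in> real_boundaries 1 X" using S(2) z by blast
      have "?\<Phi> i z = (\<Sum>s\<in>S. b s * ?\<Phi> i s)" if "i < k" for i
        using winding_functional_boundary[OF u[OF that] b]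
        by (simp add: linear_diff[OF linear_winding_functional] linear_sum[OF linear_winding_functional] linear_scale[OF linear_winding_functional])
      then have "(\<Sum>i<k. a i * ?\<Phi> i z) = (\<Sum>i<k. a i * (\<Sum>s\<in>S. b s * ?\<Phi> i s))" by simp
      also have "\<dots> = (\<Sum>s\<in>S. b s * (\<Sum>i<k. a i * ?\<Phi> i s))"
        by (simp add: sum_distrib_left sum.swap[of _ S] mult.left_commute)
      finally show ?thesis using s0 by simp
    qed
    then show False using indep a(2) by blast
  qed
qed

section \<open>Path length and isometric paths\<close>

lemma compact_attains_min:
  assumes "compactin X S" "S \<noteq> {}" "continuous_map X euclideanreal g"
  shows "\<exists>x\<in>S. \<forall>y\<in>S. g x \<le> g y"
proof -
  have "compact (g ` S)" using image_compactin[OF assms(1,3)] by simp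
  then obtain m where "m \<in> g ` S" "\<And>z. z \<in> g ` S \<Longrightarrow> m \<le> z"
    using compact_attains_inf[of "g ` S"] assms(2) by blast
  then show ?thesis by blast
qed

lemma path_length_ge_dist:
  assumes "a \<in> {0..1}" "b \<in> {0..1}" "a \<le> b" shows "ennreal (d (\<gamma> a) (\<gamma> b)) \<le> path_length d \<gamma>"
proof -
  define t where "t i = (if i = 0 then a else b)" for i :: nat
  have "(1, t) \<in> {(n, t). mono t \<and> range t \<subseteq> {0..1}}" using assms by (auto simp: t_def mono_def)
  then have "(case (1, t) of (n, t) \<Rightarrow> \<Sum>i<n. ennreal (d (\<gamma> (t i)) (\<gamma> (t (Suc i))))) \<le> path_length d \<gamma>"
    unfolding path_length_def by (rule SUP_upper)
  then show ?thesis by (simp add: t_def)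
qed

lemma path_length_leI:
  assumes "\<And>n t. mono t \<Longrightarrow> range t \<subseteq> {0..1} \<Longrightarrow> (\<Sum>i<n. ennreal (d (\<gamma> (t i)) (\<gamma> (t (Suc i))))) \<le> L"
  shows "path_length d \<gamma> \<le> L"
  unfolding path_length_def by (rule SUP_least) (use assms in auto)

lemma path_length_geI:
  assumes "mono t" "range t \<subseteq> {0..1}"
  shows "(\<Sum>i<n. ennreal (d (\<gamma> (t i)) (\<gamma> (t (Suc i))))) \<le> path_length d \<gamma>"
  unfolding path_length_def
  by (rule order_trans[OF _ SUP_upper[of "(n, t)"]]) (use assms in auto)

lemma path_length_mono:
  assumes "\<And>s t. s \<in> {0..1} \<Longrightarrow> t \<in> {0..1} \<Longrightarrow> d (\<gamma> s) (\<gamma> t) \<le> d' (\<delta> s) (\<delta> t)"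
  shows "path_length d \<gamma> \<le> path_length d' \<delta>"
proof (rule path_length_leI)
  fix n and t :: "nat \<Rightarrow> real" assume t: "mono t" "range t \<subseteq> {0..1}"
  have t01: "t i \<in> {0..1}" for i using t(2) by blast
  have "(\<Sum>i<n. ennreal (d (\<gamma> (t i)) (\<gamma> (t (Suc i))))) \<le> (\<Sum>i<n. ennreal (d' (\<delta> (t i)) (\<delta> (t (Suc i)))))"
    by (intro sum_mono ennreal_leI assms t01)
  also have "\<dots> \<le> path_length d' \<delta>" using t by (rule path_length_geI)
  finally show "(\<Sum>i<n. ennreal (d (\<gamma> (t i)) (\<gamma> (t (Suc i))))) \<le> path_length d' \<delta>" .
qed

lemma path_length_Lipschitz:
  assumes "\<And>s t. 0 \<le> s \<Longrightarrow> s \<le> t \<Longrightarrow> t \<le> 1 \<Longrightarrow> d (\<gamma> s) (\<gamma> t) \<le> L * (t - s)" "0 \<le> L"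
  shows "path_length d \<gamma> \<le> ennreal L"
proof (rule path_length_leI)
  fix n and t :: "nat \<Rightarrow> real" assume t: "mono t" "range t \<subseteq> {0..1}"
  have t01: "0 \<le> t i" "t i \<le> 1" for i using t(2) by (auto simp: image_subset_iff)
  have step: "t i \<le> t (Suc i)" for i using t(1) by (simp add: monoD)
  have "(\<Sum>i<n. ennreal (d (\<gamma> (t i)) (\<gamma> (t (Suc i))))) \<le> (\<Sum>i<n. ennreal (L * (t (Suc i) - t i)))"
    by (intro sum_mono ennreal_leI assms(1) t01 step)
  also have "\<dots> = ennreal (\<Sum>i<n. L * (t (Suc i) - t i))"
    using step assms(2) by (intro sum_ennreal) auto
  also have "(\<Sum>i<n. L * (t (Suc i) - t i)) = L * (t n - t 0)"
    by (simp only: sum_distrib_left[symmetric] sum_lessThan_telescope)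
  also have "L * (t n - t 0) \<le> L * 1" using t01[of n] t01[of 0] assms(2) by (intro mult_left_mono) auto
  finally show "(\<Sum>i<n. ennreal (d (\<gamma> (t i)) (\<gamma> (t (Suc i))))) \<le> ennreal L" by (simp add: ennreal_leI order_trans)
qed

lemma sum_lessThan_split:
  fixes f :: "nat \<Rightarrow> 'b::comm_monoid_add"
  shows "(\<Sum>i<n + m. f i) = (\<Sum>i<n. f i) + (\<Sum>i<m. f (n + i))"
  by (induction m) (auto simp: add.assoc)

lemma ennreal_SUP_add_SUP_le:
  fixes F :: "'b \<Rightarrow> ennreal"
  assumes ne: "I \<noteq> {}" "J \<noteq> {}" and le: "\<And>i j. i \<in> I \<Longrightarrow> j \<in> J \<Longrightarrow> F i + G j \<le> L"
  shows "(SUP i\<in>I. F i) + (SUP j\<in>J. G j) \<le> L"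
proof -
  have "(SUP i\<in>I. F i) + (SUP j\<in>J. G j) = (SUP i\<in>I. F i + (SUP j\<in>J. G j))"
    by (rule ennreal_SUP_add_left[OF ne(1), symmetric])
  also have "\<dots> = (SUP i\<in>I. SUP j\<in>J. F i + G j)" by (simp add: ennreal_SUP_add_right[OF ne(2)])
  also have "\<dots> \<le> L" by (intro SUP_least le)
  finally show ?thesis .
qed

text \<open>Subdivisions of the two halves combine to one of the whole path. The step between the two
  subdivisions is an extra nonnegative term.\<close>

lemma path_length_superadditive:
  assumes s: "s \<in> {0..1}"
  shows "path_length d (\<gamma> \<circ> seg 0 s) + path_length d (\<gamma> \<circ> seg s 1) \<le> path_length d \<gamma>"
proof -
  let ?P = "{(n::nat, t::nat \<Rightarrow> real). mono t \<and> range t \<subseteq> {0..1}}"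
  let ?S = "\<lambda>\<gamma> (n, t). \<Sum>i<n. ennreal (d (\<gamma> (t i)) (\<gamma> (t (Suc i))))"
  have key: "?S (\<gamma> \<circ> seg 0 s) P + ?S (\<gamma> \<circ> seg s 1) Q \<le> path_length d \<gamma>" if PQ: "P \<in> ?P" "Q \<in> ?P" for P Q
  proof -
    obtain n t m r where P: "P = (n, t)" and Q: "Q = (m, r)" by (cases P; cases Q) auto
    have t: "mono t" "\<And>i. t i \<in> {0..1}" using PQ(1) P by (auto simp: image_subset_iff)
    have r: "mono r" "\<And>i. r i \<in> {0..1}" using PQ(2) Q by (auto simp: image_subset_iff)
    define w where "w i = (if i \<le> n then seg 0 s (t i) else seg s 1 (r (i - Suc n)))" for i
    have a: "seg 0 s (t i) \<in> {0..s}" for i using seg_in_convex[of "{0..s}" 0 s "t i"] s t(2)[of i] by simp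
    have b: "seg s 1 (r i) \<in> {s..1}" for i using seg_in_convex[of "{s..1}" s 1 "r i"] s r(2)[of i] by simp
    have mo: "seg x y u \<le> seg x y v" if "u \<le> v" "x \<le> y" for x y u v :: real
    proof -
      have e: "seg x y z = x + z * (y - x)" for z by (simp add: seg_def algebra_simps)
      show ?thesis unfolding e using that by (simp add: mult_right_mono)
    qed
    have "mono w"
      unfolding mono_def
    proof (intro allI impI)
      fix i j :: nat assume ij: "i \<le> j"
      consider "j \<le> n" | "i \<le> n" "n < j" | "n < i" by linarith
      then show "w i \<le> w j"
      proof cases
        case 1
        then show ?thesis using ij mo[of "t i" "t j" 0 s] monoD[OF t(1) ij] s by (simp add: w_def)
      next
        case 2
        then show ?thesis using a[of i] b[of "j - Suc n"] by (simp add: w_def)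
      next
        case 3
        then have "i - Suc n \<le> j - Suc n" "\<not> j \<le> n" using ij by auto
        then show ?thesis using 3 mo[of "r (i - Suc n)" "r (j - Suc n)" s 1] monoD[OF r(1)] s by (simp add: w_def)
      qed
    qed
    moreover have "w i \<in> {0..1}" for i using a[of i] b[of "i - Suc n"] s by (auto simp: w_def)
    ultimately have W: "(\<Sum>i<Suc n + m. ennreal (d (\<gamma> (w i)) (\<gamma> (w (Suc i))))) \<le> path_length d \<gamma>"
      by (intro path_length_geI) auto
    have e1: "?S (\<gamma> \<circ> seg 0 s) P = (\<Sum>i<n. ennreal (d (\<gamma> (w i)) (\<gamma> (w (Suc i)))))"
      by (simp add: P w_def)
    have e2: "?S (\<gamma> \<circ> seg s 1) Q = (\<Sum>i<m. ennreal (d (\<gamma> (w (Suc n + i))) (\<gamma> (w (Suc (Suc n + i))))))"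
      by (simp add: Q w_def)
    have e3: "(\<Sum>i<Suc n + m. ennreal (d (\<gamma> (w i)) (\<gamma> (w (Suc i)))))
        = (\<Sum>i<Suc n. ennreal (d (\<gamma> (w i)) (\<gamma> (w (Suc i))))) + (\<Sum>i<m. ennreal (d (\<gamma> (w (Suc n + i))) (\<gamma> (w (Suc (Suc n + i))))))"
      by (rule sum_lessThan_split)
    have le: "A + B \<le> A + T + B" for A B T :: ennreal by (intro add_right_mono add_increasing2) simp_all
    show ?thesis unfolding e1 e2 by (rule order_trans[OF le W[unfolded e3 sum.lessThan_Suc]])
  qed
  have ne: "?P \<noteq> {}" by (auto intro!: exI[of _ "\<lambda>_. 0::real"] simp: mono_def)
  show ?thesis unfolding path_length_def[of d "\<gamma> \<circ> seg 0 s"] path_length_def[of d "\<gamma> \<circ> seg s 1"]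
    by (rule ennreal_SUP_add_SUP_le[OF ne ne key])
qed

definition join_paths :: "(real \<Rightarrow> 'b) \<Rightarrow> (real \<Rightarrow> 'b) \<Rightarrow> real \<Rightarrow> 'b" where
  "join_paths g h t = (if t \<le> 1/2 then g (2 * t) else h (2 * t - 1))"

lemma join_paths_ends [simp]: "join_paths g h 0 = g 0" "join_paths g h 1 = h 1"
  by (auto simp: join_paths_def)

lemma pathin_join_paths:
  assumes "pathin X g" "pathin X h" "g 1 = h 0" shows "pathin X (join_paths g h)"
  unfolding pathin_def join_paths_def
proof (rule continuous_map_cases_le)
  let ?I = "top_of_set {0..1::real}"
  have "continuous_map (top_of_set {0..1/2::real}) (top_of_set {0..1}) (\<lambda>t. 2 * t)" by (auto intro!: continuous_intros)
  from continuous_map_compose[OF this, of X g] assms(1)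
  have 1: "continuous_map (top_of_set {0..1/2}) X (\<lambda>t. g (2 * t))" by (simp add: o_def pathin_def)
  have "continuous_map (top_of_set {1/2..1::real}) (top_of_set {0..1}) (\<lambda>t. 2 * t - 1)" by (auto intro!: continuous_intros)
  from continuous_map_compose[OF this, of X h] assms(2)
  have 2: "continuous_map (top_of_set {1/2..1}) X (\<lambda>t. h (2 * t - 1))" by (simp add: o_def pathin_def)
  have "{0..1} \<inter> {t \<in> topspace ?I. t \<le> 1/2} = {0..1/2}" "{0..1} \<inter> {t \<in> topspace ?I. 1/2 \<le> t} = {1/2..1}" by auto
  then show "continuous_map (subtopology ?I {t \<in> topspace ?I. t \<le> 1/2}) X (\<lambda>t. g (2 * t))"
    "continuous_map (subtopology ?I {t \<in> topspace ?I. 1/2 \<le> t}) X (\<lambda>t. h (2 * t - 1))"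
    using 1 2 by (simp_all only: subtopology_subtopology)
  show "continuous_map ?I euclideanreal (\<lambda>t. t)" "continuous_map ?I euclideanreal (\<lambda>t. 1/2)"
    by (auto intro!: continuous_intros)
  fix t :: real assume "t = 1/2"
  then have "2 * t = 1" "2 * t - 1 = 0" by auto
  then show "g (2 * t) = h (2 * t - 1)" using assms(3) by (simp only:)
qed

lemma path_length_join_paths:
  fixes k :: "'b \<Rightarrow> 'c::metric_space"
  assumes "g 1 = h 0"
  shows "path_length dist (k \<circ> join_paths g h) \<le> path_length dist (k \<circ> g) + path_length dist (k \<circ> h)"
proof (rule path_length_leI)
  fix n and t :: "nat \<Rightarrow> real" assume t: "mono t" "range t \<subseteq> {0..1}"
  let ?J = "k \<circ> join_paths g h"
  define u where "u i = 2 * min (t i) (1/2)" for i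
  define v where "v i = 2 * max (t i) (1/2) - 1" for i
  have t01: "0 \<le> t i" "t i \<le> 1" for i using t(2) by (auto simp: image_subset_iff)
  have mon: "t i \<le> t j" if "i \<le> j" for i j using t(1) that by (simp add: monoD)
  have u: "mono u" "range u \<subseteq> {0..1}" using t01 mon by (auto simp: u_def mono_def min_def) (smt (verit))+
  have v: "mono v" "range v \<subseteq> {0..1}" using t01 mon by (auto simp: v_def mono_def max_def) (smt (verit))+
  have step: "dist (?J (t i)) (?J (t (Suc i))) \<le> dist (k (g (u i))) (k (g (u (Suc i)))) + dist (k (h (v i))) (k (h (v (Suc i))))" for i
  proof -
    consider "t (Suc i) \<le> 1/2" | "t i \<le> 1/2" "1/2 < t (Suc i)" | "1/2 < t i" by linarith
    then show ?thesis
    proof cases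
      case 1
      then have "t i \<le> 1/2" using mon[of i "Suc i"] by simp
      then show ?thesis using 1 by (simp add: join_paths_def u_def v_def)
    next
      case 2
      then have "u (Suc i) = 1" "v i = 0" by (auto simp: u_def v_def)
      then show ?thesis using 2 assms dist_triangle[of "k (g (u i))" "k (h (v (Suc i)))" "k (g 1)"]
        by (simp add: join_paths_def u_def v_def)
    next
      case 3
      then have "1/2 < t (Suc i)" using mon[of i "Suc i"] by simp
      then show ?thesis using 3 by (simp add: join_paths_def u_def v_def)
    qed
  qed
  have "(\<Sum>i<n. ennreal (dist (?J (t i)) (?J (t (Suc i))))) \<le>
    (\<Sum>i<n. ennreal (dist (k (g (u i))) (k (g (u (Suc i))))) + ennreal (dist (k (h (v i))) (k (h (v (Suc i))))))"
    by (rule sum_mono) (use step in \<open>simp flip: ennreal_plus add: ennreal_leI\<close>)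
  also have "\<dots> \<le> path_length dist (k \<circ> g) + path_length dist (k \<circ> h)"
    unfolding sum.distrib
    using path_length_geI[OF u, of dist "k \<circ> g" n] path_length_geI[OF v, of dist "k \<circ> h" n] by (intro add_mono) auto
  finally show "(\<Sum>i<n. ennreal (dist (?J (t i)) (?J (t (Suc i))))) \<le> path_length dist (k \<circ> g) + path_length dist (k \<circ> h)" .
qed

lemma path_length_reverse_le:
  assumes "\<And>x y. d x y = d y x"
  shows "path_length d (\<gamma> \<circ> (\<lambda>t. 1 - t)) \<le> path_length d \<gamma>"
proof (rule path_length_leI)
  fix n and t :: "nat \<Rightarrow> real" assume t: "mono t" "range t \<subseteq> {0..1}"
  define r where "r i = 1 - t (n - i)" for i
  have "mono r" using t(1) by (auto simp: r_def mono_def)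
  moreover have "range r \<subseteq> {0..1}" using t(2) by (auto simp: r_def image_subset_iff)
  ultimately have "(\<Sum>i<n. ennreal (d (\<gamma> (r i)) (\<gamma> (r (Suc i))))) \<le> path_length d \<gamma>" by (rule path_length_geI)
  moreover have "(\<Sum>i<n. ennreal (d (\<gamma> (r i)) (\<gamma> (r (Suc i))))) = (\<Sum>i<n. ennreal (d (\<gamma> (1 - t i)) (\<gamma> (1 - t (Suc i)))))"
  proof (rule sum.reindex_bij_witness[of _ "\<lambda>i. n - Suc i" "\<lambda>i. n - Suc i"])
    fix i assume "i \<in> {..<n}"
    then have "n - i = Suc (n - Suc i)" by auto
    then show "ennreal (d (\<gamma> (1 - t (n - Suc i))) (\<gamma> (1 - t (Suc (n - Suc i))))) = ennreal (d (\<gamma> (r i)) (\<gamma> (r (Suc i))))"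
      using assms by (simp add: r_def)
  qed auto
  ultimately show "(\<Sum>i<n. ennreal (d ((\<gamma> \<circ> (\<lambda>t. 1 - t)) (t i)) ((\<gamma> \<circ> (\<lambda>t. 1 - t)) (t (Suc i))))) \<le> path_length d \<gamma>" by simp
qed

text \<open>A geodesic parametrised proportionally to arc length, constant if its ends coincide.\<close>

definition isometric_path :: "'a set \<Rightarrow> ('a \<Rightarrow> 'a \<Rightarrow> real) \<Rightarrow> (real \<Rightarrow> 'a) \<Rightarrow> bool" where
  "isometric_path M d \<sigma> \<longleftrightarrow> (\<forall>s\<in>{0..1}. \<sigma> s \<in> M) \<and>
    (\<forall>s\<in>{0..1}. \<forall>t\<in>{0..1}. d (\<sigma> s) (\<sigma> t) = d (\<sigma> 0) (\<sigma> 1) * \<bar>s - t\<bar>)"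

context Metric_space
begin

lemma continuous_map_Lipschitz_real:
  assumes "\<And>x y. x \<in> M \<Longrightarrow> y \<in> M \<Longrightarrow> \<bar>g x - g y\<bar> \<le> d x y"
  shows "continuous_map mtopology euclideanreal g"
proof -
  have "continuous_map mtopology Met_TC.mtopology g"
    using metric_continuous_map[OF Met_TC.Metric_space_axioms, of g] assms
    by (force simp: dist_real_def)
  then show ?thesis by simp
qed

lemma continuous_map_dist_point: "x \<in> M \<Longrightarrow> continuous_map mtopology euclideanreal (d x)"
  by (rule continuous_map_Lipschitz_real) (smt (verit) triangle commute)

lemma pathin_Lipschitz:
  assumes "\<And>t. t \<in> {0..1} \<Longrightarrow> g t \<in> M" "\<And>s t. s \<in> {0..1} \<Longrightarrow> t \<in> {0..1} \<Longrightarrow> d (g s) (g t) \<le> L * \<bar>s - t\<bar>"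
  shows "pathin mtopology g"
  unfolding pathin_def continuous_map_to_metric
proof (intro ballI allI impI)
  fix x and e :: real assume x: "x \<in> topspace (top_of_set {0..1::real})" and e: "e > 0"
  define \<delta> where "\<delta> = e / (\<bar>L\<bar> + 1)"
  have \<delta>: "\<delta> > 0" using e by (simp add: \<delta>_def)
  have "g y \<in> mball (g x) e" if "y \<in> {0..1} \<inter> ball x \<delta>" for y
  proof -
    have "d (g x) (g y) \<le> L * \<bar>x - y\<bar>" using assms(2) x that by auto
    also have "\<dots> \<le> (\<bar>L\<bar> + 1) * \<bar>x - y\<bar>" by (intro mult_right_mono) auto
    also have "\<dots> < (\<bar>L\<bar> + 1) * \<delta>" using that by (intro mult_strict_left_mono) (auto simp: dist_real_def)
    also have "\<dots> = e" by (simp add: \<delta>_def)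
    finally show ?thesis using assms(1) x that by auto
  qed
  then show "\<exists>U. openin (top_of_set {0..1}) U \<and> x \<in> U \<and> (\<forall>y\<in>U. g y \<in> mball (g x) e)"
    using x \<delta> by (intro exI[of _ "{0..1} \<inter> ball x \<delta>"]) auto
qed

lemma isometric_path_imp_pathin: "isometric_path M d \<sigma> \<Longrightarrow> pathin mtopology \<sigma>"
  by (rule pathin_Lipschitz[of _ "d (\<sigma> 0) (\<sigma> 1)"]) (simp_all only: isometric_path_def order_refl)

lemma isometric_path_inj:
  assumes "isometric_path M d \<sigma>" "\<sigma> 0 \<noteq> \<sigma> 1" shows "inj_on \<sigma> {0..1}"
proof (rule inj_onI)
  fix s t :: real assume st: "s \<in> {0..1}" "t \<in> {0..1}" "\<sigma> s = \<sigma> t"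
  then have "d (\<sigma> 0) (\<sigma> 1) * \<bar>s - t\<bar> = 0"
    using assms(1) mdist_zero unfolding isometric_path_def by metis
  moreover have "\<sigma> 0 \<in> M" "\<sigma> 1 \<in> M" using assms(1) by (auto simp: isometric_path_def)
  ultimately show "s = t" using assms(2) by simp
qed

lemma isometric_path_seg:
  assumes "isometric_path M d \<sigma>" "a \<in> {0..1}" "b \<in> {0..1}"
  shows "isometric_path M d (\<sigma> \<circ> seg a b)"
proof -
  have in01: "seg a b t \<in> {0..1}" if "t \<in> {0..1}" for t
    using seg_in_convex[OF _ assms(2,3) that] by simp
  have e: "seg a b s - seg a b t = (b - a) * (s - t)" for s t by (simp add: seg_def algebra_simps)
  have "d (\<sigma> (seg a b s)) (\<sigma> (seg a b t)) = d (\<sigma> a) (\<sigma> b) * \<bar>s - t\<bar>" if st: "s \<in> {0..1}" "t \<in> {0..1}" for s t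
  proof -
    have "d (\<sigma> (seg a b s)) (\<sigma> (seg a b t)) = d (\<sigma> 0) (\<sigma> 1) * \<bar>seg a b s - seg a b t\<bar>"
      using assms(1) in01 st unfolding isometric_path_def by blast
    also have "\<dots> = d (\<sigma> 0) (\<sigma> 1) * \<bar>a - b\<bar> * \<bar>s - t\<bar>" by (simp add: e abs_mult abs_minus_commute)
    also have "d (\<sigma> 0) (\<sigma> 1) * \<bar>a - b\<bar> = d (\<sigma> a) (\<sigma> b)" using assms unfolding isometric_path_def by metis
    finally show ?thesis .
  qed
  then show ?thesis using assms(1) in01 unfolding isometric_path_def o_def seg_ends by blast
qed

lemma geodesic_spaceI:
  assumes "\<And>x y. x \<in> M \<Longrightarrow> y \<in> M \<Longrightarrow> \<exists>\<sigma>. isometric_path M d \<sigma> \<and> \<sigma> 0 = x \<and> \<sigma> 1 = y"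
  shows "geodesic_space M d"
  unfolding geodesic_space_def
proof (intro conjI ballI)
  show "Metric_space M d" by (rule Metric_space_axioms)
  fix x y assume "x \<in> M" "y \<in> M"
  then obtain \<sigma> where \<sigma>: "isometric_path M d \<sigma>" "\<sigma> 0 = x" "\<sigma> 1 = y" using assms by blast
  have "path_length d \<sigma> \<le> ennreal (d x y)"
    by (rule path_length_Lipschitz) (use \<sigma> in \<open>auto simp: isometric_path_def\<close>)
  moreover have "ennreal (d x y) \<le> path_length d \<sigma>" using path_length_ge_dist[of 0 1 d \<sigma>] \<sigma> by simp
  ultimately show "\<exists>\<gamma>. pathin mtopology \<gamma> \<and> \<gamma> 0 = x \<and> \<gamma> 1 = y \<and> path_length d \<gamma> = ennreal (d x y)"
    using \<sigma> isometric_path_imp_pathin by (intro exI[of _ \<sigma>]) auto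
qed

text \<open>Instead of constructing a geodesic by iterated bisection, take a maximal set \<open>S\<close> containing \<open>x\<close>
  and \<open>y\<close> on which the distance from \<open>x\<close> is an isometry into the line. By maximality \<open>S\<close> is closed,
  hence compact. If a value were missing, \<open>S\<close> would have a last point \<open>a\<close> below and a first point \<open>b\<close> above
  the gap, and a midpoint of \<open>a\<close> and \<open>b\<close> could be added. So the distance from \<open>x\<close> maps \<open>S\<close> onto the
  whole interval, and its inverse is the path.\<close>

lemma isometric_path_if_midpoints:
  assumes cpt: "compact_space mtopology"
    and mid: "\<And>x y. x \<in> M \<Longrightarrow> y \<in> M \<Longrightarrow> \<exists>m\<in>M. d x m = d x y / 2 \<and> d m y = d x y / 2"
    and xy: "x \<in> M" "y \<in> M"
  shows "\<exists>\<sigma>. isometric_path M d \<sigma> \<and> \<sigma> 0 = x \<and> \<sigma> 1 = y"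
proof -
  let ?D = "d x y"
  let ?\<phi> = "d x"
  define lin where "lin S \<longleftrightarrow> S \<subseteq> M \<and> x \<in> S \<and> y \<in> S \<and> (\<forall>a\<in>S. ?\<phi> a \<le> ?D) \<and> (\<forall>a\<in>S. \<forall>b\<in>S. d a b = \<bar>?\<phi> a - ?\<phi> b\<bar>)" for S
  have "lin {x, y}" using xy by (auto simp: lin_def commute)
  then have ne: "{S. lin S} \<noteq> {}" by blast
  have "\<exists>S\<in>{S. lin S}. \<forall>T\<in>{S. lin S}. S \<subseteq> T \<longrightarrow> T = S"
  proof (rule subset_Zorn_nonempty[OF ne])
    fix \<C> assume C: "\<C> \<noteq> {}" "subset.chain {S. lin S} \<C>"
    then have l: "lin S" if "S \<in> \<C>" for S using that by (auto simp: subset.chain_def)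
    have "d a b = \<bar>?\<phi> a - ?\<phi> b\<bar>" if ab: "a \<in> \<Union>\<C>" "b \<in> \<Union>\<C>" for a b
    proof -
      obtain S T where ST: "S \<in> \<C>" "a \<in> S" "T \<in> \<C>" "b \<in> T" using ab by auto
      have "S \<subseteq> T \<or> T \<subseteq> S" using C(2) ST by (auto simp: subset_chain_def)
      then show ?thesis using ST l[of S] l[of T] unfolding lin_def by blast
    qed
    then show "\<Union>\<C> \<in> {S. lin S}" using C(1) l unfolding lin_def by blast
  qed
  then obtain S where S: "lin S" and max: "\<And>T. lin T \<Longrightarrow> S \<subseteq> T \<Longrightarrow> T = S" by blast
  have SM: "S \<subseteq> M" "x \<in> S" "y \<in> S" and S\<phi>: "\<And>a. a \<in> S \<Longrightarrow> ?\<phi> a \<le> ?D"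
    and Sd: "\<And>a b. a \<in> S \<Longrightarrow> b \<in> S \<Longrightarrow> d a b = \<bar>?\<phi> a - ?\<phi> b\<bar>" using S unfolding lin_def by blast+
  have add: "p \<in> S" if p: "p \<in> M" "?\<phi> p \<le> ?D" "\<And>a. a \<in> S \<Longrightarrow> d a p = \<bar>?\<phi> a - ?\<phi> p\<bar>" for p
  proof -
    have "d a b = \<bar>?\<phi> a - ?\<phi> b\<bar>" if "a \<in> insert p S" "b \<in> insert p S" for a b
      using that(1)
    proof
      assume a: "a = p"
      show ?thesis using that(2)
      proof
        assume "b = p"
        then show ?thesis using a p(1) by simp
      next
        assume "b \<in> S"
        then show ?thesis using p(3)[of b] a by (simp only: commute[of p b] abs_minus_commute)
      qed
    next
      assume a: "a \<in> S"
      show ?thesis using that(2)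
      proof
        assume "b = p"
        then show ?thesis using p(3)[OF a] by (simp only:)
      qed (rule Sd[OF a])
    qed
    then have "lin (insert p S)" using p(1,2) SM S\<phi> unfolding lin_def by blast
    then show ?thesis using max[of "insert p S"] by blast
  qed
  have "closedin mtopology S"
  proof -
    have "mtopology closure_of S \<subseteq> S"
    proof
      fix p assume "p \<in> mtopology closure_of S"
      then have p: "p \<in> M" "\<And>r. r > 0 \<Longrightarrow> \<exists>s\<in>S. s \<in> mball p r" by (auto simp: metric_closure_of)
      show "p \<in> S"
      proof (rule add)
        have approx: "\<exists>s\<in>S. s \<in> M \<and> d p s < r" if "r > 0" for r using p(2)[OF that] by auto
        show "?\<phi> p \<le> ?D"
        proof (rule field_le_epsilon)
          fix e :: real assume "e > 0"
          then obtain s where s: "s \<in> S" "s \<in> M" "d p s < e" using approx by blast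
          then show "?\<phi> p \<le> ?D + e" using S\<phi>[OF s(1)] triangle[of x s p] xy p(1) commute[of p s] by linarith
        qed
        fix a assume a: "a \<in> S"
        then have aM: "a \<in> M" using SM by blast
        have "\<bar>d a p - \<bar>?\<phi> a - ?\<phi> p\<bar>\<bar> \<le> 0"
        proof (rule field_le_epsilon)
          fix e :: real assume "e > 0"
          then obtain s where s: "s \<in> S" "s \<in> M" "d p s < e / 2" using approx[of "e/2"] by auto
          have "\<bar>d a p - d a s\<bar> \<le> d p s" "\<bar>?\<phi> p - ?\<phi> s\<bar> \<le> d p s"
            using triangle[of a s p] triangle[of a p s] triangle[of x s p] triangle[of x p s] aM s p(1) xy commute[of p s] by (auto simp: abs_le_iff)
          then show "\<bar>d a p - \<bar>?\<phi> a - ?\<phi> p\<bar>\<bar> \<le> 0 + e" using Sd[OF a s(1)] s(3) by linarith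
        qed
        then show "d a p = \<bar>?\<phi> a - ?\<phi> p\<bar>" by simp
      qed (rule p(1))
    qed
    then show ?thesis using SM(1) closure_of_subset_eq[of S mtopology] by auto
  qed
  then have cS: "compactin mtopology S" using cpt closedin_compact_space by blast
  have c\<phi>: "continuous_map mtopology euclideanreal ?\<phi>" using continuous_map_dist_point[OF xy(1)] .
  have onto: "\<exists>a\<in>S. ?\<phi> a = r" if r: "0 \<le> r" "r \<le> ?D" for r
  proof (rule ccontr)
    assume n: "\<not> (\<exists>a\<in>S. ?\<phi> a = r)"
    have clr: "closedin mtopology {a \<in> topspace mtopology. ?\<phi> a \<in> {..r}}" "closedin mtopology {a \<in> topspace mtopology. ?\<phi> a \<in> {r..}}"
      by (rule closedin_continuous_map_preimage[OF c\<phi>]; simp)+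
    let ?A = "S \<inter> {a \<in> topspace mtopology. ?\<phi> a \<in> {..r}}" let ?B = "S \<inter> {a \<in> topspace mtopology. ?\<phi> a \<in> {r..}}"
    have cA: "compactin mtopology ?A" "compactin mtopology ?B" using cS clr compact_Int_closedin by blast+
    have "x \<in> ?A" "y \<in> ?B" using SM xy r by auto
    then have neA: "?A \<noteq> {}" "?B \<noteq> {}" by blast+
    have cm: "continuous_map mtopology euclideanreal (\<lambda>a. - ?\<phi> a)" using c\<phi> by (intro continuous_intros)
    obtain a where a: "a \<in> ?A" "\<And>z. z \<in> ?A \<Longrightarrow> - ?\<phi> a \<le> - ?\<phi> z" using compact_attains_min[OF cA(1) neA(1) cm] by blast
    obtain b where b: "b \<in> ?B" "\<And>z. z \<in> ?B \<Longrightarrow> ?\<phi> b \<le> ?\<phi> z" using compact_attains_min[OF cA(2) neA(2) c\<phi>] by blast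
    have aS: "a \<in> S" "a \<in> M" "?\<phi> a < r" using a(1) n by (auto simp: less_le)
    have bS: "b \<in> S" "b \<in> M" "r < ?\<phi> b" using b(1) n by (auto simp: less_le)
    have dab: "d a b = ?\<phi> b - ?\<phi> a" using Sd[OF aS(1) bS(1)] aS(3) bS(3) by simp
    obtain m where m: "m \<in> M" "d a m = d a b / 2" "d m b = d a b / 2" using mid aS bS by blast
    have dby: "d b y = ?D - ?\<phi> b" using Sd[OF bS(1) SM(3)] S\<phi>[OF bS(1)] by simp
    have \<phi>m: "?\<phi> m = (?\<phi> a + ?\<phi> b) / 2"
      using triangle[of x a m] triangle[of x m y] triangle[of m b y] xy aS bS m dab dby by (simp add: field_simps)
    have "m \<in> S"
    proof (rule add[OF m(1)])
      show "?\<phi> m \<le> ?D" using \<phi>m aS(3) bS(3) S\<phi>[OF bS(1)] S\<phi>[OF aS(1)] by (simp add: field_simps)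
      fix s assume s: "s \<in> S"
      then have sM: "s \<in> M" using SM by blast
      have tri: "d s m \<ge> \<bar>?\<phi> s - ?\<phi> m\<bar>"
        using triangle[of x s m] triangle[of x m s] sM m(1) xy commute[of s m] by auto
      consider "?\<phi> s \<le> ?\<phi> a" | "?\<phi> b \<le> ?\<phi> s"
      proof (cases "?\<phi> s \<le> r")
        case True
        then show ?thesis using a(2)[of s] s sM that(1) by auto
      next
        case False
        then show ?thesis using b(2)[of s] s sM that(2) by auto
      qed
      then show "d s m = \<bar>?\<phi> s - ?\<phi> m\<bar>"
      proof cases
        case 1
        have "d s m \<le> ?\<phi> m - ?\<phi> s"
          using triangle[of s a m] sM aS m dab \<phi>m Sd[OF s aS(1)] 1 by (simp add: field_simps)
        then show ?thesis using tri by linarith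
      next
        case 2
        have "d s m \<le> ?\<phi> s - ?\<phi> m"
          using triangle[of s b m] sM bS m dab \<phi>m Sd[OF s bS(1)] 2 commute[of b m] by (simp add: field_simps)
        then show ?thesis using tri by linarith
      qed
    qed
    moreover have "?\<phi> a < ?\<phi> m" "?\<phi> m < ?\<phi> b" using \<phi>m aS(3) bS(3) by (auto simp: field_simps)
    ultimately show False using a(2)[of m] b(2)[of m] m(1) by (cases "?\<phi> m \<le> r") auto
  qed
  have "\<exists>\<sigma>. \<forall>t\<in>{0..1}. \<sigma> t \<in> S \<and> ?\<phi> (\<sigma> t) = ?D * t"
  proof (rule bchoice, rule ballI)
    fix t :: real assume "t \<in> {0..1}"
    then show "\<exists>a. a \<in> S \<and> ?\<phi> a = ?D * t" using onto[of "?D * t"] by (auto simp: mult_left_le)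
  qed
  then obtain \<sigma> where \<sigma>: "\<And>t. t \<in> {0..1} \<Longrightarrow> \<sigma> t \<in> S" "\<And>t. t \<in> {0..1} \<Longrightarrow> ?\<phi> (\<sigma> t) = ?D * t" by blast
  have "?\<phi> (\<sigma> 0) = 0" using \<sigma>(2)[of 0] by simp
  then have 0: "\<sigma> 0 = x" using \<sigma>(1)[of 0] SM(1) xy by auto
  have "d (\<sigma> 1) y = 0" using Sd[OF \<sigma>(1)[of 1] SM(3)] \<sigma>(2)[of 1] by simp
  then have 1: "\<sigma> 1 = y" using \<sigma>(1)[of 1] SM(1) xy by auto
  have "d (\<sigma> s) (\<sigma> t) = ?D * \<bar>s - t\<bar>" if "s \<in> {0..1}" "t \<in> {0..1}" for s t
  proof -
    have "d (\<sigma> s) (\<sigma> t) = \<bar>?D * (s - t)\<bar>" using Sd[OF \<sigma>(1)[OF that(1)] \<sigma>(1)[OF that(2)]] \<sigma>(2) that by (simp add: algebra_simps)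
    then show ?thesis by (simp add: abs_mult)
  qed
  then show ?thesis using 0 1 \<sigma>(1) SM(1) by (intro exI[of _ \<sigma>]) (auto simp: isometric_path_def)
qed

text \<open>The maximum of the distances to \<open>x\<close> and \<open>y\<close> attains its minimum.\<close>

lemma midpoint_if_approximate:
  assumes cpt: "compact_space mtopology" and xy: "x \<in> M" "y \<in> M"
    and approx: "\<And>e. e > 0 \<Longrightarrow> \<exists>m\<in>M. d x m \<le> d x y / 2 + e \<and> d m y \<le> d x y / 2 + e"
  shows "\<exists>m\<in>M. d x m = d x y / 2 \<and> d m y = d x y / 2"
proof -
  have "continuous_map mtopology euclideanreal (\<lambda>m. max (d x m) (d y m))"
    using continuous_map_dist_point[OF xy(1)] continuous_map_dist_point[OF xy(2)] by (rule continuous_map_real_max)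
  moreover have "compactin mtopology M" using cpt by (simp add: compact_space_def)
  ultimately obtain m where m: "m \<in> M" "\<And>z. z \<in> M \<Longrightarrow> max (d x m) (d y m) \<le> max (d x z) (d y z)"
    using compact_attains_min[of mtopology M] xy(1) by blast
  have "max (d x m) (d y m) \<le> d x y / 2"
  proof (rule field_le_epsilon)
    fix e :: real assume "e > 0"
    then obtain z where "z \<in> M" "d x z \<le> d x y / 2 + e" "d z y \<le> d x y / 2 + e" using approx by blast
    then show "max (d x m) (d y m) \<le> d x y / 2 + e" using m(2)[of z] commute[of z y] by (simp add: max_def split: if_splits)
  qed
  then show ?thesis using triangle[OF xy(1) m(1) xy(2)] m(1) commute[of m y] by (intro bexI[of _ m]) auto
qed

end

section \<open>The Reeb metric\<close>

locale reeb_setup = Metric_space M d for M :: "'a set" and d +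
  fixes f :: "'a \<Rightarrow> real"
  assumes compact: "compact_space mtopology"
    and geodesics: "\<And>x y. x \<in> M \<Longrightarrow> y \<in> M \<Longrightarrow>
      \<exists>\<gamma>. pathin mtopology \<gamma> \<and> \<gamma> 0 = x \<and> \<gamma> 1 = y \<and> path_length d \<gamma> = ennreal (d x y)"
    and Lipschitz: "\<And>x y. x \<in> M \<Longrightarrow> y \<in> M \<Longrightarrow> \<bar>f x - f y\<bar> \<le> d x y"
begin

abbreviation "q \<equiv> reeb_class M d f"
abbreviation "R \<equiv> reeb_space M d f"
abbreviation "Rt \<equiv> reeb_topology M d f"
abbreviation "fb \<equiv> reeb_fun f"
abbreviation "rd \<equiv> reeb_dist M d f"

lemma continuous_f: "continuous_map mtopology euclideanreal f"
  by (rule continuous_map_Lipschitz_real) (rule Lipschitz)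

lemma class_refl: "x \<in> M \<Longrightarrow> x \<in> q x"
  unfolding reeb_class_def by (simp add: connected_component_of_refl)

lemma class_subset: "y \<in> q x \<Longrightarrow> y \<in> M \<and> f y = f x"
  unfolding reeb_class_def using connected_component_of_subset_topspace by fastforce

lemma class_eq: "y \<in> q x \<Longrightarrow> q y = q x"
proof -
  assume y: "y \<in> q x"
  then have e: "f y = f x" using class_subset by blast
  have "connected_component_of (subtopology mtopology {z \<in> M. f z = f x}) x y"
    using y by (simp add: reeb_class_def)
  then have "connected_component_of (subtopology mtopology {z \<in> M. f z = f x}) x =
    connected_component_of (subtopology mtopology {z \<in> M. f z = f x}) y"
    using connected_component_of_equiv by metis
  then show ?thesis by (simp add: reeb_class_def e)
qed

lemma class_connected: "connectedin mtopology (q x)"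
  using connectedin_connected_component_of[of "subtopology mtopology {y \<in> M. f y = f x}" x]
  by (simp add: connectedin_subtopology reeb_class_def)

lemma class_maximal:
  assumes "connectedin mtopology C" "C \<subseteq> {y \<in> M. f y = f x}" "x \<in> C" shows "C \<subseteq> q x"
  unfolding reeb_class_def
  by (rule connected_component_of_maximal) (use assms in \<open>auto simp: connectedin_subtopology\<close>)

lemma reeb_fun_class [simp]: "x \<in> M \<Longrightarrow> fb (q x) = f x"
  unfolding reeb_fun_def using class_refl class_subset by (metis someI_ex)

lemma reeb_spaceE: "C \<in> R \<Longrightarrow> \<exists>x. x \<in> M \<and> C = q x"
  by (auto simp: reeb_space_def)

lemma class_in_space [simp]: "x \<in> M \<Longrightarrow> q x \<in> R"
  by (simp add: reeb_space_def)

lemma image_q: "q ` M = R"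
  by (simp add: reeb_space_def)

lemma quotient: "quotient_map mtopology Rt q"
  unfolding reeb_topology_def by (rule quotient_map_quotient_topology)

lemma topspace_Rt [simp]: "topspace Rt = R"
  by (simp add: reeb_topology_def reeb_space_def)

lemma continuous_q: "continuous_map mtopology Rt q"
  using quotient by (rule quotient_imp_continuous_map)

lemma continuous_reeb_fun: "continuous_map Rt euclideanreal fb"
proof -
  have "continuous_map mtopology euclideanreal (fb \<circ> q)"
    by (rule continuous_map_eq[OF continuous_f]) simp
  then show ?thesis using continuous_compose_quotient_map_eq[OF quotient] by blast
qed

text \<open>The two open sets that separate \<open>x\<close> from \<open>y\<close> in the slab are saturated there, since a class is
  connected and stays at its level. Their images are thus disjoint and open in the quotient, and a path
  between them cannot remain over the slab.\<close>

lemma reeb_level_separation: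
  assumes xy: "x \<in> M" "y \<in> M" "q x \<noteq> q y" "f x = f y"
  obtains \<epsilon> where "\<epsilon> > 0"
    "\<And>\<beta>. pathin Rt \<beta> \<Longrightarrow> \<beta> 0 = q x \<Longrightarrow> \<beta> 1 = q y \<Longrightarrow> \<exists>t\<in>{0..1}. \<epsilon> \<le> \<bar>fb (\<beta> t) - f x\<bar>"
proof -
  let ?c = "f x"
  have H: "Hausdorff_space mtopology" by (rule Hausdorff_space_mtopology)
  have cl: "closedin mtopology {x}" "closedin mtopology {y}" using xy by (auto intro: closedin_Hausdorff_singleton[OF H])
  have dis: "disjnt C {x} \<or> disjnt C {y}"
    if "connectedin mtopology C" "C \<subseteq> {z \<in> topspace mtopology. f z = ?c}" for C
  proof (rule ccontr)
    assume "\<not> (disjnt C {x} \<or> disjnt C {y})"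
    then have "x \<in> C" "y \<in> C" by auto
    then have "y \<in> q x" using class_maximal[OF that(1), of x] that(2) by auto
    then show False using class_eq xy by metis
  qed
  obtain \<epsilon> U V where sep: "0 < \<epsilon>" "openin mtopology U" "openin mtopology V" "disjnt U V"
    "{z \<in> topspace mtopology. \<bar>f z - ?c\<bar> \<le> \<epsilon>} \<subseteq> U \<union> V" "x \<in> U" "y \<in> V"
    by (rule fibre_separation[OF compact H continuous_f cl zero_less_one, of ?c])
      (use dis xy(4) in \<open>auto simp: abs_if\<close>)
  let ?N = "{z \<in> topspace mtopology. f z \<in> {?c - \<epsilon> <..< ?c + \<epsilon>}}"
  have N: "openin mtopology ?N" by (rule openin_continuous_map_preimage[OF continuous_f]) simp
  have UV: "openin mtopology (U \<inter> ?N)" "openin mtopology (V \<inter> ?N)" using N sep by blast+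
  have sub: "q z \<subseteq> U \<union> V" if "z \<in> ?N" for z
  proof
    fix w assume "w \<in> q z"
    then have "w \<in> M" "f w = f z" using class_subset by auto
    then show "w \<in> U \<union> V" using that sep(5) by auto
  qed
  have satU: "q z \<subseteq> U \<inter> ?N" if "z \<in> U \<inter> ?N" for z
  proof -
    have "z \<in> q z" using that class_refl by auto
    then have "q z \<inter> V = {}" using connectedinD[OF class_connected sep(2,3) sub[of z]] sep(4) that
      by (auto simp: disjnt_def)
    then show ?thesis using sub[of z] class_subset[of _ z] that by auto
  qed
  have satV: "q z \<subseteq> V \<inter> ?N" if "z \<in> V \<inter> ?N" for z
  proof -
    have "z \<in> q z" using that class_refl by auto
    then have "q z \<inter> U = {}" using connectedinD[OF class_connected sep(2,3) sub[of z]] sep(4) that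
      by (auto simp: disjnt_def)
    then show ?thesis using sub[of z] class_subset[of _ z] that by auto
  qed
  have opq: "openin Rt (q ` W)" if W: "openin mtopology W" "\<And>z. z \<in> W \<Longrightarrow> q z \<subseteq> W" for W
  proof -
    have WM: "W \<subseteq> M" using openin_subset[OF W(1)] by simp
    have "{z \<in> topspace mtopology. q z \<in> q ` W} = W"
    proof
      show "W \<subseteq> {z \<in> topspace mtopology. q z \<in> q ` W}" using WM by auto
      show "{z \<in> topspace mtopology. q z \<in> q ` W} \<subseteq> W"
      proof
        fix z assume "z \<in> {z \<in> topspace mtopology. q z \<in> q ` W}"
        then obtain w where "z \<in> M" "w \<in> W" "q z = q w" by auto
        then show "z \<in> W" using W(2)[of w] class_refl[of z] by auto
      qed
    qed
    then show ?thesis using W(1) WM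
      by (simp add: reeb_topology_def openin_quotient_topology image_mono)
  qed
  have "\<exists>t\<in>{0..1}. \<epsilon> \<le> \<bar>fb (\<beta> t) - ?c\<bar>" if \<beta>: "pathin Rt \<beta>" "\<beta> 0 = q x" "\<beta> 1 = q y" for \<beta>
  proof (rule ccontr)
    assume n: "\<not> (\<exists>t\<in>{0..1}. \<epsilon> \<le> \<bar>fb (\<beta> t) - ?c\<bar>)"
    have con: "connectedin Rt (\<beta> ` {0..1})"
      using path_connectedin_imp_connectedin[OF path_connectedin_path_image[OF \<beta>(1)]] .
    have cov: "\<beta> ` {0..1} \<subseteq> q ` (U \<inter> ?N) \<union> q ` (V \<inter> ?N)"
    proof
      fix C assume "C \<in> \<beta> ` {0..1}"
      then obtain t where t: "t \<in> {0..1}" "C = \<beta> t" by auto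
      then have "C \<in> R" using pathin_in_topspace[OF \<beta>(1)] by simp
      then obtain z where z: "z \<in> M" "C = q z" using reeb_spaceE by blast
      have "\<bar>fb (\<beta> t) - ?c\<bar> < \<epsilon>" using n t(1) by (meson not_less)
      then have "\<bar>f z - ?c\<bar> < \<epsilon>" using z t(2) by simp
      then have "z \<in> ?N" "z \<in> U \<union> V" using z(1) sep(5) by auto
      then show "C \<in> q ` (U \<inter> ?N) \<union> q ` (V \<inter> ?N)" using z(2) by blast
    qed
    have disj: "q ` (U \<inter> ?N) \<inter> q ` (V \<inter> ?N) = {}"
    proof -
      have False if "u \<in> U \<inter> ?N" "v \<in> V \<inter> ?N" "q u = q v" for u v
      proof -
        have "v \<in> q u" using class_refl[of v] that by auto
        then show False using satU[OF that(1)] that(2) sep(4) by (auto simp: disjnt_def)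
      qed
      then show ?thesis by blast
    qed
    have "x \<in> ?N" "y \<in> ?N" using xy sep(1) by auto
    then have "q x \<in> q ` (U \<inter> ?N)" "q y \<in> q ` (V \<inter> ?N)" using sep by blast+
    moreover have "q x \<in> \<beta> ` {0..1}" "q y \<in> \<beta> ` {0..1}" using \<beta>(2,3) by (force simp: image_iff)+
    ultimately show False
      using connectedinD[OF con opq[OF UV(1) satU] opq[OF UV(2) satV] cov] disj by blast
  qed
  then show ?thesis using that sep(1) by blast
qed

text \<open>The extended distance, which the Reeb distance truncates to a real number.\<close>

definition reeb_length :: "'a set \<Rightarrow> 'a set \<Rightarrow> ennreal" where
  "reeb_length C D = (INF \<beta> \<in> {\<beta>. pathin Rt \<beta> \<and> \<beta> 0 = C \<and> \<beta> 1 = D}. path_length dist (fb \<circ> \<beta>))"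

lemma reeb_dist_length: "rd C D = enn2real (reeb_length C D)"
  by (simp add: reeb_dist_def reeb_length_def)

lemma reeb_length_le_path: "pathin Rt \<beta> \<Longrightarrow> reeb_length (\<beta> 0) (\<beta> 1) \<le> path_length dist (fb \<circ> \<beta>)"
  unfolding reeb_length_def by (rule INF_lower) simp

text \<open>A geodesic of the original space projects to a path on which the values of \<open>f\<close> vary no more
  than the length.\<close>

lemma reeb_length_le_dist:
  assumes "x \<in> M" "y \<in> M" shows "reeb_length (q x) (q y) \<le> ennreal (d x y)"
proof -
  obtain \<gamma> where \<gamma>: "pathin mtopology \<gamma>" "\<gamma> 0 = x" "\<gamma> 1 = y" "path_length d \<gamma> = ennreal (d x y)"
    using geodesics assms by blast
  have p: "pathin Rt (q \<circ> \<gamma>)" using \<gamma>(1) continuous_q unfolding pathin_def by (rule continuous_map_compose)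
  have "\<gamma> s \<in> M" if "s \<in> {0..1}" for s using pathin_in_topspace[OF \<gamma>(1) that] by simp
  then have "path_length dist (fb \<circ> (q \<circ> \<gamma>)) \<le> path_length d \<gamma>"
    by (intro path_length_mono) (simp add: dist_real_def Lipschitz)
  then show ?thesis using reeb_length_le_path[OF p] \<gamma> by simp
qed

lemma reeb_length_finite: "C \<in> R \<Longrightarrow> D \<in> R \<Longrightarrow> reeb_length C D < top_class.top"
proof -
  assume "C \<in> R" "D \<in> R"
  then obtain x y where "x \<in> M" "C = q x" "y \<in> M" "D = q y" using reeb_spaceE by meson
  then have "reeb_length C D \<le> ennreal (d x y)" using reeb_length_le_dist by simp
  then show ?thesis using ennreal_less_top order_le_less_trans by blast
qed

lemma reeb_length_ge_level: "ennreal \<bar>fb C - fb D\<bar> \<le> reeb_length C D"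
  unfolding reeb_length_def
proof (rule INF_greatest)
  fix \<beta> assume "\<beta> \<in> {\<beta>. pathin Rt \<beta> \<and> \<beta> 0 = C \<and> \<beta> 1 = D}"
  then show "ennreal \<bar>fb C - fb D\<bar> \<le> path_length dist (fb \<circ> \<beta>)"
    using path_length_ge_dist[of 0 1 dist "fb \<circ> \<beta>"] by (simp add: dist_real_def)
qed

lemma reeb_length_pos:
  assumes "C \<in> R" "D \<in> R" "C \<noteq> D" shows "0 < reeb_length C D"
proof -
  obtain x y where xy: "x \<in> M" "y \<in> M" "C = q x" "D = q y" using assms by (metis reeb_spaceE)
  show ?thesis
  proof (cases "f x = f y")
    case False
    then have "0 < ennreal \<bar>fb C - fb D\<bar>" using xy by simp
    then show ?thesis using reeb_length_ge_level by (rule order_less_le_trans)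
  next
    case True
    obtain \<epsilon> where e: "\<epsilon> > 0"
      "\<And>\<beta>. pathin Rt \<beta> \<Longrightarrow> \<beta> 0 = q x \<Longrightarrow> \<beta> 1 = q y \<Longrightarrow> \<exists>t\<in>{0..1}. \<epsilon> \<le> \<bar>fb (\<beta> t) - f x\<bar>"
      using reeb_level_separation xy assms(3) True by metis
    have "ennreal \<epsilon> \<le> reeb_length C D"
      unfolding reeb_length_def
    proof (rule INF_greatest)
      fix \<beta> assume "\<beta> \<in> {\<beta>. pathin Rt \<beta> \<and> \<beta> 0 = C \<and> \<beta> 1 = D}"
      then have \<beta>: "pathin Rt \<beta>" "\<beta> 0 = q x" "\<beta> 1 = q y" using xy by auto
      then obtain t where t: "t \<in> {0..1}" "\<epsilon> \<le> \<bar>fb (\<beta> t) - f x\<bar>" using e(2) by blast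
      have "ennreal \<epsilon> \<le> ennreal (dist ((fb \<circ> \<beta>) 0) ((fb \<circ> \<beta>) t))"
        using t(2) \<beta> xy by (intro ennreal_leI) (simp add: dist_real_def abs_minus_commute)
      also have "\<dots> \<le> path_length dist (fb \<circ> \<beta>)" using t(1) by (intro path_length_ge_dist) auto
      finally show "ennreal \<epsilon> \<le> path_length dist (fb \<circ> \<beta>)" .
    qed
    then show ?thesis using e(1) by (metis ennreal_less_zero_iff order_less_le_trans)
  qed
qed

lemma reeb_length_commute_le: "reeb_length C D \<le> reeb_length D C"
  unfolding reeb_length_def
proof (rule INF_greatest)
  fix \<beta> assume "\<beta> \<in> {\<beta>. pathin Rt \<beta> \<and> \<beta> 0 = D \<and> \<beta> 1 = C}"
  then have \<beta>: "pathin Rt \<beta>" "\<beta> 0 = D" "\<beta> 1 = C" by auto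
  have "continuous_map (top_of_set {0..1::real}) (top_of_set {0..1}) (\<lambda>t. 1 - t)" by (auto intro!: continuous_intros)
  then have "pathin Rt (\<beta> \<circ> (\<lambda>t. 1 - t))" using \<beta>(1) unfolding pathin_def by (rule continuous_map_compose)
  then have "\<beta> \<circ> (\<lambda>t. 1 - t) \<in> {\<beta>. pathin Rt \<beta> \<and> \<beta> 0 = C \<and> \<beta> 1 = D}" using \<beta> by simp
  then have "(INF \<beta> \<in> {\<beta>. pathin Rt \<beta> \<and> \<beta> 0 = C \<and> \<beta> 1 = D}. path_length dist (fb \<circ> \<beta>))
    \<le> path_length dist (fb \<circ> (\<beta> \<circ> (\<lambda>t. 1 - t)))" by (rule INF_lower)
  also have "\<dots> \<le> path_length dist (fb \<circ> \<beta>)"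
    using path_length_reverse_le[of dist "fb \<circ> \<beta>"] by (simp add: dist_commute o_assoc)
  finally show "(INF \<beta> \<in> {\<beta>. pathin Rt \<beta> \<and> \<beta> 0 = C \<and> \<beta> 1 = D}. path_length dist (fb \<circ> \<beta>)) \<le> path_length dist (fb \<circ> \<beta>)" .
qed

lemma reeb_length_commute: "reeb_length C D = reeb_length D C"
  by (rule antisym) (rule reeb_length_commute_le)+

lemma reeb_length_near_path:
  assumes "C \<in> R" "D \<in> R" "e > 0"
  obtains \<beta> where "pathin Rt \<beta>" "\<beta> 0 = C" "\<beta> 1 = D" "path_length dist (fb \<circ> \<beta>) \<le> ennreal (rd C D + e)"
proof -
  have "reeb_length C D = ennreal (rd C D)"
    using reeb_length_finite[OF assms(1,2)] by (simp add: reeb_dist_length)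
  also have "\<dots> < ennreal (rd C D + e)" using assms(3) by (simp add: reeb_dist_length ennreal_less_iff)
  finally obtain \<beta> where "\<beta> \<in> {\<beta>. pathin Rt \<beta> \<and> \<beta> 0 = C \<and> \<beta> 1 = D}" "path_length dist (fb \<circ> \<beta>) < ennreal (rd C D + e)"
    unfolding reeb_length_def by (auto simp: INF_less_iff)
  then show ?thesis using that[of \<beta>] by auto
qed

lemma reeb_dist_le_path:
  assumes "pathin Rt \<beta>" "path_length dist (fb \<circ> \<beta>) \<le> ennreal L" "0 \<le> L"
  shows "rd (\<beta> 0) (\<beta> 1) \<le> L"
  unfolding reeb_dist_length
  using enn2real_mono[of "reeb_length (\<beta> 0) (\<beta> 1)" "ennreal L"] reeb_length_le_path[OF assms(1)] assms(2,3)
  by simp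

lemma reeb_dist_nonneg: "0 \<le> rd C D"
  by (simp add: reeb_dist_length)

lemma Metric_space_reeb: "Metric_space R rd"
proof
  show "0 \<le> rd C D" for C D by (rule reeb_dist_nonneg)
  show "rd C D = rd D C" for C D by (simp add: reeb_dist_length reeb_length_commute[of C D])
  fix C D assume CD: "C \<in> R" "D \<in> R"
  show "rd C D = 0 \<longleftrightarrow> C = D"
  proof
    assume "rd C D = 0"
    then have "reeb_length C D = 0" using reeb_length_finite[OF CD] by (auto simp: reeb_dist_length enn2real_eq_0_iff)
    then show "C = D" using reeb_length_pos[OF CD] by auto
  next
    assume "C = D"
    obtain x where "x \<in> M" "C = q x" using reeb_spaceE[OF CD(1)] by blast
    then have "reeb_length C D = 0" using reeb_length_le_dist[of x x] \<open>C = D\<close> by simp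
    then show "rd C D = 0" by (simp add: reeb_dist_length)
  qed
next
  fix C D E assume CDE: "C \<in> R" "D \<in> R" "E \<in> R"
  show "rd C E \<le> rd C D + rd D E"
  proof (rule field_le_epsilon)
    fix e :: real assume "e > 0"
    then have e2: "e / 2 > 0" by simp
    obtain \<beta>1 where 1: "pathin Rt \<beta>1" "\<beta>1 0 = C" "\<beta>1 1 = D" "path_length dist (fb \<circ> \<beta>1) \<le> ennreal (rd C D + e / 2)"
      using reeb_length_near_path[OF CDE(1,2) e2] by blast
    obtain \<beta>2 where 2: "pathin Rt \<beta>2" "\<beta>2 0 = D" "\<beta>2 1 = E" "path_length dist (fb \<circ> \<beta>2) \<le> ennreal (rd D E + e / 2)"
      using reeb_length_near_path[OF CDE(2,3) e2] by blast
    have "pathin Rt (join_paths \<beta>1 \<beta>2)" using 1 2 by (intro pathin_join_paths) auto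
    moreover have "path_length dist (fb \<circ> join_paths \<beta>1 \<beta>2) \<le> ennreal (rd C D + rd D E + e)"
    proof -
      have "path_length dist (fb \<circ> join_paths \<beta>1 \<beta>2) \<le> path_length dist (fb \<circ> \<beta>1) + path_length dist (fb \<circ> \<beta>2)"
        using 1 2 by (intro path_length_join_paths) auto
      also have "\<dots> \<le> ennreal (rd C D + e / 2) + ennreal (rd D E + e / 2)" using 1 2 by (intro add_mono)
      also have "\<dots> = ennreal (rd C D + rd D E + e)"
        using reeb_dist_nonneg \<open>e > 0\<close> by (simp flip: ennreal_plus add: algebra_simps)
      finally show ?thesis .
    qed
    ultimately have "rd (join_paths \<beta>1 \<beta>2 0) (join_paths \<beta>1 \<beta>2 1) \<le> rd C D + rd D E + e"
      using reeb_dist_nonneg[of C D] reeb_dist_nonneg[of D E] \<open>e > 0\<close> by (intro reeb_dist_le_path) auto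
    then show "rd C E \<le> rd C D + rd D E + e" using 1 2 by simp
  qed
qed

sublocale RM: Metric_space R rd by (rule Metric_space_reeb)

lemma reeb_dist_le_dist: "x \<in> M \<Longrightarrow> y \<in> M \<Longrightarrow> rd (q x) (q y) \<le> d x y"
  using enn2real_mono[of "reeb_length (q x) (q y)" "ennreal (d x y)"] reeb_length_le_dist[of x y]
  by (simp add: reeb_dist_length)

lemma continuous_q_metric: "continuous_map mtopology RM.mtopology q"
  unfolding metric_continuous_map[OF Metric_space_reeb]
  using reeb_dist_le_dist by (auto simp: reeb_space_def) (meson order_le_less_trans)

lemma quotient_metric: "quotient_map mtopology RM.mtopology q"
proof (rule continuous_imp_quotient_map[OF continuous_q_metric compact RM.Hausdorff_space_mtopology])
  show "q ` topspace mtopology = topspace RM.mtopology" using image_q by simp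
qed

text \<open>Both topologies make \<open>q\<close> a quotient map; for the metric one this follows from compactness.\<close>

lemma reeb_topology_eq: "Rt = RM.mtopology"
proof -
  have "openin Rt U \<longleftrightarrow> openin RM.mtopology U" for U
  proof (cases "U \<subseteq> R")
    case True
    then have "openin Rt U \<longleftrightarrow> openin mtopology {x \<in> topspace mtopology. q x \<in> U}"
      "openin RM.mtopology U \<longleftrightarrow> openin mtopology {x \<in> topspace mtopology. q x \<in> U}"
      using quotient quotient_metric unfolding quotient_map_def by simp_all
    then show ?thesis by simp
  next
    case False
    then show ?thesis using openin_subset[of Rt U] openin_subset[of RM.mtopology U] by auto
  qed
  then show ?thesis by (simp add: topology_eq)
qed

lemma compact_reeb: "compact_space RM.mtopology"
proof -
  have "compactin RM.mtopology (q ` topspace mtopology)"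
    using compact continuous_q_metric image_compactin unfolding compact_space_def by blast
  then show ?thesis using image_q by (simp add: compact_space_def)
qed

text \<open>The preimage of a connected set under a closed map with connected fibres is connected. Over a level it is
  thus contained in a single class.\<close>

lemma light_map_reeb: "light_map RM.mtopology fb"
proof
  show "compact_space RM.mtopology" by (rule compact_reeb)
  show "Hausdorff_space RM.mtopology" by (rule RM.Hausdorff_space_mtopology)
  show "continuous_map RM.mtopology euclideanreal fb" using continuous_reeb_fun reeb_topology_eq by simp
  fix C c assume C: "connectedin RM.mtopology C" "C \<subseteq> {x \<in> topspace RM.mtopology. fb x = c}"
  have preim: "{x \<in> M. q x = q y} = q y" if "y \<in> M" for y
    using class_refl class_eq class_subset by blast
  have closed: "closed_map mtopology RM.mtopology q"
    by (rule continuous_imp_closed_map[OF continuous_q_metric compact RM.Hausdorff_space_mtopology])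
  have im: "q ` topspace mtopology = topspace RM.mtopology"
    using image_q by simp
  have "monotone_map mtopology RM.mtopology q"
    unfolding monotone_map_def
  proof (intro conjI ballI)
    show "q ` topspace mtopology \<subseteq> topspace RM.mtopology" using im by simp
    fix D assume "D \<in> topspace RM.mtopology"
    then obtain y where "y \<in> M" "D = q y" using reeb_spaceE by auto
    then show "connectedin mtopology {x \<in> topspace mtopology. q x = D}" using preim class_connected by simp
  qed
  then have con: "connectedin mtopology {x \<in> topspace mtopology. q x \<in> C}"
    using monotone_closed_map[OF continuous_q_metric closed im] C(1) by blast
  show "\<exists>a. C \<subseteq> {a}"
  proof (cases "C = {}")
    case False
    then obtain y where y: "y \<in> M" "q y \<in> C" using C(2) reeb_spaceE by fastforce
    have CR: "D \<in> R" "fb D = c" if "D \<in> C" for D using C(2) that by auto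
    have "D = q y" if D: "D \<in> C" for D
    proof -
      obtain z where z: "z \<in> M" "D = q z" using CR(1)[OF D] reeb_spaceE by blast
      have "f x = c" if "x \<in> M" "q x \<in> C" for x using CR(2)[OF that(2)] that(1) by simp
      then have "{x \<in> topspace mtopology. q x \<in> C} \<subseteq> {w \<in> M. f w = f y}" using y by auto
      then have "z \<in> q y" using class_maximal[OF con] y z D by auto
      then show ?thesis using class_eq z by simp
    qed
    then show ?thesis by blast
  qed simp
qed

text \<open>On an almost shortest path choose the point at half the distance from \<open>C\<close>. The
  length of the path is at least the sum of the lengths of its two parts.\<close>

lemma reeb_approximate_midpoint:
  assumes "C \<in> R" "D \<in> R" "e > 0"
  shows "\<exists>E\<in>R. rd C E \<le> rd C D / 2 + e \<and> rd E D \<le> rd C D / 2 + e"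
proof -
  obtain \<beta> where \<beta>: "pathin Rt \<beta>" "\<beta> 0 = C" "\<beta> 1 = D" "path_length dist (fb \<circ> \<beta>) \<le> ennreal (rd C D + e)"
    using reeb_length_near_path[OF assms] by blast
  have c\<beta>: "continuous_map (top_of_set {0..1}) RM.mtopology \<beta>" using \<beta>(1) reeb_topology_eq by (simp add: pathin_def)
  have "continuous_map (top_of_set {0..1}) euclideanreal (rd C \<circ> \<beta>)"
    using c\<beta> RM.continuous_map_dist_point[OF assms(1)] by (rule continuous_map_compose)
  then have cont: "continuous_on {0..1} (rd C \<circ> \<beta>)" by simp
  obtain s where s: "0 \<le> s" "s \<le> 1" "(rd C \<circ> \<beta>) s = rd C D / 2"
    using IVT'[of "rd C \<circ> \<beta>" 0 "rd C D / 2" 1] cont assms \<beta> by auto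
  have E: "\<beta> s \<in> R" using pathin_in_topspace[OF \<beta>(1)] s by simp
  have sub: "pathin Rt (\<beta> \<circ> seg 0 s)" "pathin Rt (\<beta> \<circ> seg s 1)"
    using \<beta>(1) s by (auto simp: pathin_def intro!: pathin_seg[unfolded pathin_def])
  have sup: "path_length dist (fb \<circ> (\<beta> \<circ> seg 0 s)) + path_length dist (fb \<circ> (\<beta> \<circ> seg s 1)) \<le> ennreal (rd C D + e)"
    using path_length_superadditive[of s dist "fb \<circ> \<beta>"] s \<beta>(4) by (simp add: o_assoc)
  have l1: "ennreal (rd C (\<beta> s)) \<le> path_length dist (fb \<circ> (\<beta> \<circ> seg 0 s))"
    using reeb_length_le_path[OF sub(1)] \<beta>(2) reeb_length_finite[OF assms(1) E] by (simp add: reeb_dist_length)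
  have l2: "ennreal (rd (\<beta> s) D) \<le> path_length dist (fb \<circ> (\<beta> \<circ> seg s 1))"
    using reeb_length_le_path[OF sub(2)] \<beta>(3) reeb_length_finite[OF E assms(2)] by (simp add: reeb_dist_length)
  have "ennreal (rd C (\<beta> s) + rd (\<beta> s) D) \<le> ennreal (rd C D + e)"
    using order_trans[OF add_mono[OF l1 l2] sup] by simp
  moreover have "0 \<le> rd C D + e" using assms(3) reeb_dist_nonneg[of C D] by linarith
  ultimately have "rd C (\<beta> s) + rd (\<beta> s) D \<le> rd C D + e" by (simp only: ennreal_le_iff)
  then show ?thesis using s(3) E assms(3) by (intro bexI[of _ "\<beta> s"]) auto
qed

lemma reeb_isometric_path:
  assumes "C \<in> R" "D \<in> R"
  shows "\<exists>\<sigma>. isometric_path R rd \<sigma> \<and> \<sigma> 0 = C \<and> \<sigma> 1 = D"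
  by (rule RM.isometric_path_if_midpoints[OF compact_reeb _ assms])
    (intro RM.midpoint_if_approximate compact_reeb reeb_approximate_midpoint)

lemma geodesic_reeb: "geodesic_space R rd"
  by (rule RM.geodesic_spaceI) (rule reeb_isometric_path)

end

section \<open>Covering dimension\<close>

context light_map
begin

text \<open>In the fibre, lightness separates \<open>x\<close> from everything outside \<open>U\<close>. What remains of the slab is open
  as well, so that finitely many such neighbourhoods can be made disjoint.\<close>

lemma light_point_neighbourhood:
  assumes x: "x \<in> topspace Y" "f x = c" and U: "openin Y U" "x \<in> U"
  shows "\<exists>N e. e > 0 \<and> openin Y N \<and> x \<in> N \<and> N \<subseteq> U \<and> openin Y ({z \<in> topspace Y. \<bar>f z - c\<bar> < e} - N)"
proof -
  have cl: "closedin Y {x}" "closedin Y (topspace Y - U)"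
    using x U by (auto intro: closedin_Hausdorff_singleton[OF Hausdorff])
  have dis: "disjnt C {x} \<or> disjnt C (topspace Y - U)"
    if C: "connectedin Y C" "C \<subseteq> {z \<in> topspace Y. f z = c}" for C
  proof (cases "x \<in> C")
    case True
    obtain a where "C \<subseteq> {a}" using light[OF C] by blast
    then have "C = {x}" using True by auto
    then show ?thesis using U(2) by (auto simp: disjnt_def)
  qed (simp add: disjnt_def)
  obtain e V W where sep: "0 < e" "openin Y V" "openin Y W" "disjnt V W"
    "{z \<in> topspace Y. \<bar>f z - c\<bar> \<le> e} \<subseteq> V \<union> W" "x \<in> V"
    "\<And>z. z \<in> topspace Y - U \<Longrightarrow> \<bar>f z - c\<bar> \<le> e \<Longrightarrow> z \<in> W"
  proof (rule fibre_separation[OF compact Hausdorff cont cl zero_less_one dis])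
    fix e V W
    assume *: "0 < e" "openin Y V" "openin Y W" "disjnt V W"
      "{z \<in> topspace Y. \<bar>f z - c\<bar> \<le> e} \<subseteq> V \<union> W"
      "\<And>z. z \<in> {x} \<Longrightarrow> \<bar>f z - c\<bar> \<le> e \<Longrightarrow> z \<in> V" "\<And>z. z \<in> topspace Y - U \<Longrightarrow> \<bar>f z - c\<bar> \<le> e \<Longrightarrow> z \<in> W"
    have "x \<in> V" using *(1,6) x by simp
    then show thesis using * that by blast
  qed
  let ?S = "{z \<in> topspace Y. f z \<in> {c - e <..< c + e}}"
  have S: "openin Y ?S" by (rule openin_continuous_map_preimage[OF cont]) simp
  have eqS: "{z \<in> topspace Y. \<bar>f z - c\<bar> < e} = ?S" by auto
  show ?thesis
  proof (intro exI conjI)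
    show "e > 0" by (rule sep)
    show "openin Y (V \<inter> ?S)" using sep(2) S by blast
    show "x \<in> V \<inter> ?S" using sep x by auto
    show "V \<inter> ?S \<subseteq> U"
    proof
      fix z assume z: "z \<in> V \<inter> ?S"
      show "z \<in> U"
      proof (rule ccontr)
        assume "z \<notin> U"
        then have "z \<in> W" using sep(7)[of z] z by auto
        then show False using z sep(4) by (auto simp: disjnt_def)
      qed
    qed
    have "{z \<in> topspace Y. \<bar>f z - c\<bar> < e} - V \<inter> ?S = W \<inter> ?S"
      using sep(4,5) unfolding eqS by (auto simp: disjnt_def abs_le_iff)
    then show "openin Y ({z \<in> topspace Y. \<bar>f z - c\<bar> < e} - V \<inter> ?S)" using sep(3) S by auto
  qed
qed

text \<open>Finitely many of the neighbourhoods from \<open>light_point_neighbourhood\<close> cover the fibre, and over a thin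
  enough slab they are open with open complement. The cells of the partition of the slab that
  they generate are therefore open, and they are pairwise disjoint.\<close>

lemma light_disjoint_cover_near_level:
  assumes U: "\<And>U. U \<in> \<U> \<Longrightarrow> openin Y U" "\<Union>\<U> = topspace Y"
  shows "\<exists>e>0. \<exists>\<W>. (\<forall>W\<in>\<W>. openin Y W \<and> (\<exists>U\<in>\<U>. W \<subseteq> U)) \<and> (\<forall>V\<in>\<W>. \<forall>W\<in>\<W>. V \<inter> W \<noteq> {} \<longrightarrow> V = W) \<and>
    {z \<in> topspace Y. \<bar>f z - c\<bar> < e} \<subseteq> \<Union>\<W>"
proof -
  define F where "F = {x \<in> topspace Y. f x = c}"
  define good where "good x N e \<longleftrightarrow> e > 0 \<and> openin Y N \<and> x \<in> N \<and> (\<exists>U\<in>\<U>. N \<subseteq> U) \<and>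
    openin Y ({z \<in> topspace Y. \<bar>f z - c\<bar> < e} - N)" for x N and e :: real
  have "\<exists>N e. good x N e" if x: "x \<in> F" for x
  proof -
    have xF: "x \<in> topspace Y" "f x = c" using x by (auto simp: F_def)
    then obtain U' where U': "U' \<in> \<U>" "x \<in> U'" using U(2) by blast
    from light_point_neighbourhood[OF xF U(1)[OF U'(1)] U'(2)] show ?thesis
      unfolding good_def using U'(1) by blast
  qed
  then obtain N e where "\<And>x. x \<in> F \<Longrightarrow> good x (N x) (e x)" by metis
  then have N: "\<And>x. x \<in> F \<Longrightarrow> e x > 0" "\<And>x. x \<in> F \<Longrightarrow> openin Y (N x)" "\<And>x. x \<in> F \<Longrightarrow> x \<in> N x"
    "\<And>x. x \<in> F \<Longrightarrow> \<exists>U\<in>\<U>. N x \<subseteq> U" "\<And>x. x \<in> F \<Longrightarrow> openin Y ({z \<in> topspace Y. \<bar>f z - c\<bar> < e x} - N x)"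
    unfolding good_def by blast+
  have "closedin Y F" unfolding F_def using closedin_continuous_map_preimage[OF cont, of "{c}"] by simp
  then have "compactin Y F" using compact closedin_compact_space by blast
  moreover have "\<And>V. V \<in> N ` F \<Longrightarrow> openin Y V" "F \<subseteq> \<Union>(N ` F)" using N(2,3) by auto
  ultimately obtain \<F> where \<F>: "finite \<F>" "\<F> \<subseteq> N ` F" "F \<subseteq> \<Union>\<F>"
    using compactinD[of Y F "N ` F"] by blast
  from finite_subset_image[OF \<F>(1,2)] obtain T where T: "T \<subseteq> F" "finite T" "\<F> = N ` T" by blast
  have "closedin Y (topspace Y - \<Union>(N ` T))" using N(2) T(1) by (intro closedin_diff openin_Union) auto
  moreover have "f x \<noteq> c" if "x \<in> topspace Y - \<Union>(N ` T)" for x using that \<F>(3) T(3) by (auto simp: F_def)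
  ultimately obtain \<delta> where \<delta>: "\<delta> > 0" "\<And>x. x \<in> topspace Y - \<Union>(N ` T) \<Longrightarrow> \<delta> \<le> \<bar>f x - c\<bar>"
    using level_gap[OF compact cont] by metis
  define \<epsilon> where "\<epsilon> = Min (insert \<delta> (e ` T))"
  have \<epsilon>: "\<epsilon> > 0" "\<epsilon> \<le> \<delta>" "\<And>t. t \<in> T \<Longrightarrow> \<epsilon> \<le> e t"
    unfolding \<epsilon>_def using T \<delta>(1) N(1) by auto
  let ?S = "{z \<in> topspace Y. \<bar>f z - c\<bar> < \<epsilon>}"
  have "?S = {z \<in> topspace Y. f z \<in> {c - \<epsilon> <..< c + \<epsilon>}}" by auto
  then have S: "openin Y ?S" using openin_continuous_map_preimage[OF cont, of "{c - \<epsilon> <..< c + \<epsilon>}"] by simp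
  define cell where "cell x = {y \<in> ?S. \<forall>t\<in>T. y \<in> N t \<longleftrightarrow> x \<in> N t}" for x
  have cell_open: "openin Y (cell x)" for x
  proof -
    have "openin Y (?S \<inter> \<Inter>((\<lambda>t. if x \<in> N t then N t else ?S - N t) ` T) )" if "T \<noteq> {}"
    proof (intro openin_Int S openin_Inter)
      fix V assume "V \<in> (\<lambda>t. if x \<in> N t then N t else ?S - N t) ` T"
      then obtain t where t: "t \<in> T" "V = (if x \<in> N t then N t else ?S - N t)" by auto
      have "?S - N t = ?S \<inter> ({z \<in> topspace Y. \<bar>f z - c\<bar> < e t} - N t)" using \<epsilon>(3)[OF t(1)] by auto
      then have "openin Y (?S - N t)" using S N(5)[of t] t(1) T(1) by auto
      then show "openin Y V" using t N(2)[of t] T(1) by auto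
    qed (use T that in auto)
    moreover have "cell x = ?S \<inter> \<Inter>((\<lambda>t. if x \<in> N t then N t else ?S - N t) ` T)"
      by (auto simp: cell_def split: if_splits)
    ultimately show ?thesis using S by (cases "T = {}") (auto simp: cell_def)
  qed
  have cell_sub: "\<exists>U\<in>\<U>. cell x \<subseteq> U" if "x \<in> ?S" for x
  proof -
    have "\<not> \<delta> \<le> \<bar>f x - c\<bar>" using that \<epsilon>(2) by auto
    then have "x \<in> \<Union>(N ` T)" using \<delta>(2)[of x] that by blast
    then obtain t where t: "t \<in> T" "x \<in> N t" by blast
    then have "cell x \<subseteq> N t" by (auto simp: cell_def)
    then show ?thesis using N(4)[of t] t(1) T(1) by blast
  qed
  show ?thesis
  proof (intro exI[of _ \<epsilon>] conjI exI[of _ "cell ` ?S"] \<epsilon>(1))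
    show "\<forall>W\<in>cell ` ?S. openin Y W \<and> (\<exists>U\<in>\<U>. W \<subseteq> U)" using cell_open cell_sub by auto
    show "\<forall>V\<in>cell ` ?S. \<forall>W\<in>cell ` ?S. V \<inter> W \<noteq> {} \<longrightarrow> V = W" by (auto simp: cell_def)
    show "?S \<subseteq> \<Union>(cell ` ?S)" by (auto simp: cell_def)
  qed
qed

theorem covering_dim_le_1: "covering_dim_le Y 1"
  unfolding covering_dim_le_def
proof (intro allI impI)
  fix \<U> assume "(\<forall>U\<in>\<U>. openin Y U) \<and> \<Union>\<U> = topspace Y"
  then have U: "\<And>U. U \<in> \<U> \<Longrightarrow> openin Y U" "\<Union>\<U> = topspace Y" by auto
  define good where "good c e \<W> \<longleftrightarrow> (\<forall>W\<in>\<W>. openin Y W \<and> (\<exists>U\<in>\<U>. W \<subseteq> U)) \<and> (\<forall>V\<in>\<W>. \<forall>W\<in>\<W>. V \<inter> W \<noteq> {} \<longrightarrow> V = W) \<and>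
    {z \<in> topspace Y. \<bar>f z - c\<bar> < e} \<subseteq> \<Union>\<W>" for c e :: real and \<W>
  have "\<exists>e>0. \<exists>\<W>. good c e \<W>" for c
    unfolding good_def by (rule light_disjoint_cover_near_level[OF _ U(2)]) (rule U(1))
  then obtain e \<W> where "\<And>c. e c > 0 \<and> good c (e c) (\<W> c)" by metis
  then have E: "\<And>c. e c > 0" and good: "\<And>c. good c (e c) (\<W> c)" by auto
  have W: "openin Y W" "\<exists>U\<in>\<U>. W \<subseteq> U" if "W \<in> \<W> c" for c W
    using good[of c] that unfolding good_def by blast+
  have W3: "V = W" if "V \<in> \<W> c" "W \<in> \<W> c" "V \<inter> W \<noteq> {}" for c V W
    using good[of c] that unfolding good_def by blast
  have W4: "z \<in> \<Union>(\<W> c)" if "z \<in> topspace Y" "\<bar>f z - c\<bar> < e c" for c z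
    using good[of c] that unfolding good_def by blast
  have "compactin Y (topspace Y)" using compact by (simp add: compact_space_def)
  then have cf: "compact (f ` topspace Y)" using cont image_compactin by fastforce
  have "y \<in> ball y (e y)" for y using E by simp
  then have cov: "f ` topspace Y \<subseteq> \<Union>(range (\<lambda>c. ball c (e c)))" by blast
  have op: "open G" if "G \<in> range (\<lambda>c. ball c (e c))" for G using that by auto
  have "\<exists>r>0. \<forall>y\<in>f ` topspace Y. \<exists>G\<in>range (\<lambda>c. ball c (e c)). ball y r \<subseteq> G"
    by (rule Heine_Borel_lemma[OF cf cov op]) blast+
  then obtain r where r: "r > 0" "\<And>y. y \<in> f ` topspace Y \<Longrightarrow> \<exists>G\<in>range (\<lambda>c. ball c (e c)). ball y r \<subseteq> G"
    by blast
  \<comment> \<open>\<open>r\<close> is a Lebesgue number for the slabs, so an interval of length \<open>2 * \<mu>\<close> around a value of \<open>f\<close> fits into one of them\<close>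
  define \<mu> where "\<mu> = r / 2"
  have \<mu>: "\<mu> > 0" using r by (simp add: \<mu>_def)
  define I where "I j = {(real_of_int j - 1) * \<mu> <..< (real_of_int j + 1) * \<mu>}" for j
  have "\<exists>c. I j \<subseteq> ball c (e c)" if j: "f x \<in> I j" "x \<in> topspace Y" for j x
  proof -
    obtain c where c: "ball (f x) r \<subseteq> ball c (e c)" using r(2) j(2) by blast
    have "I j \<subseteq> ball (f x) r"
    proof
      fix y assume y: "y \<in> I j"
      have "\<bar>f x - y\<bar> < 2 * \<mu>" using y j(1) by (auto simp: I_def algebra_simps abs_less_iff)
      then show "y \<in> ball (f x) r" by (simp add: dist_real_def \<mu>_def)
    qed
    then show ?thesis using c by blast
  qed
  then have "\<forall>j. \<exists>c. (\<exists>x\<in>topspace Y. f x \<in> I j) \<longrightarrow> I j \<subseteq> ball c (e c)" by blast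
  then obtain c where c: "\<And>j x. x \<in> topspace Y \<Longrightarrow> f x \<in> I j \<Longrightarrow> I j \<subseteq> ball (c j) (e (c j))" by metis
  have near: "\<bar>f x - c j\<bar> < e (c j)" if "x \<in> topspace Y" "f x \<in> I j" for x j
    using c[OF that] that(2) by (force simp: dist_real_def abs_minus_commute)
  define P where "P j = {x \<in> topspace Y. f x \<in> I j}" for j
  define \<V> where "\<V> = {W \<inter> P j | j W. W \<in> \<W> (c j)}"
  show "\<exists>\<V>. (\<forall>V\<in>\<V>. openin Y V) \<and> \<Union>\<V> = topspace Y \<and> (\<forall>V\<in>\<V>. \<exists>U\<in>\<U>. V \<subseteq> U) \<and>
        (\<forall>x\<in>topspace Y. finite {V\<in>\<V>. x \<in> V} \<and> card {V\<in>\<V>. x \<in> V} \<le> 1 + 1)"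
  proof (intro exI[of _ \<V>] conjI ballI)
    fix V assume "V \<in> \<V>"
    then obtain j W where V: "V = W \<inter> P j" "W \<in> \<W> (c j)" unfolding \<V>_def by blast
    have "openin Y (P j)" unfolding P_def by (rule openin_continuous_map_preimage[OF cont]) (simp add: I_def)
    then show "openin Y V" using V W(1) by blast
    obtain U' where "U' \<in> \<U>" "W \<subseteq> U'" using W(2)[OF V(2)] by blast
    then show "\<exists>U\<in>\<U>. V \<subseteq> U" using V(1) by blast
  next
    show "\<Union>\<V> = topspace Y"
    proof
      show "\<Union>\<V> \<subseteq> topspace Y" by (auto simp: \<V>_def P_def)
      show "topspace Y \<subseteq> \<Union>\<V>"
      proof
        fix x assume x: "x \<in> topspace Y"
        define j where "j = \<lfloor>f x / \<mu>\<rfloor>"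
        have "real_of_int j \<le> f x / \<mu>" "f x / \<mu> < real_of_int j + 1" by (auto simp: j_def)
        then have "real_of_int j * \<mu> \<le> f x" "f x < (real_of_int j + 1) * \<mu>" using \<mu> by (auto simp: field_simps)
        then have xj: "f x \<in> I j" using \<mu> by (auto simp: I_def algebra_simps)
        then obtain W where "W \<in> \<W> (c j)" "x \<in> W" using W4[OF x near[OF x xj]] by blast
        then show "x \<in> \<Union>\<V>" using x xj by (auto simp: \<V>_def P_def)
      qed
    qed
  next
    fix x assume x: "x \<in> topspace Y"
    define j0 where "j0 = \<lfloor>f x / \<mu>\<rfloor>"
    define g where "g j = (THE W. W \<in> \<W> (c j) \<and> x \<in> W) \<inter> P j" for j
    have sub: "{V\<in>\<V>. x \<in> V} \<subseteq> g ` {j0, j0 + 1}"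
    proof
      fix V assume "V \<in> {V\<in>\<V>. x \<in> V}"
      then obtain j W where V: "V = W \<inter> P j" "W \<in> \<W> (c j)" "x \<in> W" "x \<in> P j" by (auto simp: \<V>_def)
      have "(THE W. W \<in> \<W> (c j) \<and> x \<in> W) = W" using V W3 by (intro the_equality) blast+
      then have "V = g j" using V by (simp add: g_def)
      moreover have "j = j0 \<or> j = j0 + 1"
      proof -
        have "(real_of_int j - 1) * \<mu> < f x" "f x < (real_of_int j + 1) * \<mu>" using V(4) by (auto simp: P_def I_def)
        then have "real_of_int j - 1 < f x / \<mu>" "f x / \<mu> < real_of_int j + 1" using \<mu> by (auto simp: field_simps)
        then show ?thesis unfolding j0_def by linarith
      qed
      ultimately show "V \<in> g ` {j0, j0 + 1}" by blast
    qed
    show "finite {V\<in>\<V>. x \<in> V}" by (rule finite_subset[OF sub]) simp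
    have "card {V\<in>\<V>. x \<in> V} \<le> card (g ` {j0, j0 + 1})" by (rule card_mono[OF _ sub]) simp
    also have "\<dots> \<le> card {j0, j0 + 1}" by (rule card_image_le) simp
    finally show "card {V\<in>\<V>. x \<in> V} \<le> 1 + 1" by simp
  qed
qed

end

section \<open>Arc complexes of greatest rank\<close>

text \<open>A path in an open half of the circle has no room to wind, so the principal argument is a lift.\<close>

lemma angle_incr_short:
  assumes "continuous_on {0..1} p" "\<And>t. t \<in> {0..1} \<Longrightarrow> norm (p t) = 1" "\<And>t. t \<in> {0..1} \<Longrightarrow> norm (p t - p 0) < 1"
  shows "angle_incr p = Arg (p 1 / p 0)"
proof -
  have n0: "norm (p 0) = 1" "p 0 \<noteq> 0" using assms(2)[of 0] by auto
  have re: "Re (p t / p 0) > 0" if t: "t \<in> {0..1}" for t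
  proof -
    have "p t / p 0 - 1 = (p t - p 0) / p 0" using n0 by (simp add: diff_divide_distrib)
    then have "norm (p t / p 0 - 1) < 1" using assms(3)[OF t] n0 by (simp add: norm_divide)
    then have "\<bar>Re (p t / p 0 - 1)\<bar> < 1" using abs_Re_le_cmod order_le_less_trans by blast
    then show ?thesis by simp
  qed
  have contArg: "continuous_on {z. Re z > 0} Arg"
  proof (intro continuous_at_imp_continuous_on ballI continuous_at_Arg)
    fix z assume "z \<in> {z. Re z > 0}"
    then show "z \<notin> \<real>\<^sub>\<le>\<^sub>0" by (auto simp: complex_nonpos_Reals_iff)
  qed
  define h where "h t = Arg (p 0) + Arg (p t / p 0)" for t
  have "continuous_on {0..1} (\<lambda>t. Arg (p t / p 0))"
    by (rule continuous_on_compose2[OF contArg]) (use assms(1) n0 re in \<open>auto intro!: continuous_intros\<close>)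
  then have "continuous_on {0..1} h" unfolding h_def by (rule continuous_on_add[OF continuous_on_const])
  moreover have "p t = cis (h t)" if t: "t \<in> {0..1}" for t
  proof -
    have n: "norm (p t / p 0) = 1" using assms(2)[OF t] n0 by (simp add: norm_divide)
    then have "p t / p 0 \<noteq> 0" by auto
    then have "cis (Arg (p t / p 0)) = p t / p 0" using n cis_Arg[of "p t / p 0"] by (simp add: sgn_div_norm)
    moreover have "cis (Arg (p 0)) = p 0" using n0 cis_Arg[of "p 0"] by (simp add: sgn_div_norm)
    ultimately have "cis (h t) = p 0 * (p t / p 0)" by (simp add: h_def flip: cis_mult)
    then show ?thesis using n0 by simp
  qed
  ultimately have "angle_incr p = h 1 - h 0" by (rule angle_incr_eq)
  then show ?thesis using n0 by (simp add: h_def)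
qed

lemma closed_path_preimage:
  assumes "pathin X g" "closedin X K" shows "closed {t \<in> {0..1}. g t \<in> K}"
proof -
  have "closedin (top_of_set {0..1}) {t \<in> topspace (top_of_set {0..1}). g t \<in> K}"
    using assms unfolding pathin_def by (rule closedin_continuous_map_preimage)
  from closedin_closed_trans[OF this closed_atLeastAtMost] show ?thesis by simp
qed

lemma gap_interval:
  fixes T :: "real set"
  assumes "closed T" "a \<in> T" "b \<in> T" "a \<le> c" "c \<le> b" "c \<notin> T"
  shows "\<exists>s t. s \<in> T \<and> t \<in> T \<and> a \<le> s \<and> s < c \<and> c < t \<and> t \<le> b \<and> {s<..<t} \<inter> T = {}"
proof -
  have "compact (T \<inter> {a..c})" "compact (T \<inter> {c..b})" using assms(1) by (auto intro: closed_Int_compact)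
  moreover have "T \<inter> {a..c} \<noteq> {}" "T \<inter> {c..b} \<noteq> {}" using assms by auto
  ultimately obtain s t where s: "s \<in> T \<inter> {a..c}" "\<forall>x\<in>T \<inter> {a..c}. x \<le> s"
    and t: "t \<in> T \<inter> {c..b}" "\<forall>x\<in>T \<inter> {c..b}. t \<le> x"
    using compact_attains_sup[of "T \<inter> {a..c}"] compact_attains_inf[of "T \<inter> {c..b}"] by blast
  have "x \<notin> T" if x: "x \<in> {s<..<t}" for x
  proof
    assume "x \<in> T"
    then show False using x s t by (cases "x \<le> c") force+
  qed
  then have "{s<..<t} \<inter> T = {}" by blast
  moreover have "s < c" "c < t" using s t assms(6) by (auto simp: less_le)
  moreover have "s \<in> T" "t \<in> T" "a \<le> s" "t \<le> b" using s(1) t(1) by auto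
  ultimately show ?thesis by blast
qed

lemma continuous_map_closed_union:
  assumes "closedin X A" "closedin X B" "continuous_map (subtopology X A) Y g" "continuous_map (subtopology X B) Y h"
    and "\<And>x. x \<in> A \<Longrightarrow> x \<in> B \<Longrightarrow> g x = h x"
  shows "continuous_map (subtopology X (A \<union> B)) Y (\<lambda>x. if x \<in> A then g x else h x)"
proof -
  let ?Z = "subtopology X (A \<union> B)"
  have e: "subtopology ?Z A = subtopology X A" "subtopology ?Z B = subtopology X B"
    by (auto simp: subtopology_subtopology intro!: arg_cong[where f = "subtopology X"])
  show ?thesis
  proof (rule pasting_lemma_closed[of "UNIV :: bool set" ?Z "\<lambda>b. if b then A else B" Y "\<lambda>b. if b then g else h"])
    fix x assume x: "x \<in> topspace ?Z"
    show "\<exists>j. j \<in> UNIV \<and> x \<in> (if j then A else B) \<and> (if x \<in> A then g x else h x) = (if j then g else h) x"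
      by (rule exI[of _ "x \<in> A"]) (use x in auto)
  next
    fix i j x assume "x \<in> topspace ?Z \<inter> (if i then A else B) \<inter> (if j then A else B)"
    then show "(if i then g else h) x = (if j then g else h) x" using assms(5) by (cases i; cases j) auto
  next
    fix i show "continuous_map (subtopology ?Z (if i then A else B)) Y (if i then g else h)"
      using assms(3,4) e by (cases i) auto
  next
    fix i show "closedin ?Z (if i then A else B)"
      using assms(1,2) by (cases i) (auto simp: closedin_subtopology)
  qed auto
qed

text \<open>The arc meets \<open>\<Gamma>\<close> only in its starting point. A lift along the arc can be shifted to agree there.\<close>

lemma attaching_arc_extends_lift:
  fixes u :: "'b \<Rightarrow> complex"
  assumes X: "Hausdorff_space X" and u: "circle_map X u" and \<Gamma>: "closedin X \<Gamma>" and arc: "attaching_arc X \<Gamma> \<alpha>" "\<alpha> 1 \<notin> \<Gamma>"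
    and h: "continuous_map (subtopology X \<Gamma>) euclideanreal h" "\<And>x. x \<in> \<Gamma> \<Longrightarrow> u x = cis (h x)"
  shows "\<exists>k. continuous_map (subtopology X (\<Gamma> \<union> \<alpha> ` {0..1})) euclideanreal k \<and> (\<forall>x\<in>\<Gamma> \<union> \<alpha> ` {0..1}. u x = cis (k x))"
proof -
  have a: "pathin X \<alpha>" "inj_on \<alpha> {0..1}" "\<alpha> 0 \<in> \<Gamma>" using arc(1) by (auto simp: attaching_arc_def)
  obtain \<beta> where \<beta>: "continuous_map (subtopology X (\<alpha> ` {0..1})) (top_of_set {0..1}) \<beta>"
    "\<And>t. t \<in> {0..1} \<Longrightarrow> \<beta> (\<alpha> t) = t" using arc_inverse[OF X a(1,2)] by metis
  obtain l where l: "continuous_on {0..1} l" "\<And>t. t \<in> {0..1} \<Longrightarrow> u (\<alpha> t) = cis (l t)"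
    using circle_map_path_lift[OF u a(1)] by metis
  define c where "c = h (\<alpha> 0) - l 0"
  have c: "cis c = 1" using h(2)[OF a(3)] l(2)[of 0] by (simp add: c_def flip: cis_divide)
  define g where "g x = l (\<beta> x) + c" for x
  have gu: "u x = cis (g x)" if x: "x \<in> \<alpha> ` {0..1}" for x
  proof -
    obtain t where "t \<in> {0..1}" "x = \<alpha> t" using x by auto
    then show ?thesis using l(2)[of t] \<beta>(2)[of t] c by (simp add: g_def flip: cis_mult)
  qed
  have "continuous_map (top_of_set {0..1}) euclideanreal (\<lambda>t. l t + c)" using l(1) by (auto intro!: continuous_intros)
  from continuous_map_compose[OF \<beta>(1) this] have g: "continuous_map (subtopology X (\<alpha> ` {0..1})) euclideanreal g"
    by (simp add: g_def[abs_def] o_def)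
  have agree: "h x = g x" if x: "x \<in> \<Gamma>" "x \<in> \<alpha> ` {0..1}" for x
  proof -
    obtain t where t: "t \<in> {0..1}" "x = \<alpha> t" using x by auto
    then have "t = 0" using attaching_arc_meets_only_at_ends[OF arc(1), of t] x(1) arc(2) by auto
    then show ?thesis using t \<beta>(2)[of 0] by (simp add: g_def c_def)
  qed
  have cl: "closedin X (\<alpha> ` {0..1})" using compactin_imp_closedin[OF X compactin_path_image[OF a(1)]] .
  have "continuous_map (subtopology X (\<Gamma> \<union> \<alpha> ` {0..1})) euclideanreal (\<lambda>x. if x \<in> \<Gamma> then h x else g x)"
    by (rule continuous_map_closed_union[OF \<Gamma> cl h(1) g agree])
  then show ?thesis using h(2) gu by (intro exI[of _ "\<lambda>x. if x \<in> \<Gamma> then h x else g x"]) auto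
qed

definition lifts_on :: "'b topology \<Rightarrow> ('b \<Rightarrow> complex) \<Rightarrow> 'b set \<Rightarrow> bool" where
  "lifts_on X u S \<longleftrightarrow> (\<exists>h. continuous_map (subtopology X S) euclideanreal h \<and> (\<forall>x\<in>S. u x = cis (h x)))"

locale light_geodesic = Metric_space R d + light_map "Metric_space.mtopology R d" f
  for R :: "'b set" and d :: "'b \<Rightarrow> 'b \<Rightarrow> real" and f :: "'b \<Rightarrow> real" +
  assumes isometric_path_exists: "\<And>x y. x \<in> R \<Longrightarrow> y \<in> R \<Longrightarrow> \<exists>\<sigma>. isometric_path R d \<sigma> \<and> \<sigma> 0 = x \<and> \<sigma> 1 = y"

locale maximal_arc_complex = light_geodesic R d f for R :: "'b set" and d f +
  fixes k :: nat and G :: "'b set"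
  assumes complex: "arc_complex mtopology k G"
    and maximal: "\<And>\<Gamma>. \<not> arc_complex mtopology (Suc k) \<Gamma>"
begin

lemma arc_complex_closed: "arc_complex mtopology j \<Gamma> \<Longrightarrow> closedin mtopology \<Gamma>"
  using arc_complex_topology(3) compactin_imp_closedin[OF Hausdorff] by blast

text \<open>A maximal excursion of the geodesic from \<open>\<Gamma>\<close> is an arc with both ends on \<open>\<Gamma>\<close>; attaching it would
  raise the rank.\<close>

lemma isometric_path_stays:
  assumes \<Gamma>: "arc_complex mtopology k \<Gamma>" and \<sigma>: "isometric_path R d \<sigma>"
    and abc: "a \<in> {0..1}" "b \<in> {0..1}" "\<sigma> a \<in> \<Gamma>" "\<sigma> b \<in> \<Gamma>" "a \<le> c" "c \<le> b"
  shows "\<sigma> c \<in> \<Gamma>"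
proof (cases "\<sigma> 0 = \<sigma> 1")
  case True
  have c01: "c \<in> {0..1}" using abc by auto
  have M: "\<sigma> t \<in> R" if "t \<in> {0..1}" for t using \<sigma> that by (auto simp: isometric_path_def)
  have "d (\<sigma> a) (\<sigma> c) = d (\<sigma> 0) (\<sigma> 1) * \<bar>a - c\<bar>" using \<sigma> abc(1) c01 unfolding isometric_path_def by blast
  also have "\<dots> = 0" using True M[of 1] by simp
  finally have "\<sigma> a = \<sigma> c" using M[OF c01] M[OF abc(1)] by simp
  then show ?thesis using abc by simp
next
  case False
  show ?thesis
  proof (rule ccontr)
    assume n: "\<sigma> c \<notin> \<Gamma>"
    have p: "pathin mtopology \<sigma>" using isometric_path_imp_pathin[OF \<sigma>] .
    let ?T = "{t \<in> {0..1}. \<sigma> t \<in> \<Gamma>}"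
    have clT: "closed ?T" using closed_path_preimage[OF p arc_complex_closed[OF \<Gamma>]] .
    have "a \<in> ?T" "b \<in> ?T" "c \<notin> ?T" using abc n by auto
    from gap_interval[OF clT this(1,2) abc(5,6) this(3)]
    obtain s t where st: "s \<in> ?T" "t \<in> ?T" "s < c" "c < t" "{s<..<t} \<inter> ?T = {}" by blast
    have s01: "s \<in> {0..1}" "t \<in> {0..1}" "\<sigma> s \<in> \<Gamma>" "\<sigma> t \<in> \<Gamma>" "s < t" using st by auto
    let ?\<alpha> = "\<sigma> \<circ> seg s t"
    have iso: "isometric_path R d ?\<alpha>" using isometric_path_seg[OF \<sigma> s01(1,2)] .
    have "\<sigma> s \<noteq> \<sigma> t" using inj_onD[OF isometric_path_inj[OF \<sigma> False], of s t] s01 by auto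
    then have inj: "inj_on ?\<alpha> {0..1}" using isometric_path_inj[OF iso] by simp
    have "?\<alpha> ` {0<..<1} \<inter> \<Gamma> = {}"
    proof -
      have "seg s t ` {0<..<1} = {s<..<t}" using seg_open_image[of s t] s01 by auto
      then have im: "?\<alpha> ` {0<..<1} = \<sigma> ` {s<..<t}" by (simp only: image_comp[symmetric])
      have "\<sigma> r \<notin> \<Gamma>" if r: "r \<in> {s<..<t}" for r
      proof -
        have "r \<in> {0..1}" "r \<notin> ?T" using r s01 st(5) by (auto simp del: mem_Collect_eq)
        then show ?thesis by blast
      qed
      then show ?thesis unfolding im by auto
    qed
    then have "attaching_arc mtopology \<Gamma> ?\<alpha>"
      using isometric_path_imp_pathin[OF iso] inj s01(3) by (simp add: attaching_arc_def)
    from arc_complex.attach[OF \<Gamma> this] have "arc_complex mtopology (Suc k) (\<Gamma> \<union> ?\<alpha> ` {0..1})"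
      using s01(4) by simp
    then show False using maximal by blast
  qed
qed

text \<open>After its last visit to \<open>\<Gamma>\<close> the geodesic is an arc with a free end, before that visit it stays in \<open>\<Gamma>\<close>.
  So the rank does not change and the lift extends.\<close>

lemma absorb_isometric_path:
  assumes u: "circle_map mtopology u" and \<Gamma>: "arc_complex mtopology k \<Gamma>" and \<sigma>: "isometric_path R d \<sigma>" "\<sigma> 0 \<in> \<Gamma>"
    and lift: "lifts_on mtopology u \<Gamma>"
  shows "\<exists>\<Delta>. arc_complex mtopology k \<Delta> \<and> \<Gamma> \<subseteq> \<Delta> \<and> \<sigma> ` {0..1} \<subseteq> \<Delta> \<and> lifts_on mtopology u \<Delta>"
proof (cases "\<sigma> 1 \<in> \<Gamma>")
  case True
  have "\<sigma> ` {0..1} \<subseteq> \<Gamma>" using isometric_path_stays[OF \<Gamma> \<sigma>(1), of 0 1] \<sigma>(2) True by auto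
  then show ?thesis using lift \<Gamma> by blast
next
  case False
  obtain h where h: "continuous_map (subtopology mtopology \<Gamma>) euclideanreal h" "\<And>x. x \<in> \<Gamma> \<Longrightarrow> u x = cis (h x)"
    using lift by (auto simp: lifts_on_def)
  have p: "pathin mtopology \<sigma>" using isometric_path_imp_pathin[OF \<sigma>(1)] .
  have ne: "\<sigma> 0 \<noteq> \<sigma> 1" using \<sigma>(2) False by auto
  let ?T = "{t \<in> {0..1}. \<sigma> t \<in> \<Gamma>}"
  have "closed ?T" using closed_path_preimage[OF p arc_complex_closed[OF \<Gamma>]] .
  moreover have "bounded ?T" by (rule bounded_subset[of "{0..1}"]) auto
  moreover have "0 \<in> ?T" using \<sigma>(2) by simp
  ultimately obtain s where s: "s \<in> ?T" "\<forall>t\<in>?T. t \<le> s"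
    using compact_attains_sup[of ?T] compact_eq_bounded_closed by blast
  have s01: "s \<in> {0..1}" "\<sigma> s \<in> \<Gamma>" "s < 1" using s(1) False by (auto simp: less_le)
  let ?\<alpha> = "\<sigma> \<circ> seg s 1"
  have iso: "isometric_path R d ?\<alpha>" using isometric_path_seg[OF \<sigma>(1) s01(1)] by simp
  have "\<sigma> s \<noteq> \<sigma> 1" using False s01 by auto
  then have inj: "inj_on ?\<alpha> {0..1}" using isometric_path_inj[OF iso] by simp
  have "?\<alpha> ` {0<..<1} \<inter> \<Gamma> = {}"
  proof -
    have "seg s 1 ` {0<..<1} = {s<..<1}" using seg_open_image[of s 1] s01 by auto
    then have im: "?\<alpha> ` {0<..<1} = \<sigma> ` {s<..<1}" by (simp only: image_comp[symmetric])
    have "\<sigma> t \<notin> \<Gamma>" if t: "t \<in> {s<..<1}" for t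
    proof
      assume "\<sigma> t \<in> \<Gamma>"
      then have "t \<in> ?T" using t s01 by auto
      then have "t \<le> s" using s(2) by blast
      then show False using t by simp
    qed
    then show ?thesis unfolding im by auto
  qed
  then have arc: "attaching_arc mtopology \<Gamma> ?\<alpha>"
    using isometric_path_imp_pathin[OF iso] inj s01(2) by (simp add: attaching_arc_def)
  have a1: "?\<alpha> 1 \<notin> \<Gamma>" using False by simp
  let ?\<Delta> = "\<Gamma> \<union> ?\<alpha> ` {0..1}"
  have \<Delta>: "arc_complex mtopology k ?\<Delta>" using arc_complex.attach[OF \<Gamma> arc] a1 by simp
  have ends: "\<sigma> 0 \<in> ?\<Delta>" "\<sigma> 1 \<in> ?\<Delta>" using \<sigma>(2) by (auto intro!: image_eqI[of _ _ 1])
  have "\<sigma> t \<in> ?\<Delta>" if "t \<in> {0..1}" for t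
    using isometric_path_stays[OF \<Delta> \<sigma>(1) _ _ ends, of t] that by simp
  then have "\<sigma> ` {0..1} \<subseteq> ?\<Delta>" by blast
  moreover have "lifts_on mtopology u ?\<Delta>"
    using attaching_arc_extends_lift[OF Hausdorff u arc_complex_closed[OF \<Gamma>] arc a1 h] by (simp add: lifts_on_def)
  ultimately show ?thesis using \<Delta> by blast
qed

lemma angle_incr_in_lifted_set:
  assumes "pathin mtopology g" "g ` {0..1} \<subseteq> \<Delta>"
    and "continuous_map (subtopology mtopology \<Delta>) euclideanreal h" "\<And>x. x \<in> \<Delta> \<Longrightarrow> u x = cis (h x)"
  shows "angle_incr (u \<circ> g) = h (g 1) - h (g 0)"
proof -
  have "pathin (subtopology mtopology \<Delta>) g" using assms(1,2) by (auto simp: pathin_subtopology)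
  then have "continuous_map (top_of_set {0..1}) euclideanreal (h \<circ> g)"
    using assms(3) unfolding pathin_def by (rule continuous_map_compose)
  then have "continuous_on {0..1} (h \<circ> g)" by simp
  then have "angle_incr (u \<circ> g) = (h \<circ> g) 1 - (h \<circ> g) 0"
  proof (rule angle_incr_eq)
    fix t :: real assume "t \<in> {0..1}"
    then have "g t \<in> \<Delta>" using assms(2) by blast
    then show "(u \<circ> g) t = cis ((h \<circ> g) t)" using assms(4) by simp
  qed
  then show ?thesis by simp
qed

text \<open>The lift at \<open>x\<close> is the angle increment along a geodesic from a fixed point of \<open>G\<close> to \<open>x\<close>. Continuity
  is the point: for two points and a geodesic joining them, all three geodesics are absorbed into one
  complex on which the map lifts, so that the increment along the triangle vanishes. Hence nearby
  points have nearby lifts.\<close>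

theorem circle_map_lifts:
  assumes u: "circle_map mtopology u" and u1: "\<And>x. x \<in> G \<Longrightarrow> u x = 1"
  obtains h where "continuous_map mtopology euclideanreal h" "\<And>x. x \<in> R \<Longrightarrow> u x = cis (h x)"
proof -
  have GR: "G \<subseteq> R" "G \<noteq> {}" using arc_complex_topology(1,2)[OF complex] by auto
  then obtain g0 where g0: "g0 \<in> G" "g0 \<in> R" by blast
  have "\<forall>x\<in>R. \<exists>\<sigma>. isometric_path R d \<sigma> \<and> \<sigma> 0 = g0 \<and> \<sigma> 1 = x" using isometric_path_exists g0 by blast
  from bchoice[OF this] obtain S where S: "\<And>x. x \<in> R \<Longrightarrow> isometric_path R d (S x) \<and> S x 0 = g0 \<and> S x 1 = x" by blast
  define H where "H x = angle_incr (u \<circ> S x)" for x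
  have lift: "u x = cis (H x)" if x: "x \<in> R" for x
  proof -
    obtain h where h: "\<And>t. t \<in> {0..1} \<Longrightarrow> u (S x t) = cis (h t)" "angle_incr (u \<circ> S x) = h 1 - h 0"
      using circle_map_path_lift[OF u isometric_path_imp_pathin] S[OF x] by metis
    have "cis (h 0) = 1" using h(1)[of 0] S[OF x] u1[OF g0(1)] by simp
    then have "cis (h 1 - h 0) = cis (h 1)" by (simp flip: cis_divide)
    then show ?thesis using h(1)[of 1] h(2) S[OF x] by (simp add: H_def)
  qed
  have diff: "H y - H x = angle_incr (u \<circ> \<tau>)"
    if xy: "x \<in> R" "y \<in> R" and \<tau>: "isometric_path R d \<tau>" "\<tau> 0 = x" "\<tau> 1 = y" for x y \<tau>
  proof -
    have "lifts_on mtopology u G" unfolding lifts_on_def using u1 by (intro exI[of _ "\<lambda>_. 0"]) simp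
    moreover have "S x 0 \<in> G" using S[OF xy(1)] g0 by simp
    ultimately obtain \<Delta>1 where 1: "arc_complex mtopology k \<Delta>1" "G \<subseteq> \<Delta>1" "S x ` {0..1} \<subseteq> \<Delta>1"
      "lifts_on mtopology u \<Delta>1"
      using absorb_isometric_path[OF u complex, of "S x"] S[OF xy(1)] by blast
    have "S y 0 \<in> \<Delta>1" using S[OF xy(2)] g0 1(2) by auto
    then obtain \<Delta>2 where 2: "arc_complex mtopology k \<Delta>2" "\<Delta>1 \<subseteq> \<Delta>2" "S y ` {0..1} \<subseteq> \<Delta>2" "lifts_on mtopology u \<Delta>2"
      using absorb_isometric_path[OF u 1(1), of "S y"] S[OF xy(2)] 1(4) by blast
    have "\<tau> 0 \<in> S x ` {0..1}" using \<tau>(2) S[OF xy(1)] by (auto intro!: image_eqI[of _ _ 1])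
    then have "\<tau> 0 \<in> \<Delta>2" using 1(3) 2(2) by blast
    then obtain \<Delta> where D: "arc_complex mtopology k \<Delta>" "\<Delta>2 \<subseteq> \<Delta>" "\<tau> ` {0..1} \<subseteq> \<Delta>" "lifts_on mtopology u \<Delta>"
      using absorb_isometric_path[OF u 2(1) \<tau>(1) _ 2(4)] by blast
    then obtain h where \<Delta>: "arc_complex mtopology k \<Delta>" "\<Delta>2 \<subseteq> \<Delta>" "\<tau> ` {0..1} \<subseteq> \<Delta>"
      "continuous_map (subtopology mtopology \<Delta>) euclideanreal h" "\<And>x. x \<in> \<Delta> \<Longrightarrow> u x = cis (h x)"
      by (auto simp: lifts_on_def)
    have inc: "angle_incr (u \<circ> g) = h (g 1) - h (g 0)" if "isometric_path R d g" "g ` {0..1} \<subseteq> \<Delta>" for g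
      using angle_incr_in_lifted_set[OF isometric_path_imp_pathin[OF that(1)] that(2) \<Delta>(4,5)] .
    have "H x = h x - h g0" unfolding H_def using inc[of "S x"] S[OF xy(1)] 1(3) 2(2) \<Delta>(2) by auto
    moreover have "H y = h y - h g0" unfolding H_def using inc[of "S y"] S[OF xy(2)] 2(3) \<Delta>(2) by auto
    moreover have "angle_incr (u \<circ> \<tau>) = h y - h x" using inc[OF \<tau>(1) \<Delta>(3)] \<tau> by simp
    ultimately show ?thesis by simp
  qed
  have contu: "continuous_map mtopology euclidean u" and nu: "\<And>x. x \<in> R \<Longrightarrow> norm (u x) = 1"
    using u by (auto simp: circle_map_def)
  have "continuous_map mtopology Met_TC.mtopology H"
    unfolding metric_continuous_map[OF Met_TC.Metric_space_axioms]
  proof (intro conjI ballI allI impI)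
    fix x and e :: real assume x: "x \<in> R" and e: "e > 0"
    \<comment> \<open>along a short geodesic the increment is the principal argument of the quotient of the values, which is small\<close>
    have "isCont Arg 1" by (rule continuous_at_Arg) (simp add: complex_nonpos_Reals_iff)
    then obtain \<delta> where \<delta>: "\<delta> > 0" "\<And>v. dist v 1 < \<delta> \<Longrightarrow> dist (Arg v) (Arg 1) < e"
      using e unfolding continuous_at_eps_delta by blast
    have "continuous_map mtopology Met_TC.mtopology u" using contu by simp
    then obtain r where r: "r > 0" "\<And>y. y \<in> R \<Longrightarrow> d x y < r \<Longrightarrow> dist (u x) (u y) < min \<delta> 1"
      using x \<delta>(1) unfolding metric_continuous_map[OF Met_TC.Metric_space_axioms]
      by (metis min_less_iff_conj zero_less_one)
    have "dist (H x) (H y) < e" if y: "y \<in> R" "d x y < r" for y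
    proof -
      obtain \<tau> where \<tau>: "isometric_path R d \<tau>" "\<tau> 0 = x" "\<tau> 1 = y" using isometric_path_exists x y(1) by blast
      have p: "pathin mtopology \<tau>" using isometric_path_imp_pathin[OF \<tau>(1)] .
      have "continuous_map (top_of_set {0..1}) euclidean (u \<circ> \<tau>)"
        using p contu unfolding pathin_def by (rule continuous_map_compose)
      then have c: "continuous_on {0..1} (u \<circ> \<tau>)" by simp
      have \<tau>R: "\<tau> t \<in> R" if "t \<in> {0..1}" for t using \<tau>(1) that by (auto simp: isometric_path_def)
      have near: "d x (\<tau> t) < r" if t: "t \<in> {0..1}" for t
      proof -
        have "d (\<tau> 0) (\<tau> t) = d (\<tau> 0) (\<tau> 1) * \<bar>0 - t\<bar>"
          using \<tau>(1) t unfolding isometric_path_def by (metis atLeastAtMost_iff order_refl zero_le_one)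
        also have "\<dots> \<le> d (\<tau> 0) (\<tau> 1)" using t by (auto simp: mult_left_le)
        finally show ?thesis using \<tau> y(2) by simp
      qed
      have "angle_incr (u \<circ> \<tau>) = Arg ((u \<circ> \<tau>) 1 / (u \<circ> \<tau>) 0)"
      proof (rule angle_incr_short[OF c])
        fix t :: real assume t: "t \<in> {0..1}"
        show "norm ((u \<circ> \<tau>) t) = 1" using nu \<tau>R[OF t] by simp
        show "norm ((u \<circ> \<tau>) t - (u \<circ> \<tau>) 0) < 1"
          using r(2)[OF \<tau>R[OF t] near[OF t]] \<tau>(2) by (simp add: dist_norm norm_minus_commute)
      qed
      then have "H y - H x = Arg (u y / u x)" using diff[OF x y(1) \<tau>] \<tau> by simp
      moreover have "dist (u y / u x) 1 < \<delta>"
      proof -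
        have "u x \<noteq> 0" using nu[OF x] by auto
        then have "u y / u x - 1 = (u y - u x) / u x" by (simp add: diff_divide_distrib)
        then have "dist (u y / u x) 1 = norm (u y - u x)" using nu[OF x] by (simp add: dist_norm norm_divide)
        also have "\<dots> < \<delta>" using r(2)[OF y] by (simp add: dist_norm norm_minus_commute)
        finally show ?thesis .
      qed
      ultimately show ?thesis using \<delta>(2) by (fastforce simp: dist_real_def abs_minus_commute)
    qed
    then show "\<exists>\<delta>>0. \<forall>y. y \<in> R \<and> d x y < \<delta> \<longrightarrow> dist (H x) (H y) < e" using r(1) by blast
  qed simp
  then show ?thesis using that[of H] lift by simp
qed

end

section \<open>Collapsing a closed subset of a metric space\<close>

lemma isometric_path_dist:
  "isometric_path M d \<sigma> \<Longrightarrow> s \<in> {0..1} \<Longrightarrow> t \<in> {0..1} \<Longrightarrow> d (\<sigma> s) (\<sigma> t) = d (\<sigma> 0) (\<sigma> 1) * \<bar>s - t\<bar>"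
  unfolding isometric_path_def by blast

locale collapse = Metric_space Z d for Z :: "'b set" and d +
  fixes A :: "'b set"
  assumes compact: "compact_space mtopology" and closed: "closedin mtopology A" and nonempty: "A \<noteq> {}"
begin

definition dA :: "'b \<Rightarrow> real" where "dA x = (INF a\<in>A. d x a)"

lemma A_subset: "A \<subseteq> Z"
  using closed closedin_subset by fastforce

lemma dA_attained: assumes "x \<in> Z" obtains a where "a \<in> A" "dA x = d x a"
proof -
  have "compactin mtopology A" using compact closed closedin_compact_space by blast
  then obtain a where a: "a \<in> A" "\<forall>y\<in>A. d x a \<le> d x y"
    using compact_attains_min[OF _ nonempty continuous_map_dist_point[OF assms]] by blast
  then have "dA x = d x a" unfolding dA_def by (intro cInf_eq_minimum) auto
  then show ?thesis using that a by blast
qed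

lemma dA_le: "x \<in> Z \<Longrightarrow> a \<in> A \<Longrightarrow> dA x \<le> d x a"
  unfolding dA_def by (rule cINF_lower) (auto intro: bdd_belowI[of _ 0])

lemma dA_nonneg: "x \<in> Z \<Longrightarrow> 0 \<le> dA x"
  using dA_attained by (metis nonneg)

lemma dA_triangle: assumes "x \<in> Z" "y \<in> Z" shows "dA x \<le> d x y + dA y"
proof -
  obtain a where a: "a \<in> A" "dA y = d y a" using dA_attained[OF assms(2)] by blast
  have "dA x \<le> d x a" using dA_le[OF assms(1) a(1)] .
  also have "\<dots> \<le> d x y + d y a" using triangle assms a(1) A_subset by blast
  finally show ?thesis using a by simp
qed

lemma dA_zero_iff: assumes "x \<in> Z" shows "dA x = 0 \<longleftrightarrow> x \<in> A"
proof
  assume "dA x = 0"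
  then obtain a where "a \<in> A" "d x a = 0" using dA_attained[OF assms] by metis
  then show "x \<in> A" using assms A_subset zero by blast
next
  assume "x \<in> A"
  then have "dA x \<le> 0" using dA_le[OF assms, of x] assms by simp
  then show "dA x = 0" using dA_nonneg[OF assms] by simp
qed

abbreviation "gd \<equiv> glue_dist Z d A"
abbreviation "\<pi> \<equiv> glue_class Z d A"
abbreviation "T \<equiv> glue_space Z d A"
abbreviation "td \<equiv> glue_metric Z d A"

lemma chain_bound:
  assumes x: "x \<in> Z"
  shows "1 \<le> n \<Longrightarrow> (\<forall>i\<in>{1..n}. p i \<in> Z \<and> q i \<in> Z) \<Longrightarrow> p 1 = x \<Longrightarrow> (\<forall>i\<in>{1..<n}. identified A (q i) (p (Suc i)))
    \<Longrightarrow> min (d x (q n)) (dA x + dA (q n)) \<le> (\<Sum>i=1..n. d (p i) (q i))"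
proof (induction n rule: nat_induct_at_least)
  case base
  then show ?case by simp
next
  case (Suc n)
  let ?y = "q n" and ?p = "p (Suc n)" and ?z = "q (Suc n)"
  have Z: "?y \<in> Z" "?p \<in> Z" "?z \<in> Z" using Suc.prems(1) Suc.hyps by auto
  have IH: "min (d x ?y) (dA x + dA ?y) \<le> (\<Sum>i=1..n. d (p i) (q i))"
    using Suc.IH Suc.prems by simp
  have id: "identified A ?y ?p" using Suc.prems(3) Suc.hyps by auto
  have "min (d x ?z) (dA x + dA ?z) \<le> min (d x ?y) (dA x + dA ?y) + d ?p ?z"
  proof (cases "?y = ?p")
    case True
    then show ?thesis
      using triangle[OF x Z(1) Z(3)] dA_triangle[OF Z(3) Z(1)] commute[of ?y ?z] by (simp add: min_def split: if_splits)
  next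
    case False
    then have A: "?y \<in> A" "?p \<in> A" using id by (auto simp: identified_def)
    have "dA ?y = 0" "dA ?p = 0" using A dA_zero_iff Z by auto
    moreover have "dA x \<le> d x ?y" using dA_le[OF x A(1)] .
    moreover have "dA ?z \<le> d ?p ?z" using dA_le[OF Z(3) A(2)] commute by simp
    ultimately show ?thesis by (simp add: min_def)
  qed
  also have "\<dots> \<le> (\<Sum>i=1..Suc n. d (p i) (q i))" using IH by simp
  finally show ?case .
qed

text \<open>A chain that uses the identification at all is at least as long as the way from \<open>x\<close> to \<open>A\<close> plus
  the way from \<open>A\<close> to \<open>y\<close>; otherwise the triangle inequality collapses it to a single step.\<close>

lemma glue_dist_eq:
  assumes "x \<in> Z" "y \<in> Z" shows "gd x y = min (d x y) (dA x + dA y)"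
proof -
  let ?S = "{(\<Sum>i=1..n. d (p i) (q i)) | (n::nat) p q.
       1 \<le> n \<and> (\<forall>i\<in>{1..n}. p i \<in> Z \<and> q i \<in> Z) \<and> p 1 = x \<and> q n = y \<and>
       (\<forall>i\<in>{1..<n}. identified A (q i) (p (Suc i)))}"
  have lower: "min (d x y) (dA x + dA y) \<le> s" if "s \<in> ?S" for s
    using that chain_bound[OF assms(1)] by auto
  have bdd: "bdd_below ?S" using lower by (meson bdd_belowI)
  have 1: "d x y \<in> ?S"
    using assms by (intro CollectI exI[of _ 1] exI[of _ "\<lambda>_. x"] exI[of _ "\<lambda>_. y"]) auto
  have 2: "dA x + dA y \<in> ?S"
  proof -
    obtain a b where ab: "a \<in> A" "dA x = d x a" "b \<in> A" "dA y = d y b" using dA_attained assms by metis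
    have Z: "a \<in> Z" "b \<in> Z" using ab A_subset by auto
    \<comment> \<open>two steps: from \<open>x\<close> to its nearest point of \<open>A\<close>, then from the point of \<open>A\<close> nearest to \<open>y\<close> to \<open>y\<close>\<close>
    define p where "p i = (if i = 1 then x else b)" for i :: nat
    define q where "q i = (if i = 1 then a else y)" for i :: nat
    have "{1..2::nat} = {1, 2}" "{1..<2::nat} = {1}" by auto
    then have "(\<Sum>i=1..2. d (p i) (q i)) = dA x + dA y" "\<forall>i\<in>{1..<2}. identified A (q i) (p (Suc i))"
      "\<forall>i\<in>{1..2}. p i \<in> Z \<and> q i \<in> Z"
      using ab Z assms commute[of b y] by (auto simp: p_def q_def identified_def)
    then show ?thesis by (intro CollectI exI[of _ 2] exI[of _ p] exI[of _ q]) (auto simp: p_def q_def)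
  qed
  have "Inf ?S \<le> min (d x y) (dA x + dA y)" using cInf_lower[OF 1 bdd] cInf_lower[OF 2 bdd] by simp
  moreover have "min (d x y) (dA x + dA y) \<le> Inf ?S" using 1 lower by (intro cInf_greatest) auto
  ultimately have "Inf ?S = min (d x y) (dA x + dA y)" by linarith
  moreover have "gd x y = Inf ?S" using assms unfolding glue_dist_def by (simp only: if_True simp_thms)
  ultimately show ?thesis by linarith
qed

lemma glue_dist_nonneg: "0 \<le> gd x y"
proof (cases "x \<in> Z \<and> y \<in> Z")
  case True
  then show ?thesis using glue_dist_eq dA_nonneg[of x] dA_nonneg[of y] by auto
next
  case False
  then show ?thesis by (auto simp: glue_dist_def)
qed

lemma glue_dist_commute: "gd x y = gd y x"
proof (cases "x \<in> Z \<and> y \<in> Z")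
  case True
  then show ?thesis using glue_dist_eq commute[of x y] by (simp add: add.commute)
next
  case False
  then show ?thesis by (auto simp: glue_dist_def)
qed

lemma glue_dist_le: "x \<in> Z \<Longrightarrow> y \<in> Z \<Longrightarrow> gd x y \<le> d x y"
  by (simp add: glue_dist_eq)

lemma glue_dist_triangle:
  assumes "x \<in> Z" "y \<in> Z" "z \<in> Z" shows "gd x z \<le> gd x y + gd y z"
  unfolding glue_dist_eq[OF assms(1,3)] glue_dist_eq[OF assms(1,2)] glue_dist_eq[OF assms(2,3)]
  using triangle[OF assms] dA_triangle[OF assms(1,2)] dA_triangle[OF assms(3,2)] commute[of z y]
    dA_nonneg[OF assms(1)] dA_nonneg[OF assms(2)] dA_nonneg[OF assms(3)]
  by (simp add: min_def split: if_splits)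

lemma glue_dist_zero_iff:
  assumes "x \<in> Z" "y \<in> Z" shows "gd x y = 0 \<longleftrightarrow> x = y \<or> x \<in> A \<and> y \<in> A"
proof -
  have "min (d x y) (dA x + dA y) = 0 \<longleftrightarrow> d x y = 0 \<or> dA x + dA y = 0"
    using nonneg[of x y] dA_nonneg[OF assms(1)] dA_nonneg[OF assms(2)] unfolding min_def by (smt (verit))
  moreover have "dA x + dA y = 0 \<longleftrightarrow> x \<in> A \<and> y \<in> A"
    using dA_nonneg[OF assms(1)] dA_nonneg[OF assms(2)] dA_zero_iff assms by (metis add_nonneg_eq_0_iff)
  ultimately show ?thesis using assms by (simp add: glue_dist_eq)
qed

lemma glue_class_eq: "x \<in> Z \<Longrightarrow> \<pi> x = (if x \<in> A then A else {x})"
  unfolding glue_class_def using glue_dist_zero_iff A_subset by auto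

lemma glue_class_eq_iff: "x \<in> Z \<Longrightarrow> y \<in> Z \<Longrightarrow> \<pi> x = \<pi> y \<longleftrightarrow> x = y \<or> x \<in> A \<and> y \<in> A"
  by (auto simp: glue_class_eq split: if_splits)

lemma glue_metric_class: assumes "x \<in> Z" "y \<in> Z" shows "td (\<pi> x) (\<pi> y) = gd x y"
proof -
  have rep: "(SOME z. z \<in> \<pi> w) \<in> Z" "gd w (SOME z. z \<in> \<pi> w) = 0" if "w \<in> Z" for w
  proof -
    have "w \<in> \<pi> w" using that glue_dist_zero_iff by (simp add: glue_class_def)
    then have "(SOME z. z \<in> \<pi> w) \<in> \<pi> w" by (rule someI)
    then show "(SOME z. z \<in> \<pi> w) \<in> Z" "gd w (SOME z. z \<in> \<pi> w) = 0" by (auto simp: glue_class_def)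
  qed
  let ?x = "SOME z. z \<in> \<pi> x" and ?y = "SOME z. z \<in> \<pi> y"
  have "gd ?x ?y = gd x y"
    using glue_dist_triangle[of ?x x ?y] glue_dist_triangle[of x y ?y] glue_dist_triangle[of x ?x y] glue_dist_triangle[of ?x ?y y]
      rep[OF assms(1)] rep[OF assms(2)] assms glue_dist_commute[of x ?x] glue_dist_commute[of y ?y] by simp
  then show ?thesis by (simp add: glue_metric_def)
qed

lemma glue_spaceE: "C \<in> T \<Longrightarrow> \<exists>x. x \<in> Z \<and> C = \<pi> x"
  by (auto simp: glue_space_def)

lemma class_in_glue_space [simp]: "x \<in> Z \<Longrightarrow> \<pi> x \<in> T"
  by (simp add: glue_space_def)

lemma Metric_space_glue: "Metric_space T td"
proof
  show "0 \<le> td C D" for C D by (simp add: glue_metric_def glue_dist_nonneg)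
  show "td C D = td D C" for C D unfolding glue_metric_def by (rule glue_dist_commute)
  fix C D assume "C \<in> T" "D \<in> T"
  then obtain x y where "x \<in> Z" "C = \<pi> x" "y \<in> Z" "D = \<pi> y" using glue_spaceE by meson
  then show "td C D = 0 \<longleftrightarrow> C = D"
    by (simp add: glue_metric_class glue_dist_zero_iff glue_class_eq_iff)
next
  fix C D E assume "C \<in> T" "D \<in> T" "E \<in> T"
  then obtain x y z where "x \<in> Z" "C = \<pi> x" "y \<in> Z" "D = \<pi> y" "z \<in> Z" "E = \<pi> z" using glue_spaceE by meson
  then show "td C E \<le> td C D + td D E" by (simp add: glue_metric_class glue_dist_triangle)
qed

sublocale GM: Metric_space T td by (rule Metric_space_glue)

lemma image_class: "\<pi> ` Z = T"
  by (simp add: glue_space_def)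

lemma continuous_class: "continuous_map mtopology GM.mtopology \<pi>"
  unfolding metric_continuous_map[OF Metric_space_glue]
proof (intro conjI ballI allI impI)
  fix a and e :: real assume a: "a \<in> Z" and e: "e > 0"
  have "td (\<pi> a) (\<pi> x) < e" if "x \<in> Z" "d a x < e" for x
    using glue_dist_le[OF a that(1)] that a by (simp add: glue_metric_class)
  then show "\<exists>\<delta>>0. \<forall>x. x \<in> Z \<and> d a x < \<delta> \<longrightarrow> td (\<pi> a) (\<pi> x) < e" using e by blast
qed auto

lemma quotient_class: "quotient_map mtopology GM.mtopology \<pi>"
  by (rule continuous_imp_quotient_map[OF continuous_class compact GM.Hausdorff_space_mtopology])
    (use image_class in simp)

lemma compact_glue: "compact_space GM.mtopology"
proof -
  have "compactin GM.mtopology (\<pi> ` topspace mtopology)"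
    using compact continuous_class image_compactin unfolding compact_space_def by blast
  then show ?thesis using image_class by (simp add: compact_space_def)
qed

text \<open>If the shortest connection passes through \<open>A\<close>, its midpoint lies on the longer of the two ways to
  \<open>A\<close>.\<close>

lemma glue_midpoint_through_A:
  assumes iso: "\<And>x y. x \<in> Z \<Longrightarrow> y \<in> Z \<Longrightarrow> \<exists>\<sigma>. isometric_path Z d \<sigma> \<and> \<sigma> 0 = x \<and> \<sigma> 1 = y"
    and xy: "x \<in> Z" "y \<in> Z" "dA y \<le> dA x"
  shows "\<exists>m\<in>Z. gd x m \<le> (dA x + dA y) / 2 \<and> gd m y \<le> (dA x + dA y) / 2"
proof (cases "dA x = 0")
  case True
  then have "dA x + dA y = 0" using xy dA_nonneg[OF xy(2)] by simp
  then have "gd x y \<le> 0" "gd x x \<le> 0" using xy by (auto simp: glue_dist_eq)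
  then show ?thesis using xy(1) \<open>dA x + dA y = 0\<close> by (intro bexI[of _ x]) auto
next
  case False
  obtain a where a: "a \<in> A" "dA x = d x a" using dA_attained[OF xy(1)] by blast
  have aZ: "a \<in> Z" using a A_subset by blast
  obtain \<sigma> where \<sigma>: "isometric_path Z d \<sigma>" "\<sigma> 0 = x" "\<sigma> 1 = a" using iso[OF xy(1) aZ] by blast
  define t where "t = (dA x + dA y) / 2 / dA x"
  have dx: "dA x > 0" using False dA_nonneg[OF xy(1)] by simp
  have t: "t \<in> {0..1}" using dx xy dA_nonneg[OF xy(2)] by (auto simp: t_def field_simps)
  have \<sigma>t: "\<sigma> t \<in> Z" using \<sigma>(1) t by (auto simp: isometric_path_def)
  have "d (\<sigma> 0) (\<sigma> t) = d (\<sigma> 0) (\<sigma> 1) * \<bar>0 - t\<bar>" "d (\<sigma> t) (\<sigma> 1) = d (\<sigma> 0) (\<sigma> 1) * \<bar>t - 1\<bar>"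
    using t by (intro isometric_path_dist[OF \<sigma>(1)]; simp)+
  then have d: "d x (\<sigma> t) = dA x * t" "d (\<sigma> t) a = dA x * (1 - t)" using \<sigma> a t by auto
  have "dA x * t = (dA x + dA y) / 2" using dx by (simp add: t_def)
  then have "gd x (\<sigma> t) \<le> (dA x + dA y) / 2" using glue_dist_le[OF xy(1) \<sigma>t] d by simp
  moreover have "gd (\<sigma> t) y \<le> (dA x + dA y) / 2"
  proof -
    have "gd (\<sigma> t) y \<le> dA (\<sigma> t) + dA y" using \<sigma>t xy by (simp add: glue_dist_eq)
    also have "\<dots> \<le> d (\<sigma> t) a + dA y" using dA_le[OF \<sigma>t a(1)] by simp
    also have "\<dots> = (dA x + dA y) / 2" using d \<open>dA x * t = (dA x + dA y) / 2\<close> by (simp add: algebra_simps)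
    finally show ?thesis .
  qed
  ultimately show ?thesis using \<sigma>t by blast
qed

lemma glue_isometric_path:
  assumes iso: "\<And>x y. x \<in> Z \<Longrightarrow> y \<in> Z \<Longrightarrow> \<exists>\<sigma>. isometric_path Z d \<sigma> \<and> \<sigma> 0 = x \<and> \<sigma> 1 = y"
    and CD: "C \<in> T" "D \<in> T"
  shows "\<exists>\<sigma>. isometric_path T td \<sigma> \<and> \<sigma> 0 = C \<and> \<sigma> 1 = D"
proof (rule GM.isometric_path_if_midpoints[OF compact_glue _ CD])
  fix C D assume CD: "C \<in> T" "D \<in> T"
  then obtain x y where xy: "x \<in> Z" "C = \<pi> x" "y \<in> Z" "D = \<pi> y" using glue_spaceE by meson
  have "\<exists>m\<in>Z. gd x m \<le> gd x y / 2 \<and> gd m y \<le> gd x y / 2"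
  proof (cases "d x y \<le> dA x + dA y")
    case True
    obtain \<sigma> where \<sigma>: "isometric_path Z d \<sigma>" "\<sigma> 0 = x" "\<sigma> 1 = y" using iso[OF xy(1,3)] by blast
    have h: "\<sigma> (1/2) \<in> Z" using \<sigma>(1) by (auto simp: isometric_path_def)
    have "d (\<sigma> 0) (\<sigma> (1/2)) = d (\<sigma> 0) (\<sigma> 1) * \<bar>0 - 1/2\<bar>" "d (\<sigma> (1/2)) (\<sigma> 1) = d (\<sigma> 0) (\<sigma> 1) * \<bar>1/2 - 1\<bar>"
      by (rule isometric_path_dist[OF \<sigma>(1)]; simp)+
    then have "d x (\<sigma> (1/2)) = d x y / 2" "d (\<sigma> (1/2)) y = d x y / 2" using \<sigma> by auto
    moreover have "gd x y = d x y" using True xy by (simp add: glue_dist_eq)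
    ultimately show ?thesis using glue_dist_le[OF xy(1) h] glue_dist_le[OF h xy(3)] h by (intro bexI[of _ "\<sigma> (1/2)"]) auto
  next
    case False
    then have g: "gd x y = dA x + dA y" using xy by (simp add: glue_dist_eq)
    show ?thesis
    proof (cases "dA y \<le> dA x")
      case True
      then show ?thesis using glue_midpoint_through_A[OF iso xy(1,3)] g by simp
    next
      case False
      then have "dA x \<le> dA y" by simp
      from glue_midpoint_through_A[OF iso xy(3,1) this] obtain m where
        "m \<in> Z" "gd y m \<le> (dA y + dA x) / 2" "gd m x \<le> (dA y + dA x) / 2" by blast
      then show ?thesis using g glue_dist_commute[of y m] glue_dist_commute[of m x] by (intro bexI[of _ m]) (auto simp: add.commute)
    qed
  qed
  then obtain m where m: "m \<in> Z" "gd x m \<le> gd x y / 2" "gd m y \<le> gd x y / 2" by blast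
  then have "gd x m = gd x y / 2" "gd m y = gd x y / 2"
    using glue_dist_triangle[OF xy(1) m(1) xy(3)] by auto
  then show "\<exists>E\<in>T. td C E = td C D / 2 \<and> td E D = td C D / 2"
    using xy m(1) by (intro bexI[of _ "\<pi> m"]) (auto simp: glue_metric_class)
qed

end

section \<open>The quotient by an arc complex of greatest rank\<close>

lemma subinterval_avoiding_point:
  fixes s t z :: real assumes "s < t"
  shows "\<exists>a b. s < a \<and> a < b \<and> b < t \<and> z \<notin> {a..b}"
proof (cases "z \<le> (s + t) / 2")
  case True
  then show ?thesis using assms by (intro exI[of _ "(s + 2 * t) / 3"] exI[of _ "(s + 5 * t) / 6"]) (auto simp: field_simps)
next
  case False
  then show ?thesis using assms by (intro exI[of _ "(2 * s + t) / 3"] exI[of _ "(s + t) / 2"]) (auto simp: field_simps)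
qed

context maximal_arc_complex
begin

sublocale collapse: collapse R d G
proof
  show "compact_space mtopology" by (rule compact)
  show "closedin mtopology G" using arc_complex_closed[OF complex] .
  show "G \<noteq> {}" using arc_complex_topology(2)[OF complex] .
qed

abbreviation "tree_top \<equiv> collapse.GM.mtopology"
abbreviation "cl \<equiv> glue_class R d G"

lemma G_subset: "G \<subseteq> R"
  using arc_complex_topology(1)[OF complex] by simp

text \<open>The lift takes values in the multiples of \<open>2 * pi\<close> on \<open>G\<close>, and \<open>G\<close> is path-connected.\<close>

lemma lift_constant_on_G:
  assumes h: "continuous_map mtopology euclideanreal h" "\<And>x. x \<in> R \<Longrightarrow> u x = cis (h x)"
    and u: "\<And>x. x \<in> G \<Longrightarrow> u x = 1" and xy: "x \<in> G" "y \<in> G"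
  shows "h x = h y"
proof -
  have top: "topspace (subtopology mtopology G) = G" using G_subset by auto
  obtain g where g: "pathin (subtopology mtopology G) g" "g 0 = x" "g 1 = y"
    using arc_complex_topology(4)[OF complex] top xy
    unfolding path_connectedin_def path_connected_space_def by blast
  have gG: "g t \<in> G" if "t \<in> {0..1}" for t using pathin_in_topspace[OF g(1) that] top by simp
  have "pathin mtopology g" using g(1) by (simp add: pathin_subtopology)
  then have "continuous_map (top_of_set {0..1}) euclideanreal (h \<circ> g)"
    using h(1) unfolding pathin_def by (rule continuous_map_compose)
  then have c: "continuous_on {0..1} (h \<circ> g)" by simp
  have e: "cis ((h \<circ> g) t) = cis ((\<lambda>_. 0) t)" if t: "t \<in> {0..1}" for t
  proof -
    have "g t \<in> G" by (rule gG[OF t])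
    then show ?thesis using h(2)[of "g t"] u[of "g t"] G_subset by auto
  qed
  have "(h \<circ> g) 0 - (h \<circ> g) 1 = (\<lambda>_. 0) 0 - (\<lambda>_. 0) (1::real)"
    by (rule circle_lift_unique[OF connected_Icc c continuous_on_const e]) auto
  then show ?thesis using g by simp
qed

text \<open>Suppose \<open>\<gamma>\<close> leaves the image \<open>K\<close> of \<open>\<delta>\<close>. A piece of \<open>\<gamma>\<close> off \<open>K\<close> that avoids the point \<open>G\<close> of the
  quotient lifts homeomorphically to an arc in \<open>R\<close>, as the projection is injective off \<open>G\<close>. Some circle-valued map
  winds along a part \<open>g\<close> of this arc and is \<open>1\<close> on \<open>G\<close>, over \<open>K\<close> and over the remainder of \<open>\<gamma>\<close>. Its
  real lift exists by maximality of \<open>G\<close> and descends to the quotient. Being locally constant over \<open>K\<close> and the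
  remainder of \<open>\<gamma>\<close>, it has equal values at the two ends of \<open>g\<close>, whereas the winding along \<open>g\<close> is not
  zero.\<close>

lemma simple_path_image_subset:
  assumes \<gamma>: "pathin tree_top \<gamma>" "inj_on \<gamma> {0..1}" and \<delta>: "pathin tree_top \<delta>"
    and ends: "\<gamma> 0 = \<delta> 0" "\<gamma> 1 = \<delta> 1"
  shows "\<gamma> ` {0..1} \<subseteq> \<delta> ` {0..1}"
proof (rule ccontr)
  let ?I = "{0..1::real}"
  note HT = collapse.GM.Hausdorff_space_mtopology
  assume "\<not> \<gamma> ` ?I \<subseteq> \<delta> ` ?I"
  then obtain t0 where t0: "t0 \<in> ?I" "\<gamma> t0 \<notin> \<delta> ` ?I" by blast
  have closed_sub: "closedin tree_top (\<zeta> ` {x..y})" if "pathin tree_top \<zeta>" "0 \<le> x" "y \<le> 1" for \<zeta> x y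
  proof (rule compactin_imp_closedin[OF HT], rule image_compactin)
    show "compactin (top_of_set ?I) {x..y}" using that by (simp add: compactin_subtopology)
    show "continuous_map (top_of_set ?I) tree_top \<zeta>" using that(1) by (simp add: pathin_def)
  qed
  let ?K = "\<delta> ` ?I"
  have K: "closedin tree_top ?K" by (rule closed_sub[OF \<delta>]) auto
  let ?P = "{t \<in> ?I. \<gamma> t \<in> ?K}"
  have "0 \<in> ?P" "1 \<in> ?P" "t0 \<notin> ?P" using ends t0 by auto
  moreover have "0 \<le> t0" "t0 \<le> 1" using t0 by auto
  ultimately obtain s t where st: "0 \<le> s" "s < t0" "t0 < t" "t \<le> 1" "{s<..<t} \<inter> ?P = {}"
    using gap_interval[OF closed_path_preimage[OF \<gamma>(1) K], of 0 1 t0] by blast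
  have offK: "\<gamma> r \<notin> ?K" if "r \<in> {s<..<t}" for r
  proof -
    have "r \<in> ?I" "r \<notin> ?P" using that st by (auto simp del: mem_Collect_eq)
    then show ?thesis by blast
  qed
  \<comment> \<open>the class of the points of \<open>G\<close> is the set \<open>G\<close> itself, and the simple path \<open>\<gamma>\<close> visits it at most once\<close>
  obtain a b where ab: "s < a" "a < b" "b < t" "\<And>r. r \<in> {a..b} \<Longrightarrow> \<gamma> r \<noteq> G"
  proof (cases "\<exists>z\<in>?I. \<gamma> z = G")
    case True
    then obtain z where z: "z \<in> ?I" "\<gamma> z = G" by blast
    obtain a b where ab: "s < a" "a < b" "b < t" "z \<notin> {a..b}" using subinterval_avoiding_point[of s t z] st by auto
    have "\<gamma> r \<noteq> G" if r: "r \<in> {a..b}" for r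
    proof
      assume "\<gamma> r = G"
      moreover have "r \<in> ?I" using r ab st by auto
      ultimately have "r = z" using inj_onD[OF \<gamma>(2), of r z] z by simp
      then show False using r ab by simp
    qed
    then show ?thesis using that ab by blast
  next
    case False
    obtain a b where ab: "s < a" "a < b" "b < t" using subinterval_avoiding_point[of s t 0] st by auto
    then have "r \<in> ?I" if "r \<in> {a..b}" for r using that st by auto
    then show ?thesis using that[of a b] ab False by blast
  qed
  have ab01: "0 \<le> a" "b \<le> 1" "a \<in> ?I" "b \<in> ?I" using ab st by auto
  have offG: "x \<notin> G" if "x \<in> R" "cl x = \<gamma> r" "r \<in> {a..b}" for x r
    using ab(4)[OF that(3)] that collapse.glue_class_eq[of x] by auto
  let ?A = "\<gamma> ` {a..b}"
  have clA: "closedin tree_top ?A" using closed_sub[OF \<gamma>(1) ab01(1,2)] .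
  define L where "L = {x \<in> topspace mtopology. cl x \<in> ?A}"
  have clL: "closedin mtopology L"
    unfolding L_def by (rule closedin_continuous_map_preimage[OF collapse.continuous_class clA])
  have "homeomorphic_map (subtopology mtopology L) (subtopology tree_top ?A) cl"
  proof (rule continuous_imp_homeomorphic_map)
    show "continuous_map (subtopology mtopology L) (subtopology tree_top ?A) cl"
      using collapse.continuous_class by (auto simp: continuous_map_in_subtopology continuous_map_from_subtopology L_def)
    show "compact_space (subtopology mtopology L)"
      using clL compact closedin_compact_space compact_space_subtopology by blast
    show "Hausdorff_space (subtopology tree_top ?A)" using HT Hausdorff_space_subtopology by blast
    have AT: "?A \<subseteq> glue_space R d G" using closedin_subset[OF clA] by simp
    show "cl ` topspace (subtopology mtopology L) = topspace (subtopology tree_top ?A)"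
      using AT collapse.glue_spaceE by (fastforce simp: L_def)
    show "inj_on cl (topspace (subtopology mtopology L))"
    proof (rule inj_onI)
      fix x y assume xy: "x \<in> topspace (subtopology mtopology L)" "y \<in> topspace (subtopology mtopology L)" "cl x = cl y"
      then have R: "x \<in> R" "y \<in> R" and "cl x \<in> ?A" by (auto simp: L_def)
      then have "x \<notin> G" using offG by auto
      then show "x = y" using collapse.glue_class_eq_iff[OF R] xy(3) by blast
    qed
  qed
  then obtain r where r: "homeomorphic_maps (subtopology mtopology L) (subtopology tree_top ?A) cl r"
    by (auto simp: homeomorphic_map_maps)
  have topA: "topspace (subtopology tree_top ?A) = ?A" using closedin_subset[OF clA] by auto
  have rc: "continuous_map (subtopology tree_top ?A) (subtopology mtopology L) r" and
    rcl: "\<And>C. C \<in> ?A \<Longrightarrow> cl (r C) = C" using r topA by (auto simp: homeomorphic_maps_def)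
  define g0 where "g0 = r \<circ> (\<gamma> \<circ> seg a b)"
  have segab: "seg a b v \<in> {a..b}" if "v \<in> ?I" for v using seg_in_convex[of "{a..b}" a b v] that ab by auto
  have "pathin tree_top (\<gamma> \<circ> seg a b)" using \<gamma>(1) ab01 by (auto simp: pathin_def intro!: pathin_seg[unfolded pathin_def])
  then have "continuous_map (top_of_set ?I) (subtopology tree_top ?A) (\<gamma> \<circ> seg a b)"
    using segab by (auto simp: pathin_def continuous_map_in_subtopology)
  from continuous_map_compose[OF this rc]
  have g0: "pathin mtopology g0" by (simp add: g0_def pathin_def continuous_map_in_subtopology)
  have clg0: "cl (g0 v) = \<gamma> (seg a b v)" if "v \<in> ?I" for v
    using rcl[of "\<gamma> (seg a b v)"] segab[OF that] by (simp add: g0_def)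
  have inj0: "inj_on g0 ?I"
  proof (rule inj_onI)
    fix v w assume vw: "v \<in> ?I" "w \<in> ?I" "g0 v = g0 w"
    then have "\<gamma> (seg a b v) = \<gamma> (seg a b w)" using clg0[of v] clg0[of w] by simp
    moreover have "seg a b v \<in> ?I" "seg a b w \<in> ?I" using segab[OF vw(1)] segab[OF vw(2)] ab01 by auto
    ultimately have "seg a b v = seg a b w" using inj_onD[OF \<gamma>(2)] by blast
    then show "v = w" using inj_seg[of a b] ab by (auto dest: injD)
  qed
  obtain v where v: "0 < v" "v \<le> 1" "f (g0 v) \<noteq> f (g0 0)" using nonconstant_on_arc[OF g0 inj0, of 0 1] by auto
  define g where "g = g0 \<circ> seg 0 v"
  define b' where "b' = seg a b v"
  have b': "a < b'" "b' \<le> b"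
  proof -
    have "b' = a + v * (b - a)" by (simp add: b'_def seg_def algebra_simps)
    moreover have "0 < v * (b - a)" using v ab by simp
    ultimately show "a < b'" by simp
    show "b' \<le> b" using segab[of v] v by (auto simp: b'_def)
  qed
  have "continuous_map (top_of_set ?I) mtopology g0" using g0 by (simp add: pathin_def)
  then have g: "pathin mtopology g" unfolding g_def using v by (intro pathin_seg) auto
  have gends: "g 0 = g0 0" "g 1 = g0 v" by (simp_all add: g_def)
  have clg: "\<exists>w\<in>{a..b'}. cl (g x) = \<gamma> w" if x: "x \<in> ?I" for x
  proof -
    have sx: "seg 0 v x \<in> {0..v}" using seg_in_convex[of "{0..v}" 0 v x] x v by auto
    then have sI: "seg 0 v x \<in> ?I" using v by auto
    have e: "seg a b w = a + w * (b - a)" for w by (simp add: seg_def algebra_simps)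
    have "seg a b (seg 0 v x) \<le> b'" unfolding b'_def e using sx ab by (simp add: mult_right_mono)
    then have "seg a b (seg 0 v x) \<in> {a..b'}" using segab[OF sI] by simp
    then show ?thesis using clg0[OF sI] by (auto simp: g_def)
  qed
  define Q where "Q = G \<union> {x \<in> topspace mtopology. cl x \<in> ?K \<union> \<gamma> ` {0..a} \<union> \<gamma> ` {b'..1}}"
  have "closedin mtopology {x \<in> topspace mtopology. cl x \<in> ?K \<union> \<gamma> ` {0..a} \<union> \<gamma> ` {b'..1}}"
    by (rule closedin_continuous_map_preimage[OF collapse.continuous_class], intro closedin_Un K closed_sub \<gamma>(1))
      (use ab01 ab b' in auto)
  then have clQ: "closedin mtopology Q" unfolding Q_def using arc_complex_closed[OF complex] by blast
  have gR: "g x \<in> R" if "x \<in> ?I" for x using pathin_in_topspace[OF g that] by simp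
  have endcl: "cl (g 0) = \<gamma> a" "cl (g 1) = \<gamma> b'" using clg0[of 0] clg0[of v] v gends by (auto simp: b'_def)
  have "g ` ?I \<inter> Q \<subseteq> {g 0, g 1}"
  proof
    fix y assume y: "y \<in> g ` ?I \<inter> Q"
    then obtain x where x: "x \<in> ?I" "y = g x" by auto
    obtain w where w: "w \<in> {a..b'}" "cl y = \<gamma> w" using clg[OF x(1)] x(2) by auto
    have wab: "w \<in> {a..b}" "w \<in> {s<..<t}" "w \<in> ?I" using w(1) b' ab ab01 by auto
    have yR: "y \<in> R" using gR x by simp
    have yG: "y \<notin> G" using offG[OF yR w(2) wab(1)] .
    have "cl y \<notin> ?K" using offK[OF wab(2)] w(2) by simp
    then have "cl y \<in> \<gamma> ` ({0..a} \<union> {b'..1})" using y yG unfolding Q_def image_Un by blast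
    then obtain z where z: "z \<in> {0..a} \<union> {b'..1}" "cl y = \<gamma> z" unfolding image_iff by blast
    have "z \<in> ?I" using z(1) ab01 b' ab by auto
    then have "z = w" using inj_onD[OF \<gamma>(2), of z w] z(2) w(2) wab(3) by simp
    then have "w = a \<or> w = b'" using z(1) w(1) by auto
    then have "cl y = cl (g 0) \<or> cl y = cl (g 1)" using w(2) endcl by auto
    then have "y = g 0 \<or> y = g 1"
      using collapse.glue_class_eq_iff[OF yR gR[of 0]] collapse.glue_class_eq_iff[OF yR gR[of 1]] yG by auto
    then show "y \<in> {g 0, g 1}" by blast
  qed
  moreover have "f (g 0) \<noteq> f (g 1)" using v(3) gends by simp
  ultimately obtain u where u: "circle_map mtopology u" "\<And>x. x \<in> Q \<Longrightarrow> u x = 1" "angle_incr (u \<circ> g) \<noteq> 0"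
    using circle_map_winding_path[OF g clQ] by metis
  have uG: "u x = 1" if "x \<in> G" for x using u(2) that by (simp add: Q_def)
  obtain h where h: "continuous_map mtopology euclideanreal h" "\<And>x. x \<in> R \<Longrightarrow> u x = cis (h x)"
    using circle_map_lifts[OF u(1) uG] by blast
  have hcl: "h x = h y" if "x \<in> topspace mtopology" "y \<in> topspace mtopology" "cl x = cl y" for x y
    using that collapse.glue_class_eq_iff[of x y] lift_constant_on_G[OF h uG] by auto
  obtain k where k: "continuous_map tree_top euclideanreal k" "\<And>x. x \<in> topspace mtopology \<Longrightarrow> k (cl x) = h x"
    by (rule quotient_map_lift_exists[OF collapse.quotient_class h(1)]) (use hcl in blast)+
  have const: "k (\<zeta> x) = k (\<zeta> y)"
    if \<zeta>: "pathin tree_top \<zeta>" and xy: "0 \<le> x" "x \<le> y" "y \<le> 1"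
      and sub: "\<zeta> ` {x..y} \<subseteq> ?K \<union> \<gamma> ` {0..a} \<union> \<gamma> ` {b'..1}" for \<zeta> x y
  proof -
    have "continuous_map (top_of_set ?I) euclideanreal (k \<circ> \<zeta>)"
      using \<zeta> k(1) unfolding pathin_def by (rule continuous_map_compose)
    then have "continuous_on ?I (k \<circ> \<zeta>)" by simp
    then have c: "continuous_on {x..y} (k \<circ> \<zeta>)" by (rule continuous_on_subset) (use xy in auto)
    have e: "cis ((k \<circ> \<zeta>) z) = cis ((\<lambda>_. 0) z)" if z: "z \<in> {x..y}" for z
    proof -
      have "z \<in> ?I" using z xy by auto
      then have "\<zeta> z \<in> glue_space R d G" using pathin_in_topspace[OF \<zeta>] by simp
      then obtain p where p: "p \<in> R" "\<zeta> z = cl p" using collapse.glue_spaceE by blast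
      moreover have "\<zeta> z \<in> ?K \<union> \<gamma> ` {0..a} \<union> \<gamma> ` {b'..1}" using sub imageI[OF z, of \<zeta>] by (rule subsetD)
      ultimately have "p \<in> Q" by (simp add: Q_def)
      then show ?thesis using u(2)[of p] h(2)[OF p(1)] k(2)[of p] p by simp
    qed
    have "(k \<circ> \<zeta>) x - (k \<circ> \<zeta>) y = (\<lambda>_. 0) x - (\<lambda>_. 0::real) y"
      by (rule circle_lift_unique[OF connected_Icc c continuous_on_const e]) (use xy in auto)
    then show ?thesis by simp
  qed
  have "k (\<delta> 0) = k (\<delta> 1)" by (rule const[OF \<delta>]) auto
  moreover have "k (\<gamma> 0) = k (\<gamma> a)" by (rule const[OF \<gamma>(1)]) (use ab01 in auto)
  moreover have "k (\<gamma> b') = k (\<gamma> 1)" by (rule const[OF \<gamma>(1)]) (use ab01 ab b' in auto)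
  ultimately have "k (\<gamma> a) = k (\<gamma> b')" using ends by simp
  then have "h (g 0) = h (g 1)" using endcl k(2)[of "g 0"] k(2)[of "g 1"] gR[of 0] gR[of 1] by simp
  moreover have "angle_incr (u \<circ> g) = h (g 1) - h (g 0)"
    by (rule angle_incr_in_lifted_set[of _ R]) (use g gR h in \<open>auto simp: continuous_map_from_subtopology\<close>)
  ultimately show False using u(3) by simp
qed

text \<open>Two simple paths with the same ends have the same image, so each is the other one composed with
  a homeomorphism of the interval.\<close>

theorem metric_tree_collapse: "metric_tree (glue_space R d G) (glue_metric R d G)"
  unfolding metric_tree_def
proof (intro conjI ballI impI allI)
  have iso: "\<exists>\<sigma>. isometric_path (glue_space R d G) (glue_metric R d G) \<sigma> \<and> \<sigma> 0 = C \<and> \<sigma> 1 = D"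
    if "C \<in> glue_space R d G" "D \<in> glue_space R d G" for C D
    by (rule collapse.glue_isometric_path[OF isometric_path_exists that])
  then show "geodesic_space (glue_space R d G) (glue_metric R d G)"
    by (rule collapse.GM.geodesic_spaceI)
  fix C D assume CD: "C \<in> glue_space R d G" "D \<in> glue_space R d G" "C \<noteq> D"
  obtain \<sigma> where \<sigma>: "isometric_path (glue_space R d G) (glue_metric R d G) \<sigma>" "\<sigma> 0 = C" "\<sigma> 1 = D"
    using iso[OF CD(1,2)] by blast
  have "inj_on \<sigma> {0..1}" by (rule collapse.GM.isometric_path_inj[OF \<sigma>(1)]) (use \<sigma> CD(3) in simp)
  then show "\<exists>\<gamma>. simple_path_between tree_top C D \<gamma>"
    unfolding simple_path_between_def using collapse.GM.isometric_path_imp_pathin[OF \<sigma>(1)] \<sigma>(2,3) by blast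
  fix \<gamma> \<delta> assume "simple_path_between tree_top C D \<gamma> \<and> simple_path_between tree_top C D \<delta>"
  then have \<gamma>: "pathin tree_top \<gamma>" "inj_on \<gamma> {0..1}" "\<gamma> 0 = C" "\<gamma> 1 = D"
    and \<delta>: "pathin tree_top \<delta>" "inj_on \<delta> {0..1}" "\<delta> 0 = C" "\<delta> 1 = D" by (auto simp: simple_path_between_def)
  have "\<gamma> ` {0..1} \<subseteq> \<delta> ` {0..1}" "\<delta> ` {0..1} \<subseteq> \<gamma> ` {0..1}"
    using simple_path_image_subset \<gamma> \<delta> by auto
  then have im: "\<gamma> ` {0..1} = \<delta> ` {0..1}" by simp
  obtain \<beta> where \<beta>: "continuous_map (subtopology tree_top (\<gamma> ` {0..1})) (top_of_set {0..1}) \<beta>"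
    "\<And>t. t \<in> {0..1} \<Longrightarrow> \<beta> (\<gamma> t) = t" using arc_inverse[OF collapse.GM.Hausdorff_space_mtopology \<gamma>(1,2)] by metis
  obtain \<epsilon> where \<epsilon>: "continuous_map (subtopology tree_top (\<delta> ` {0..1})) (top_of_set {0..1}) \<epsilon>"
    "\<And>t. t \<in> {0..1} \<Longrightarrow> \<epsilon> (\<delta> t) = t" using arc_inverse[OF collapse.GM.Hausdorff_space_mtopology \<delta>(1,2)] by metis
  have "continuous_map (top_of_set {0..1}) (subtopology tree_top (\<gamma> ` {0..1})) \<delta>"
    "continuous_map (top_of_set {0..1}) (subtopology tree_top (\<delta> ` {0..1})) \<gamma>"
    using \<gamma>(1) \<delta>(1) im by (auto simp: pathin_def continuous_map_in_subtopology)
  from continuous_map_compose[OF this(1) \<beta>(1)] continuous_map_compose[OF this(2) \<epsilon>(1)]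
  have c: "continuous_on {0..1} (\<beta> \<circ> \<delta>)" "(\<beta> \<circ> \<delta>) ` {0..1} \<subseteq> {0..1}"
    "continuous_on {0..1} (\<epsilon> \<circ> \<gamma>)" "(\<epsilon> \<circ> \<gamma>) ` {0..1} \<subseteq> {0..1}"
    by (simp_all add: continuous_map_in_subtopology image_subset_iff_funcset o_def)
  have \<gamma>\<beta>: "\<gamma> (\<beta> C) = C" if C: "C \<in> \<gamma> ` {0..1}" for C
  proof -
    obtain t where "t \<in> {0..1}" "C = \<gamma> t" using C by blast
    then show ?thesis using \<beta>(2) by simp
  qed
  have \<delta>\<epsilon>: "\<delta> (\<epsilon> C) = C" if C: "C \<in> \<delta> ` {0..1}" for C
  proof -
    obtain t where "t \<in> {0..1}" "C = \<delta> t" using C by blast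
    then show ?thesis using \<epsilon>(2) by simp
  qed
  have 1: "(\<epsilon> \<circ> \<gamma>) ((\<beta> \<circ> \<delta>) t) = t" "\<delta> t = \<gamma> ((\<beta> \<circ> \<delta>) t)" if t: "t \<in> {0..1}" for t
  proof -
    have "\<delta> t \<in> \<gamma> ` {0..1}" using im t by blast
    then show "(\<epsilon> \<circ> \<gamma>) ((\<beta> \<circ> \<delta>) t) = t" "\<delta> t = \<gamma> ((\<beta> \<circ> \<delta>) t)" using \<gamma>\<beta>[of "\<delta> t"] \<epsilon>(2)[OF t] by auto
  qed
  have 2: "(\<beta> \<circ> \<delta>) ((\<epsilon> \<circ> \<gamma>) t) = t" if t: "t \<in> {0..1}" for t
  proof -
    have "\<gamma> t \<in> \<delta> ` {0..1}" using im t by blast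
    then show ?thesis using \<delta>\<epsilon>[of "\<gamma> t"] \<beta>(2)[OF t] by auto
  qed
  have "homeomorphism {0..1} {0..1} (\<beta> \<circ> \<delta>) (\<epsilon> \<circ> \<gamma>)"
    by (rule homeomorphismI[OF c(1,3,2,4)]) (use 1(1) 2 in auto)
  then show "\<exists>\<phi> \<psi>. homeomorphism {0..1::real} {0..1::real} \<phi> \<psi> \<and> (\<forall>t\<in>{0..1}. \<delta> t = \<gamma> (\<phi> t))"
    using 1(2) by blast
qed

lemma finite_metric_graph_complex: "finite_metric_graph G d"
proof -
  interpret S: Submetric R d G by unfold_locales (rule G_subset)
  have "geodesic_space G d"
  proof (rule S.sub.geodesic_spaceI)
    fix x y assume xy: "x \<in> G" "y \<in> G"
    then obtain \<sigma> where \<sigma>: "isometric_path R d \<sigma>" "\<sigma> 0 = x" "\<sigma> 1 = y" using isometric_path_exists G_subset by blast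
    have "\<sigma> t \<in> G" if "t \<in> {0..1}" for t
      using isometric_path_stays[OF complex \<sigma>(1), of 0 1 t] \<sigma> xy that by simp
    then have "isometric_path G d \<sigma>" using \<sigma>(1) unfolding isometric_path_def by blast
    then show "\<exists>\<sigma>. isometric_path G d \<sigma> \<and> \<sigma> 0 = x \<and> \<sigma> 1 = y" using \<sigma> by blast
  qed
  moreover have "finite_graph S.sub.mtopology"
    using arc_complex_finite_graph[OF Hausdorff complex] S.mtopology_submetric by simp
  ultimately show ?thesis by (simp add: finite_metric_graph_def)
qed

lemma betti_complex_le: "betti 1 (Metric_space.mtopology G d) \<le> enat k"
proof -
  interpret S: Submetric R d G by unfold_locales (rule G_subset)
  show ?thesis using arc_complex_betti_le[OF Hausdorff complex] S.mtopology_submetric by simp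
qed

lemma is_core_complex: "is_core R d G"
  unfolding is_core_def compact_metric_space_def
  using Metric_space_axioms compact collapse.closed collapse.nonempty metric_tree_collapse by blast

end

section \<open>Arc complexes in the Reeb space and cycles in the original space\<close>

context reeb_setup
begin

lemma path_connected: "path_connected_space mtopology"
  unfolding path_connected_space_def using geodesics by fastforce

text \<open>A geodesic from \<open>x\<close> to a nearby point stays near \<open>x\<close>, where all the maps vary little; their
  increments are then principal arguments, which depend on the end point alone.\<close>

lemma winding_increment_locally:
  fixes k :: nat
  assumes v: "\<And>i. i < k \<Longrightarrow> circle_map mtopology (v i)"
    and h: "\<And>g. pathin mtopology g \<Longrightarrow> h (g 1) - h (g 0) = (\<Sum>i<k. a i * angle_incr (v i \<circ> g))"
    and x: "x \<in> M"
  shows "\<exists>r>0. \<forall>y\<in>M. d x y < r \<longrightarrow> h y - h x = (\<Sum>i<k. a i * Arg (v i y / v i x))"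
proof -
  have nv: "norm (v i y) = 1" if "i < k" "y \<in> M" for i y using v[OF that(1)] that(2) by (simp add: circle_map_def)
  have "\<exists>r>0. \<forall>y\<in>M. d x y < r \<longrightarrow> dist (v i x) (v i y) < 1" if i: "i < k" for i
  proof -
    have "continuous_map mtopology Met_TC.mtopology (v i)" using v[OF i] by (simp add: circle_map_def)
    then show ?thesis using x unfolding metric_continuous_map[OF Met_TC.Metric_space_axioms] by (meson zero_less_one)
  qed
  then obtain \<rho> where \<rho>: "\<And>i. i < k \<Longrightarrow> \<rho> i > 0" "\<And>i y. i < k \<Longrightarrow> y \<in> M \<Longrightarrow> d x y < \<rho> i \<Longrightarrow> dist (v i x) (v i y) < 1"
    by metis
  define r where "r = Min (insert 1 (\<rho> ` {..<k}))"
  have "0 < r" unfolding r_def using \<rho>(1) by (subst Min_gr_iff) auto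
  moreover have "r \<le> \<rho> i" if "i < k" for i unfolding r_def using that by (intro Min_le) auto
  ultimately have r: "r > 0" "\<And>i. i < k \<Longrightarrow> r \<le> \<rho> i" by simp_all
  have "h y - h x = (\<Sum>i<k. a i * Arg (v i y / v i x))" if y: "y \<in> M" "d x y < r" for y
  proof -
    obtain \<gamma> where \<gamma>: "pathin mtopology \<gamma>" "\<gamma> 0 = x" "\<gamma> 1 = y" "path_length d \<gamma> = ennreal (d x y)"
      using geodesics x y by blast
    have \<gamma>M: "\<gamma> t \<in> M" if "t \<in> {0..1}" for t using pathin_in_topspace[OF \<gamma>(1) that] by simp
    have near: "d x (\<gamma> t) < r" if t: "t \<in> {0..1}" for t
    proof -
      have "ennreal (d x (\<gamma> t)) \<le> ennreal (d x y)"
        using path_length_ge_dist[of 0 t d \<gamma>] t \<gamma> by simp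
      then show ?thesis using y(2) by simp
    qed
    have "angle_incr (v i \<circ> \<gamma>) = Arg (v i y / v i x)" if i: "i < k" for i
    proof -
      have "continuous_map (top_of_set {0..1}) euclidean (v i \<circ> \<gamma>)"
        using \<gamma>(1) v[OF i] unfolding pathin_def circle_map_def by (meson continuous_map_compose)
      then have c: "continuous_on {0..1} (v i \<circ> \<gamma>)" by simp
      have "angle_incr (v i \<circ> \<gamma>) = Arg ((v i \<circ> \<gamma>) 1 / (v i \<circ> \<gamma>) 0)"
      proof (rule angle_incr_short[OF c])
        fix t :: real assume t: "t \<in> {0..1}"
        show "norm ((v i \<circ> \<gamma>) t) = 1" using nv[OF i \<gamma>M[OF t]] by simp
        have "d x (\<gamma> t) < \<rho> i" using near[OF t] r(2)[OF i] by simp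
        then show "norm ((v i \<circ> \<gamma>) t - (v i \<circ> \<gamma>) 0) < 1"
          using \<rho>(2)[OF i \<gamma>M[OF t]] \<gamma>(2) by (simp add: dist_norm norm_minus_commute)
      qed
      then show ?thesis using \<gamma> by simp
    qed
    then show ?thesis using h[OF \<gamma>(1)] \<gamma> by simp
  qed
  then show ?thesis using r(1) by blast
qed

text \<open>By the local formula the potential \<open>h\<close> is locally constant on each class, and classes are connected;
  so \<open>h\<close> factors through \<open>q\<close>. The local formula passes to the quotient because \<open>q\<close> is closed: a
  neighbourhood of a whole class contains the preimage of a ball of \<open>R\<close>. Paths of \<open>R\<close> need not lift
  to \<open>M\<close>, so the formula is summed up along a path of \<open>R\<close> by a connectedness argument on the
  interval.\<close>

lemma potential_descends:
  fixes k :: nat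
  assumes u: "\<And>i. i < k \<Longrightarrow> circle_map RM.mtopology (u i)"
    and h: "\<And>g. pathin mtopology g \<Longrightarrow> h (g 1) - h (g 0) = (\<Sum>i<k. a i * angle_incr (u i \<circ> q \<circ> g))"
  obtains hb where "\<And>g. pathin RM.mtopology g \<Longrightarrow> hb (g 1) - hb (g 0) = (\<Sum>i<k. a i * angle_incr (u i \<circ> g))"
proof -
  have nu: "norm (u i C) = 1" if "i < k" "C \<in> R" for i C using u[OF that(1)] that(2) by (simp add: circle_map_def)
  have v: "circle_map mtopology (u i \<circ> q)" if "i < k" for i
    using u[OF that] continuous_map_compose[OF continuous_q_metric] unfolding circle_map_def by auto
  define good where "good x r \<longleftrightarrow> r > 0 \<and> (\<forall>y\<in>M. d x y < r \<longrightarrow> h y - h x = (\<Sum>i<k. a i * Arg (u i (q y) / u i (q x))))"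
    for x and r :: real
  have "\<exists>r. good x r" if "x \<in> M" for x
    using winding_increment_locally[of k "\<lambda>i. u i \<circ> q" h a x] v h that by (auto simp: good_def)
  then obtain r where "\<And>x. x \<in> M \<Longrightarrow> good x (r x)" by metis
  then have r: "\<And>x. x \<in> M \<Longrightarrow> r x > 0"
    "\<And>x y. x \<in> M \<Longrightarrow> y \<in> M \<Longrightarrow> d x y < r x \<Longrightarrow> h y - h x = (\<Sum>i<k. a i * Arg (u i (q y) / u i (q x)))"
    by (auto simp: good_def)
  have near_eq: "h y = h x" if "x \<in> M" "y \<in> M" "d x y < r x" "q x = q y" for x y
  proof -
    have "a i * Arg (u i (q y) / u i (q x)) = 0" if i: "i < k" for i
    proof -
      have "u i (q x) \<noteq> 0" using nu[OF i, of "q x"] \<open>x \<in> M\<close> by auto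
      then show ?thesis using \<open>q x = q y\<close> by simp
    qed
    then have "(\<Sum>i<k. a i * Arg (u i (q y) / u i (q x))) = 0" by (intro sum.neutral) simp
    then show ?thesis using r(2)[OF that(1-3)] by linarith
  qed
  have class_const: "h y = h x" if xy: "x \<in> M" "y \<in> q x" for x y
  proof (rule ccontr)
    assume ne: "h y \<noteq> h x"
    define E where "E S = (\<Union>z\<in>S. mball z (r z))" for S
    let ?S1 = "{z \<in> q x. h z = h x}" and ?S2 = "{z \<in> q x. h z \<noteq> h x}"
    have op: "openin mtopology (E S)" for S unfolding E_def by (intro openin_Union) auto
    have inE: "z \<in> E S" if "z \<in> S" "z \<in> q x" for z S
      unfolding E_def using that class_subset[OF that(2)] r(1)[of z] by (intro UN_I[of z]) auto
    have val: "h w = h z" if "z \<in> q x" "w \<in> q x" "w \<in> mball z (r z)" for z w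
      using near_eq[of z w] that class_eq[OF that(1)] class_eq[OF that(2)] by auto
    have cov: "q x \<subseteq> E ?S1 \<union> E ?S2"
    proof
      fix z assume z: "z \<in> q x"
      show "z \<in> E ?S1 \<union> E ?S2"
      proof (cases "h z = h x")
        case True
        then show ?thesis using z by (intro UnI1 inE) auto
      next
        case False
        then show ?thesis using z by (intro UnI2 inE) auto
      qed
    qed
    have dis: "E ?S1 \<inter> E ?S2 \<inter> q x = {}"
    proof -
      have False if w: "w \<in> E ?S1" "w \<in> E ?S2" "w \<in> q x" for w
      proof -
        obtain z1 z2 where z: "z1 \<in> ?S1" "w \<in> mball z1 (r z1)" "z2 \<in> ?S2" "w \<in> mball z2 (r z2)" using w(1,2) unfolding E_def by blast
        then show False using val[of z1 w] val[of z2 w] w(3) by auto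
      qed
      then show ?thesis by blast
    qed
    have "x \<in> E ?S1" "y \<in> E ?S2" using inE[of x ?S1] inE[of y ?S2] class_refl[OF xy(1)] xy(2) ne by auto
    then show False using connectedinD[OF class_connected op op cov dis] class_refl[OF xy(1)] xy(2) by blast
  qed
  define hb where "hb C = h (SOME x. x \<in> C)" for C
  have hbq: "hb (q x) = h x" if "x \<in> M" for x
  proof -
    have "(SOME z. z \<in> q x) \<in> q x" using class_refl[OF that] by (rule someI)
    then show ?thesis using class_const[OF that] by (simp add: hb_def)
  qed
  have local: "\<exists>\<rho>>0. \<forall>D\<in>R. rd C D < \<rho> \<longrightarrow> hb D - hb C = (\<Sum>i<k. a i * Arg (u i D / u i C))" if C: "C \<in> R" for C
  proof -
    obtain x0 where x0: "x0 \<in> M" "C = q x0" using reeb_spaceE[OF C] by blast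
    define W where "W = (\<Union>x\<in>q x0. mball x (r x))"
    have "openin mtopology W" unfolding W_def by (intro openin_Union) auto
    then have "closedin mtopology (topspace mtopology - W)" by blast
    moreover have "closed_map mtopology RM.mtopology q"
      by (rule continuous_imp_closed_map[OF continuous_q_metric compact RM.Hausdorff_space_mtopology])
    ultimately have "closedin RM.mtopology (q ` (topspace mtopology - W))" unfolding closed_map_def by blast
    then have op: "openin RM.mtopology (topspace RM.mtopology - q ` (topspace mtopology - W))" by blast
    have "C \<notin> q ` (topspace mtopology - W)"
    proof
      assume "C \<in> q ` (topspace mtopology - W)"
      then obtain y where y: "y \<in> M" "y \<notin> W" "C = q y" by auto
      then have "y \<in> q x0" using class_refl[of y] x0(2) by simp
      moreover have "y \<in> mball y (r y)" using y(1) r(1) by simp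
      ultimately show False using y(2) unfolding W_def by blast
    qed
    then have "C \<in> topspace RM.mtopology - q ` (topspace mtopology - W)" using C by simp
    then obtain \<rho> where \<rho>: "\<rho> > 0" "RM.mball C \<rho> \<subseteq> topspace RM.mtopology - q ` (topspace mtopology - W)"
      using op unfolding RM.openin_mtopology by blast
    have "hb D - hb C = (\<Sum>i<k. a i * Arg (u i D / u i C))" if D: "D \<in> R" "rd C D < \<rho>" for D
    proof -
      obtain y where y: "y \<in> M" "D = q y" using reeb_spaceE[OF D(1)] by blast
      have "D \<in> RM.mball C \<rho>" using C D by simp
      then have "D \<notin> q ` (topspace mtopology - W)" using \<rho>(2) by blast
      then have "y \<in> W" using y by auto
      then obtain x where x: "x \<in> q x0" "x \<in> M" "d x y < r x" unfolding W_def by auto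
      have "C = q x" using class_eq[OF x(1)] x0(2) by simp
      then show ?thesis using r(2)[OF x(2) y(1) x(3)] hbq x(2) y by simp
    qed
    then show ?thesis using \<rho>(1) by blast
  qed
  have "hb (g 1) - hb (g 0) = (\<Sum>i<k. a i * angle_incr (u i \<circ> g))" if g: "pathin RM.mtopology g" for g
  proof -
    have "\<forall>i\<in>{..<k}. \<exists>l. continuous_on {0..1} l \<and> (\<forall>t\<in>{0..1}. u i (g t) = cis (l t)) \<and> angle_incr (u i \<circ> g) = l 1 - l 0"
    proof
      fix i assume "i \<in> {..<k}"
      then have "circle_map RM.mtopology (u i)" using u by simp
      from circle_map_path_lift[OF this g] show "\<exists>l. continuous_on {0..1} l \<and> (\<forall>t\<in>{0..1}. u i (g t) = cis (l t)) \<and> angle_incr (u i \<circ> g) = l 1 - l 0"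
        by metis
    qed
    from bchoice[OF this] obtain l where "\<forall>i\<in>{..<k}. continuous_on {0..1} (l i) \<and>
      (\<forall>t\<in>{0..1}. u i (g t) = cis (l i t)) \<and> angle_incr (u i \<circ> g) = l i 1 - l i 0" by blast
    then have l: "\<And>i. i < k \<Longrightarrow> continuous_on {0..1} (l i)"
      "\<And>i t. i < k \<Longrightarrow> t \<in> {0..1} \<Longrightarrow> u i (g t) = cis (l i t)" "\<And>i. i < k \<Longrightarrow> angle_incr (u i \<circ> g) = l i 1 - l i 0"
      by blast+
    \<comment> \<open>the claim is that \<open>\<Psi>\<close> has equal values at \<open>0\<close> and \<open>1\<close>; it is locally constant\<close>
    define \<Psi> where "\<Psi> t = hb (g t) - (\<Sum>i<k. a i * l i t)" for t
    have gR: "g t \<in> R" if "t \<in> {0..1}" for t using pathin_in_topspace[OF g that] by simp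
    have loc: "\<exists>\<delta>>0. \<forall>t\<in>{0..1}. \<bar>t - x\<bar> < \<delta> \<longrightarrow> \<Psi> t = \<Psi> x" if x: "x \<in> {0..1}" for x
    proof -
      obtain \<rho> where \<rho>: "\<rho> > 0" "\<And>D. D \<in> R \<Longrightarrow> rd (g x) D < \<rho> \<Longrightarrow> hb D - hb (g x) = (\<Sum>i<k. a i * Arg (u i D / u i (g x)))"
        using local[OF gR[OF x]] by blast
      have "continuous_map (top_of_set {0..1}) euclideanreal (rd (g x) \<circ> g)"
        using g RM.continuous_map_dist_point[OF gR[OF x]] unfolding pathin_def by (rule continuous_map_compose)
      then have "continuous_on {0..1} (rd (g x) \<circ> g)" by simp
      then have "((rd (g x) \<circ> g) \<longlongrightarrow> (rd (g x) \<circ> g) x) (at x within {0..1})" using x unfolding continuous_on_def by blast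
      moreover have "(rd (g x) \<circ> g) x < \<rho>" using gR[OF x] \<rho>(1) by simp
      ultimately have e1: "eventually (\<lambda>t. (rd (g x) \<circ> g) t < \<rho>) (at x within {0..1})" by (rule order_tendstoD(2))
      have "eventually (\<lambda>t. \<forall>i\<in>{..<k}. dist (l i t) (l i x) < pi) (at x within {0..1})"
      proof (rule eventually_ball_finite)
        show "\<forall>i\<in>{..<k}. eventually (\<lambda>t. dist (l i t) (l i x) < pi) (at x within {0..1})"
        proof
          fix i assume "i \<in> {..<k}"
          then have "(l i \<longlongrightarrow> l i x) (at x within {0..1})" using l(1)[of i] x by (simp add: continuous_on_def)
          then show "eventually (\<lambda>t. dist (l i t) (l i x) < pi) (at x within {0..1})" using pi_gt_zero by (rule tendstoD)
        qed
      qed simp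
      with e1 have "eventually (\<lambda>t. (rd (g x) \<circ> g) t < \<rho> \<and> (\<forall>i\<in>{..<k}. dist (l i t) (l i x) < pi)) (at x within {0..1})"
        by (rule eventually_conj)
      then obtain \<delta> where \<delta>: "\<delta> > 0" "\<And>t. t \<in> {0..1} \<Longrightarrow> t \<noteq> x \<Longrightarrow> dist t x < \<delta> \<Longrightarrow>
          rd (g x) (g t) < \<rho> \<and> (\<forall>i<k. dist (l i t) (l i x) < pi)"
        unfolding eventually_at by auto
      have "\<Psi> t = \<Psi> x" if t: "t \<in> {0..1}" "\<bar>t - x\<bar> < \<delta>" for t
      proof (cases "t = x")
        case False
        then have n: "rd (g x) (g t) < \<rho>" "\<And>i. i < k \<Longrightarrow> dist (l i t) (l i x) < pi"
          using \<delta>(2)[OF t(1)] t(2) by (auto simp: dist_real_def)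
        have "Arg (u i (g t) / u i (g x)) = l i t - l i x" if i: "i < k" for i
        proof -
          have "u i (g t) / u i (g x) = cis (l i t - l i x)" using l(2)[OF i] t(1) x by (simp add: cis_divide)
          moreover have "l i t - l i x \<in> {-pi<..pi}" using n(2)[OF i] by (auto simp: dist_real_def)
          ultimately show ?thesis by (simp add: Arg_cis)
        qed
        then have "hb (g t) - hb (g x) = (\<Sum>i<k. a i * (l i t - l i x))" using \<rho>(2)[OF gR[OF t(1)] n(1)] by simp
        then show ?thesis by (simp add: \<Psi>_def algebra_simps sum_subtractf)
      qed simp
      then show ?thesis using \<delta>(1) by blast
    qed
    have "0 \<le> (0::real) \<longrightarrow> (1::real) \<le> 1 \<longrightarrow> \<Psi> 0 = \<Psi> 1"
    proof (rule Bolzano[where P = "\<lambda>s t. 0 \<le> s \<longrightarrow> t \<le> 1 \<longrightarrow> \<Psi> s = \<Psi> t"])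
      fix x :: real assume "0 \<le> x" "x \<le> 1"
      then obtain \<delta> where \<delta>: "\<delta> > 0" "\<And>t. t \<in> {0..1} \<Longrightarrow> \<bar>t - x\<bar> < \<delta> \<Longrightarrow> \<Psi> t = \<Psi> x" using loc[of x] by (meson atLeastAtMost_iff)
      show "\<exists>\<delta>>0. \<forall>s t. s \<le> x \<and> x \<le> t \<and> t - s < \<delta> \<longrightarrow> 0 \<le> s \<longrightarrow> t \<le> 1 \<longrightarrow> \<Psi> s = \<Psi> t"
      proof (intro exI[of _ \<delta>] conjI allI impI \<delta>(1))
        fix s t assume "s \<le> x \<and> x \<le> t \<and> t - s < \<delta>" "0 \<le> s" "t \<le> 1"
        then show "\<Psi> s = \<Psi> t" using \<delta>(2)[of s] \<delta>(2)[of t] by auto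
      qed
    qed auto
    then show ?thesis by (simp add: \<Psi>_def l(3) algebra_simps sum_subtractf)
  qed
  then show ?thesis by (rule that)
qed

lemma arc_complex_le_betti:
  assumes "arc_complex RM.mtopology k \<Gamma>"
  shows "enat k \<le> betti 1 mtopology"
proof -
  obtain u where u: "\<And>i. i < k \<Longrightarrow> circle_map RM.mtopology (u i)"
    and indep: "\<And>a h. (\<And>g. pathin (subtopology RM.mtopology \<Gamma>) g \<Longrightarrow> h (g 1) - h (g 0) = (\<Sum>i<k. a i * angle_incr (u i \<circ> g)))
       \<Longrightarrow> (\<forall>i<k. a i = (0::real))"
    using light_map.arc_complex_independent_windings[OF light_map_reeb assms] by blast
  show ?thesis
  proof (rule betti_ge_independent_windings[where u = "\<lambda>i. u i \<circ> q"])
    show "circle_map mtopology (u i \<circ> q)" if "i < k" for i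
      using u[OF that] continuous_map_compose[OF continuous_q_metric] unfolding circle_map_def by auto
    fix a assume zero: "\<And>z. z \<in> real_cycles 1 mtopology \<Longrightarrow> (\<Sum>i<k. a i * winding_functional (u i \<circ> q) z) = 0"
    obtain h where h: "\<And>g. pathin mtopology g \<Longrightarrow> h (g 1) - h (g 0) = (\<Sum>i<k. a i * angle_incr (u i \<circ> q \<circ> g))"
      using winding_potential[where u = "\<lambda>i. u i \<circ> q", OF path_connected zero] by blast
    obtain hb where hb: "\<And>g. pathin RM.mtopology g \<Longrightarrow> hb (g 1) - hb (g 0) = (\<Sum>i<k. a i * angle_incr (u i \<circ> g))"
      using potential_descends[OF u h] by blast
    show "\<forall>i<k. a i = 0"
      by (rule indep[of hb]) (use hb in \<open>auto simp: pathin_subtopology\<close>)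
  qed
qed

end

text \<open>The empty space carries no singular simplices; needed for the empty Reeb space.\<close>

lemma betti_empty: "betti 1 trivial_topology \<le> 0"
proof -
  have "\<not> singular_simplex 1 (trivial_topology :: 'a topology) \<sigma>" for \<sigma>
  proof
    assume "singular_simplex 1 (trivial_topology :: 'a topology) \<sigma>"
    from pathin_in_topspace[OF singular_1_simplex_is_path(1)[OF this], of 0] show False by simp
  qed
  then have "singular_simplex_set 1 (trivial_topology :: 'a topology) = {}" by blast
  then have "real_chains 1 (trivial_topology :: 'a topology) \<subseteq> {0}"
    unfolding real_chains_def by (simp only: subset_empty keys_eq_empty) simp
  then have "real_cycles 1 (trivial_topology :: 'a topology) \<subseteq> span ({} \<union> real_boundaries 1 trivial_topology)"
    by (auto simp: real_cycles_def intro: span_zero)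
  from homology_basis_from_spanning[OF _ _ this] show ?thesis by (simp add: zero_enat_def)
qed

section \<open>Structure of the Reeb metric graph\<close>

theorem theorem4:
  fixes M :: "'a set" and d :: "'a \<Rightarrow> 'a \<Rightarrow> real" and f :: "'a \<Rightarrow> real"
  assumes "geodesic_space M d"
    and "compact_metric_space M d"
    and "\<forall>x\<in>M. \<forall>y\<in>M. \<bar>f x - f y\<bar> \<le> d x y"
  shows "compact_metric_space (reeb_space M d f) (reeb_dist M d f) \<and>
    geodesic_space (reeb_space M d f) (reeb_dist M d f) \<and>
    covering_dim_le (Metric_space.mtopology (reeb_space M d f) (reeb_dist M d f)) 1 \<and>
    (betti 1 (Metric_space.mtopology M d) < \<infinity> \<longrightarrow>
      (\<exists>G. is_core (reeb_space M d f) (reeb_dist M d f) G \<and>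
           finite_metric_graph G (reeb_dist M d f) \<and>
           betti 1 (Metric_space.mtopology G (reeb_dist M d f))
             \<le> betti 1 (Metric_space.mtopology M d)))"
proof -
  have Md: "Metric_space M d" using assms(1) by (simp add: geodesic_space_def)
  interpret reeb_setup M d f
  proof (intro reeb_setup.intro Md reeb_setup_axioms.intro)
    show "compact_space (Metric_space.mtopology M d)" using assms(2) by (simp add: compact_metric_space_def)
  qed (use assms(1,3) in \<open>auto simp: geodesic_space_def\<close>)
  have comp: "compact_metric_space R rd"
    using Metric_space_reeb compact_reeb by (simp add: compact_metric_space_def)
  have "\<exists>G. is_core R rd G \<and> finite_metric_graph G rd \<and> betti 1 (Metric_space.mtopology G rd) \<le> betti 1 mtopology"
    if fin: "betti 1 mtopology < \<infinity>"
  proof (cases "M = {}")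
    case True
    then have R: "R = {}" by (simp add: reeb_space_def)
    have gl: "glue_space {} rd {} = {}" by (simp add: glue_space_def)
    have gm: "Metric_space {} (glue_metric {} rd {})" by unfold_locales (simp_all add: glue_metric_def glue_dist_def)
    have top: "RM.mtopology = trivial_topology" using R RM.topspace_mtopology by (metis null_topspace_iff_trivial)
    have "is_core R rd {}"
      using comp gm R by (simp add: is_core_def gl metric_tree_def geodesic_space_def)
    moreover have "finite_metric_graph {} rd"
      using Metric_space_reeb top R by (auto simp: finite_metric_graph_def geodesic_space_def finite_graph_def)
    moreover have "betti 1 (Metric_space.mtopology {} rd) \<le> betti 1 mtopology"
      using betti_empty[where 'a = "'a set"] top R by simp
    ultimately show ?thesis by blast
  next
    case False
    obtain n where n: "betti 1 mtopology = enat n" using fin by (cases "betti 1 mtopology") auto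
    let ?P = "\<lambda>k. \<exists>G. arc_complex RM.mtopology k G"
    obtain C where "C \<in> R" using False by (auto simp: reeb_space_def)
    then have "?P 0" using arc_complex.point[of C RM.mtopology] by auto
    moreover have bound: "k \<le> n" if "?P k" for k using that arc_complex_le_betti n by fastforce
    ultimately obtain k where k: "?P k" "\<And>j. ?P j \<Longrightarrow> j \<le> k" using GreatestI_nat[of ?P 0 n] Greatest_le_nat[of ?P _ n] by blast
    obtain G where G: "arc_complex RM.mtopology k G" using k(1) by blast
    interpret maximal_arc_complex R rd fb k G
    proof (intro maximal_arc_complex.intro light_geodesic.intro light_geodesic_axioms.intro maximal_arc_complex_axioms.intro)
      show "\<not> arc_complex RM.mtopology (Suc k) \<Gamma>" for \<Gamma> using k(2)[of "Suc k"] by auto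
    qed (use Metric_space_reeb light_map_reeb reeb_isometric_path G in auto)
    have "betti 1 (Metric_space.mtopology G rd) \<le> betti 1 (Metric_space.mtopology M d)"
      using betti_complex_le arc_complex_le_betti[OF G] by (rule order_trans)
    then show ?thesis using is_core_complex finite_metric_graph_complex by blast
  qed
  then show ?thesis
    using comp geodesic_reeb light_map.covering_dim_le_1[OF light_map_reeb] by blast
qed

end
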